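(* Let $d\ge2$. A topologically typical $d$-dimensional Archimedean copula $C$ has full support, has degenerated discrete component and is not absolutely continuous; that is, the set of all $C\in\mathcal{C}_{ar}^d$ satisfying $\mathrm{supp}(\mu_C)=\mathbb{I}^d$, $\mu_C^{dis}(\mathbb{I}^d)=0$ and $\mu_C^{abs}(\mathbb{I}^d)\neq 1$ is co-meager in $(\mathcal{C}_{ar}^d,d_\infty)$.
   Context: Notation: $\mathbb{I}=[0,1]$; $\inf\emptyset=\infty$. The support of a finite Borel measure is the complement of the union of all open sets of measure $0$. The uniform metric is $d_\infty(A,B)=\sup_{\mathbf{x}\in\mathbb{I}^d}|A(\mathbf{x})-B(\mathbf{x})|$. A subset of a topological space is meager (of first Baire category) if it can be covered by countably many nowhere dense sets, and co-meager if its complement is meager. A generator is a continuous non-increasing $\psi:[0,\infty)\to\mathbb{I}$ with $\psi(0)=1$, $\psi(\infty):=\lim_{z\to\infty}\psi(z)=0$, strictly decreasing on $[0,\inf\{x:\psi(x)=0\})$; its pseudo-inverse is $\varphi(y)=\inf\{z\in[0,\infty]:\psi(z)=y\}$, $y\in\mathbb{I}$. $\mathcal{C}_{ar}^d$ is the set of $d$-dimensional Archimedean copulas, i.e. copulas of the form $C(\mathbf{x})=\psi(\sum_{i=1}^d\varphi(x_i))$ (this function is a copula iff $\psi$ is $d$-monotone, i.e., with $\psi$ continuous on $[0,\infty)$, on $(0,\infty)$ $\psi$ is differentiable up to order $d-2$, $(-1)^k\psi^{(k)}\ge0$ for $k\le d-2$, and $(-1)^{d-2}\psi^{(d-2)}$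 is non-increasing and convex). $\mu_C$ is the probability measure on $\mathbb{I}^d$ with distribution function $C$; $C^{1:d-1}$ is the marginal copula of the first $d-1$ coordinates, with measure $\mu_{C^{1:d-1}}$ (always absolutely continuous for $C\in\mathcal{C}_{ar}^d$). A finite measure is called discrete if it is concentrated on a countable set, and singular if it has no point masses and is concentrated on a Lebesgue null set. Let $K_C:\mathbb{I}^{d-1}\times\mathcal{B}(\mathbb{I})\to\mathbb{I}$ be (a version of) the regular conditional distribution of the last coordinate given the first $d-1$ under $\mu_C$, and for each $\mathbf{x}$ let $K_C(\mathbf{x},\cdot)=K_C^{abs}(\mathbf{x},\cdot)+K_C^{dis}(\mathbf{x},\cdot)+K_C^{sing}(\mathbf{x},\cdot)$ be its decomposition into absolutely continuous, discrete and singular (i.e. having no point masses and concentrated on a Lebesgue null set) parts; these are sub-Markov kernels. For $\ast\in\{abs,dis,sing\}$ the measure $\mu_C^{\ast}$ on $\mathbb{I}^d$ is defined by $\mu_C^{\ast}(E\times F)=\int_E K_C^{\ast}(\mathbf{x},F)\,d\mu_{C^{1:d-1}}(\mathbf{x})$ for Borel $E\subseteq\mathbb{I}^{d-1}$, $F\subseteq\mathbb{I}$. $C$ is called absolutely continuous if $\mu_C^{abs}(\mathbb{I}^d)=1$. *)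

theory Defs
  imports "HOL-Probability.Probability"
begin

section \<open>The unit cube and measures on it\<close>

text \<open>
  Points of the cube are functions on the index set \<open>{..<d}\<close>, extended by
  \<^const>\<open>undefined\<close>, so that they form the space of the product measure \<^const>\<open>PiM\<close>. The
  coordinate with index \<open>d - 1\<close> is the last one.
\<close>

definition cube :: "nat \<Rightarrow> (nat \<Rightarrow> real) set" where
  "cube d = {..<d} \<rightarrow>\<^sub>E {0..1}"

abbreviation unit_borel :: "real measure" where
  "unit_borel \<equiv> restrict_space borel {0..1}"

abbreviation unit_lebesgue :: "real measure" where
  "unit_lebesgue \<equiv> restrict_space lborel {0..1}"

abbreviation cube_borel :: "nat \<Rightarrow> (nat \<Rightarrow> real) measure" where
  "cube_borel d \<equiv> PiM {..<d} (\<lambda>_. unit_borel)"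

abbreviation cube_topology :: "nat \<Rightarrow> (nat \<Rightarrow> real) topology" where
  "cube_topology d \<equiv> product_topology (\<lambda>_. top_of_set {0..1}) {..<d}"

lemma space_cube_borel: "space (cube_borel d) = cube d"
  by (simp add: cube_def space_PiM space_restrict_space)

lemma topspace_cube_topology: "topspace (cube_topology d) = cube d"
  by (simp add: cube_def)

definition measure_support :: "'a topology \<Rightarrow> 'a measure \<Rightarrow> 'a set" where
  "measure_support X M = topspace X - \<Union>{U. openin X U \<and> emeasure M U = 0}"


section \<open>Copulas\<close>

definition has_distribution_function ::
    "nat \<Rightarrow> (nat \<Rightarrow> real) measure \<Rightarrow> ((nat \<Rightarrow> real) \<Rightarrow> real) \<Rightarrow> bool" where
  "has_distribution_function d M C \<longleftrightarrow>
     prob_space M \<and> sets M = sets (cube_borel d) \<and>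
     (\<forall>x \<in> cube d. C x = measure M {y \<in> cube d. \<forall>i<d. y i \<le> x i})"

text \<open>
  A copula is a distribution function on the cube whose univariate margins are uniform. It is
  required to be extensional, so that copulas are equal iff they agree on the cube.
\<close>

definition copula :: "nat \<Rightarrow> ((nat \<Rightarrow> real) \<Rightarrow> real) \<Rightarrow> bool" where
  "copula d C \<longleftrightarrow> C \<in> extensional (cube d) \<and>
     (\<exists>M. has_distribution_function d M C \<and>
          (\<forall>i<d. distr M unit_borel (\<lambda>y. y i) = unit_lebesgue))"

definition copula_measure :: "nat \<Rightarrow> ((nat \<Rightarrow> real) \<Rightarrow> real) \<Rightarrow> (nat \<Rightarrow> real) measure" where
  "copula_measure d C = (THE M. has_distribution_function d M C)"

definition first_margin :: "nat \<Rightarrow> ((nat \<Rightarrow> real) \<Rightarrow> real) \<Rightarrow> (nat \<Rightarrow> real) \<Rightarrow> real" where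
  "first_margin d C = restrict (\<lambda>x. C (x(d - 1 := 1))) (cube (d - 1))"

text \<open>
  The supremum is over a bounded set whenever \<open>A\<close> and \<open>B\<close> are copulas. The value \<open>0\<close>
  otherwise is only there because \<^locale>\<open>Metric_space\<close> demands a distance that is nonnegative
  on the whole type.
\<close>

definition uniform_dist ::
    "nat \<Rightarrow> ((nat \<Rightarrow> real) \<Rightarrow> real) \<Rightarrow> ((nat \<Rightarrow> real) \<Rightarrow> real) \<Rightarrow> real" where
  "uniform_dist d A B =
     (if bdd_above ((\<lambda>x. \<bar>A x - B x\<bar>) ` cube d) then SUP x \<in> cube d. \<bar>A x - B x\<bar> else 0)"


section \<open>Archimedean copulas\<close>

definition generator :: "(real \<Rightarrow> real) \<Rightarrow> bool" where
  "generator \<psi> \<longleftrightarrow>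
     \<psi> ` {0..} \<subseteq> {0..1} \<and> continuous_on {0..} \<psi> \<and> antimono_on {0..} \<psi> \<and>
     \<psi> 0 = 1 \<and> (\<psi> \<longlongrightarrow> 0) at_top \<and>
     strict_antimono_on {z. 0 \<le> z \<and> ennreal z < (INF x \<in> {x. 0 \<le> x \<and> \<psi> x = 0}. ennreal x)} \<psi>"

definition generator_ext :: "(real \<Rightarrow> real) \<Rightarrow> ennreal \<Rightarrow> real" where
  "generator_ext \<psi> z = (if z = \<top> then Lim at_top \<psi> else \<psi> (enn2real z))"

definition pseudo_inverse :: "(real \<Rightarrow> real) \<Rightarrow> real \<Rightarrow> ennreal" where
  "pseudo_inverse \<psi> y = Inf {z. generator_ext \<psi> z = y}"

definition archimedean_copulas :: "nat \<Rightarrow> ((nat \<Rightarrow> real) \<Rightarrow> real) set" where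
  "archimedean_copulas d = {C. copula d C \<and>
     (\<exists>\<psi>. generator \<psi> \<and>
       (\<forall>x \<in> cube d. C x = generator_ext \<psi> (\<Sum>i<d. pseudo_inverse \<psi> (x i))))}"


section \<open>Conditional distributions and their decomposition\<close>

text \<open>Markov kernels are the measurable maps into the Giry monad \<^const>\<open>prob_algebra\<close>.\<close>

definition rectangle :: "nat \<Rightarrow> (nat \<Rightarrow> real) set \<Rightarrow> real set \<Rightarrow> (nat \<Rightarrow> real) set" where
  "rectangle d E F = {y \<in> cube d. restrict y {..<d - 1} \<in> E \<and> y (d - 1) \<in> F}"

definition is_conditional_kernel ::
    "nat \<Rightarrow> ((nat \<Rightarrow> real) \<Rightarrow> real) \<Rightarrow> ((nat \<Rightarrow> real) \<Rightarrow> real measure) \<Rightarrow> bool" where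
  "is_conditional_kernel d C K \<longleftrightarrow>
     K \<in> cube_borel (d - 1) \<rightarrow>\<^sub>M prob_algebra unit_borel \<and>
     (\<forall>E \<in> sets (cube_borel (d - 1)). \<forall>F \<in> sets unit_borel.
        emeasure (copula_measure d C) (rectangle d E F) =
        (\<integral>\<^sup>+x\<in>E. emeasure (K x) F \<partial>copula_measure (d - 1) (first_margin d C)))"

definition conditional_kernel ::
    "nat \<Rightarrow> ((nat \<Rightarrow> real) \<Rightarrow> real) \<Rightarrow> (nat \<Rightarrow> real) \<Rightarrow> real measure" where
  "conditional_kernel d C = (SOME K. is_conditional_kernel d C K)"

definition discrete_measure :: "real measure \<Rightarrow> bool" where
  "discrete_measure M \<longleftrightarrow> (\<exists>S. countable S \<and> (AE x in M. x \<in> S))"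

definition singular_measure :: "real measure \<Rightarrow> bool" where
  "singular_measure M \<longleftrightarrow> (\<forall>x. emeasure M {x} = 0) \<and>
     (\<exists>N \<in> null_sets lborel. AE x in M. x \<in> N)"

definition lebesgue_decomposition ::
    "real measure \<Rightarrow> real measure \<Rightarrow> real measure \<Rightarrow> real measure \<Rightarrow> bool" where
  "lebesgue_decomposition M A D S \<longleftrightarrow>
     sets A = sets unit_borel \<and> sets D = sets unit_borel \<and> sets S = sets unit_borel \<and>
     absolutely_continuous unit_lebesgue A \<and> discrete_measure D \<and> singular_measure S \<and>
     (\<forall>F \<in> sets unit_borel. emeasure M F = emeasure A F + emeasure D F + emeasure S F)"

definition abs_part :: "real measure \<Rightarrow> real measure" where
  "abs_part M = (THE A. \<exists>D S. lebesgue_decomposition M A D S)"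

definition dis_part :: "real measure \<Rightarrow> real measure" where
  "dis_part M = (THE D. \<exists>A S. lebesgue_decomposition M A D S)"

definition kernel_measure ::
    "nat \<Rightarrow> ((nat \<Rightarrow> real) \<Rightarrow> real) \<Rightarrow> ((nat \<Rightarrow> real) \<Rightarrow> real measure) \<Rightarrow> (nat \<Rightarrow> real) measure" where
  "kernel_measure d C K = (THE M. sets M = sets (cube_borel d) \<and>
     (\<forall>E \<in> sets (cube_borel (d - 1)). \<forall>F \<in> sets unit_borel.
        emeasure M (rectangle d E F) =
        (\<integral>\<^sup>+x\<in>E. emeasure (K x) F \<partial>copula_measure (d - 1) (first_margin d C))))"

definition copula_abs :: "nat \<Rightarrow> ((nat \<Rightarrow> real) \<Rightarrow> real) \<Rightarrow> (nat \<Rightarrow> real) measure" where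
  "copula_abs d C = kernel_measure d C (\<lambda>x. abs_part (conditional_kernel d C x))"

definition copula_dis :: "nat \<Rightarrow> ((nat \<Rightarrow> real) \<Rightarrow> real) \<Rightarrow> (nat \<Rightarrow> real) measure" where
  "copula_dis d C = kernel_measure d C (\<lambda>x. dis_part (conditional_kernel d C x))"

definition absolutely_continuous_copula :: "nat \<Rightarrow> ((nat \<Rightarrow> real) \<Rightarrow> real) \<Rightarrow> bool" where
  "absolutely_continuous_copula d C \<longleftrightarrow> emeasure (copula_abs d C) (cube d) = 1"


section \<open>Baire category\<close>

definition nowhere_dense_in :: "'a topology \<Rightarrow> 'a set \<Rightarrow> bool" where
  "nowhere_dense_in X S \<longleftrightarrow> S \<subseteq> topspace X \<and> X interior_of (X closure_of S) = {}"

definition meager_in :: "'a topology \<Rightarrow> 'a set \<Rightarrow> bool" where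
  "meager_in X S \<longleftrightarrow> (\<exists>\<N>. countable \<N> \<and> (\<forall>N \<in> \<N>. nowhere_dense_in X N) \<and> S \<subseteq> \<Union>\<N>)"

definition comeager_in :: "'a topology \<Rightarrow> 'a set \<Rightarrow> bool" where
  "comeager_in X S \<longleftrightarrow> S \<subseteq> topspace X \<and> meager_in X (topspace X - S)"


section \<open>The uniform distance is a metric\<close>

lemma copula_bounds:
  assumes "copula d C" "x \<in> cube d"
  shows "0 \<le> C x" "C x \<le> 1"
  using assms prob_space.prob_le_1
  by (auto simp: copula_def has_distribution_function_def)

lemma copula_diff_bdd:
  assumes "copula d A" "copula d B"
  shows "bdd_above ((\<lambda>x. \<bar>A x - B x\<bar>) ` cube d)"
proof (rule bdd_aboveI2)
  fix x assume "x \<in> cube d"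
  then show "\<bar>A x - B x\<bar> \<le> 1"
    using copula_bounds[OF assms(1)] copula_bounds[OF assms(2)] by (smt (verit))
qed

lemma uniform_dist_copula:
  assumes "copula d A" "copula d B"
  shows "uniform_dist d A B = (SUP x \<in> cube d. \<bar>A x - B x\<bar>)"
  using copula_diff_bdd[OF assms] by (simp add: uniform_dist_def)

lemma uniform_dist_upper:
  assumes "copula d A" "copula d B" "x \<in> cube d"
  shows "\<bar>A x - B x\<bar> \<le> uniform_dist d A B"
  unfolding uniform_dist_copula[OF assms(1,2)]
  using assms(3) copula_diff_bdd[OF assms(1,2)] by (rule cSUP_upper)

lemma cube_nonempty: "cube d \<noteq> {}"
  by (auto simp: cube_def PiE_eq_empty_iff)

lemma Metric_space_archimedean_copulas:
  "Metric_space (archimedean_copulas d) (uniform_dist d)"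
proof -
  have *: "copula d A" if "A \<in> archimedean_copulas d" for A
    using that by (simp add: archimedean_copulas_def)
  obtain x0 where x0: "x0 \<in> cube d"
    using cube_nonempty by blast
  show ?thesis
  proof
    fix A B :: "(nat \<Rightarrow> real) \<Rightarrow> real"
    show "0 \<le> uniform_dist d A B"
      using cSUP_upper[OF x0, of "\<lambda>x. \<bar>A x - B x\<bar>"]
      by (auto simp: uniform_dist_def intro: order_trans[OF abs_ge_zero])
    show "uniform_dist d A B = uniform_dist d B A"
      by (simp add: uniform_dist_def abs_minus_commute)
  next
    fix A B assume AB: "A \<in> archimedean_copulas d" "B \<in> archimedean_copulas d"
    show "uniform_dist d A B = 0 \<longleftrightarrow> A = B"
    proof
      assume "uniform_dist d A B = 0"
      then have "A x = B x" if "x \<in> cube d" for x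
        using uniform_dist_upper[OF *[OF AB(1)] *[OF AB(2)] that] by simp
      then show "A = B"
        using *[OF AB(1)] *[OF AB(2)] unfolding copula_def
        by (blast intro: extensionalityI)
    qed (simp add: uniform_dist_def cube_nonempty)
  next
    fix A B C
    assume ABC: "A \<in> archimedean_copulas d" "B \<in> archimedean_copulas d" "C \<in> archimedean_copulas d"
    have "\<bar>A x - C x\<bar> \<le> uniform_dist d A B + uniform_dist d B C" if "x \<in> cube d" for x
      using uniform_dist_upper[OF *[OF ABC(1)] *[OF ABC(2)] that]
        uniform_dist_upper[OF *[OF ABC(2)] *[OF ABC(3)] that] by linarith
    then show "uniform_dist d A C \<le> uniform_dist d A B + uniform_dist d B C"
      unfolding uniform_dist_copula[OF *[OF ABC(1)] *[OF ABC(3)]]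
      by (intro cSUP_least cube_nonempty)
  qed
qed

end

theory Submission
  imports Defs
begin

text \<open>
  Every Archimedean copula on the unit cube of dimension \<open>n + 1\<close> is the law of the vector with
  components \<open>\<psi> (R S\<^sub>i)\<close>, where \<open>S\<close> is uniform on the standard simplex, \<open>R\<close> is an independent
  positive radius, and \<open>\<psi>\<close> is the Williamson transform of the law of \<open>R\<close>. Hence a copula can be
  approximated uniformly by modifying \<open>R\<close>: mixing its law with an Erlang law makes every grid
  cell have positive mass, multiplying \<open>R\<close> by a random factor close to \<open>1\<close> makes all level sets
  of the copula null, and rounding \<open>R\<close> to a countable set concentrates the copula on countably
  many level sets, which the product of its margin with Lebesgue measure does not charge.

  Consequently the following sets of copulas, which are closed because the mass of a grid cell
  depends continuously on the copula, are nowhere dense: those for which a given cell is null;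
  those with a level set of mass at least \<open>1 / (j + 1)\<close>; and those for which no union of cells has
  mass greater than \<open>1 - 2\<^sup>-\<^sup>j\<close> while its mass under margin times Lebesgue measure is less
  than \<open>2\<^sup>-\<^sup>j\<close>. Outside all of them the support is full, the law of \<open>R\<close> has no atoms, so
  that the explicit conditional kernels have none, and by Borel-Cantelli almost all of them
  are concentrated on Lebesgue null sets.
\<close>

text \<open>Neither the conditional kernel nor its absolutely continuous part depends continuously
  on the copula, so no exceptional set is defined through them. Singularity is expressed on the cube
  instead, by comparing \<open>copula_measure\<close> with the product of its margin and Lebesgue
  measure: both have distribution functions that depend continuously on the copula, and mutual
  singularity of the two measures passes to almost every fibre. This alone says nothing about atoms
  of the fibres, since a kernel of point masses is singular too. Atoms are therefore excluded
  separately, and this is where the kernel must be known explicitly: given the first coordinates,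
  the law of \<open>R\<close> has a density with respect to its unconditional law, so an atom of a
  typical fibre at an interior point forces an atom of \<open>R\<close>, and a level set of the
  copula detects it. All perturbations act on the radial law. They always yield Archimedean copulas,
  and uniform closeness of the Williamson transforms entails uniform closeness of the
  copulas.\<close>

lemma nowhere_dense_inI:
  assumes M: "Metric_space M d" and S: "S \<subseteq> M"
    and closed: "\<And>x. x \<in> M \<Longrightarrow> (\<And>e. e > 0 \<Longrightarrow> \<exists>y\<in>S. d x y < e) \<Longrightarrow> x \<in> S"
    and thin: "\<And>x e. x \<in> S \<Longrightarrow> e > 0 \<Longrightarrow> \<exists>y\<in>M - S. d x y < e"
  shows "nowhere_dense_in (Metric_space.mtopology M d) S"
proof -
  interpret Metric_space M d by fact
  have cl: "mtopology closure_of S = S"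
  proof
    show "mtopology closure_of S \<subseteq> S"
    proof
      fix x assume "x \<in> mtopology closure_of S"
      then have x: "x \<in> M" "\<And>r. r > 0 \<Longrightarrow> \<exists>y\<in>S. y \<in> mball x r"
        by (auto simp: metric_closure_of)
      have "\<exists>y\<in>S. d x y < e" if "e > 0" for e
        using x(2)[OF that] by auto
      then show "x \<in> S" using closed x(1) by blast
    qed
    show "S \<subseteq> mtopology closure_of S"
      using S by (intro closure_of_subset) auto
  qed
  have "mtopology interior_of S = {}"
  proof (rule ccontr)
    assume "mtopology interior_of S \<noteq> {}"
    then obtain x where "x \<in> mtopology interior_of S" by auto
    then obtain U where U: "openin mtopology U" "x \<in> U" "U \<subseteq> S"
      by (auto simp: interior_of_def)
    then obtain r where r: "r > 0" "mball x r \<subseteq> U"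
      by (auto simp: openin_mtopology)
    obtain y where "y \<in> M - S" "d x y < r"
      using thin[of x r] U r by blast
    moreover have "x \<in> M" using U S by auto
    ultimately have "y \<in> mball x r" by simp
    then show False using r U \<open>y \<in> M - S\<close> by auto
  qed
  then show ?thesis
    using S cl by (simp add: nowhere_dense_in_def)
qed

section \<open>Measures on the cube\<close>

text \<open>The generating intervals are cut to the unit interval so that their products are exactly
  the lower orthants on which a distribution function is prescribed.\<close>

lemma sets_unit_borel:
  "sets unit_borel = sigma_sets {0..1} ((\<lambda>a. {0..a}) ` {0..1})"
proof -
  have 1: "sets unit_borel = sigma_sets {0..1} ((\<inter>) {0..1} ` range (\<lambda>a::real. {..a}))"
  proof -
    have b: "sets (borel :: real measure) = sigma_sets UNIV (range (\<lambda>a::real. {..a}))"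
      by (subst borel_eq_atMost) (simp add: sets_measure_of)
    have "{0..1::real} \<in> sets borel" by simp
    then have "{0..1} \<in> sigma_sets UNIV (range (\<lambda>a::real. {..a}))" by (simp only: b)
    then show ?thesis
      unfolding sets_restrict_space b by (rule sigma_sets_Int) simp
  qed
  show ?thesis
    unfolding 1
  proof (rule sigma_sets_eqI)
    fix A assume "A \<in> (\<inter>) {0..1} ` range (\<lambda>a::real. {..a})"
    then obtain a :: real where A: "A = {0..1} \<inter> {..a}" by blast
    show "A \<in> sigma_sets {0..1} ((\<lambda>a. {0..a}) ` {0..1})"
    proof (cases "a < 0")
      case True
      then have "A = {}" using A by auto
      then show ?thesis by (simp add: sigma_sets.Empty)
    next
      case False
      then have "A = {0..min a 1}" "min a 1 \<in> {0..1}" using A by auto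
      then show ?thesis by (intro sigma_sets.Basic image_eqI[of _ _ "min a 1"])
    qed
  next
    fix B assume "B \<in> (\<lambda>a::real. {0..a}) ` {0..1}"
    then obtain a :: real where a: "0 \<le> a" "a \<le> 1" "B = {0..a}" by auto
    then have "B = {0..1} \<inter> {..a}" by auto
    then have "B \<in> (\<inter>) {0..1} ` range (\<lambda>a::real. {..a})" by blast
    then show "B \<in> sigma_sets {0..1} ((\<inter>) {0..1} ` range (\<lambda>a::real. {..a}))" by auto
  qed
qed

lemma Pi_E_down_eq:
  "Pi\<^sub>E {..<d} (\<lambda>i. {0..x i}) = {y \<in> cube d. \<forall>i<d. y i \<le> x i}" if "x \<in> cube d"
proof -
  have "x i \<le> 1" if "i < d" for i
    using that \<open>x \<in> cube d\<close> by (auto simp: cube_def PiE_iff)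
  show ?thesis
    unfolding cube_def
  proof (intro set_eqI iffI)
    fix y assume "y \<in> Pi\<^sub>E {..<d} (\<lambda>i. {0..x i})"
    then show "y \<in> {y \<in> {..<d} \<rightarrow>\<^sub>E {0..1}. \<forall>i<d. y i \<le> x i}"
      using \<open>\<And>i. i < d \<Longrightarrow> x i \<le> 1\<close> unfolding PiE_iff by (auto intro: order_trans[of "y _" "x _" 1])
  qed (simp add: PiE_iff)
qed

text \<open>Lower orthants are stable under intersection, generate the Borel sets and include the
  whole cube, so the uniqueness theorem for finite measures applies.\<close>

lemma cube_borel_eqI:
  assumes "sets M = sets (cube_borel d)" "sets N = sets (cube_borel d)"
    and fin: "emeasure M (cube d) \<noteq> \<infinity>"
    and eq: "\<And>x. x \<in> cube d \<Longrightarrow>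
      emeasure M {y \<in> cube d. \<forall>i<d. y i \<le> x i} = emeasure N {y \<in> cube d. \<forall>i<d. y i \<le> x i}"
  shows "M = N"
proof (rule measure_eqI_generator_eq)
  let ?E = "{Pi\<^sub>E {..<d} F | F. \<forall>i\<in>{..<d}. F i \<in> (\<lambda>a::real. {0..a}) ` {0..1}}"
  have sub: "?E \<subseteq> Pow (cube d)"
  proof
    fix X assume "X \<in> ?E"
    then obtain A where A: "X = Pi\<^sub>E {..<d} A" "\<forall>i\<in>{..<d}. A i \<in> (\<lambda>a::real. {0..a}) ` {0..1}" by blast
    have "A i \<subseteq> {0..1}" if "i \<in> {..<d}" for i
      using bspec[OF A(2) that] by (elim imageE) simp
    then show "X \<in> Pow (cube d)" unfolding A(1) cube_def by (auto dest!: PiE_mono)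
  qed
  have gen: "sets (cube_borel d) = sigma_sets (cube d) ?E"
  proof -
    let ?G = "(\<lambda>a::real. {0..a}) ` {0..1}"
    have "sets (cube_borel d) = sets (PiM {..<d} (\<lambda>_. sigma {0..1} ?G))"
      by (intro sets_PiM_cong refl, subst sets_measure_of) (auto simp: sets_unit_borel)
    also have "\<dots> = sets (sigma (\<Pi>\<^sub>E i\<in>{..<d}. {0..1})
        {{f \<in> \<Pi>\<^sub>E i\<in>{..<d}. {0..1}. \<forall>i\<in>j. f i \<in> A i} | A j. j \<in> {{..<d}} \<and> A \<in> Pi j (\<lambda>_. ?G)})"
      by (rule sets_PiM_sigma) (auto intro!: exI[of _ "{{0..1}}"])
    also have "{{f \<in> \<Pi>\<^sub>E i\<in>{..<d}. {0..1}. \<forall>i\<in>j. f i \<in> A i} | A j. j \<in> {{..<d}} \<and> A \<in> Pi j (\<lambda>_. ?G)} = ?E"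
    proof -
      have eq: "{f \<in> \<Pi>\<^sub>E i\<in>{..<d}. {0..1}. \<forall>i\<in>{..<d}. f i \<in> A i} = Pi\<^sub>E {..<d} A" if A: "\<forall>i\<in>{..<d}. A i \<in> ?G" for A
      proof -
        have "A i \<subseteq> {0..1}" if "i \<in> {..<d}" for i
          using bspec[OF A that] by (elim imageE) simp
        then have "f i \<in> {0..1}" if "i \<in> {..<d}" "f i \<in> A i" for f i using that by blast
        then show ?thesis by (intro set_eqI) (simp add: PiE_iff, blast)
      qed
      show ?thesis
      proof (intro set_eqI iffI)
        fix X assume "X \<in> {{f \<in> \<Pi>\<^sub>E i\<in>{..<d}. {0..1}. \<forall>i\<in>j. f i \<in> A i} | A j. j \<in> {{..<d}} \<and> A \<in> Pi j (\<lambda>_. ?G)}"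
        then obtain A where A: "A \<in> Pi {..<d} (\<lambda>_. ?G)"
          "X = {f \<in> \<Pi>\<^sub>E i\<in>{..<d}. {0..1}. \<forall>i\<in>{..<d}. f i \<in> A i}" by blast
        then have "\<forall>i\<in>{..<d}. A i \<in> ?G" unfolding Pi_iff by blast
        then show "X \<in> ?E" unfolding A(2) using eq[of A] by blast
      next
        fix X assume "X \<in> ?E"
        then obtain A where A: "X = Pi\<^sub>E {..<d} A" "\<forall>i\<in>{..<d}. A i \<in> ?G" by blast
        then have "A \<in> Pi {..<d} (\<lambda>_. ?G)" unfolding Pi_iff by blast
        moreover have "X = {f \<in> \<Pi>\<^sub>E i\<in>{..<d}. {0..1}. \<forall>i\<in>{..<d}. f i \<in> A i}"
          unfolding eq[OF A(2)] A(1) ..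
        ultimately show "X \<in> {{f \<in> \<Pi>\<^sub>E i\<in>{..<d}. {0..1}. \<forall>i\<in>j. f i \<in> A i} | A j. j \<in> {{..<d}} \<and> A \<in> Pi j (\<lambda>_. ?G)}"
          by blast
      qed
    qed
    also have "sets (sigma (\<Pi>\<^sub>E i\<in>{..<d}. {0..1}) ?E) = sigma_sets (\<Pi>\<^sub>E i\<in>{..<d}. {0..1}) ?E"
      by (rule sets_measure_of) (use sub in \<open>simp add: cube_def\<close>)
    finally show ?thesis by (simp only: cube_def)
  qed
  show "Int_stable ?E"
  proof (rule Int_stableI)
    fix a b assume "a \<in> ?E" "b \<in> ?E"
    then obtain F G where F: "a = Pi\<^sub>E {..<d} F" "\<forall>i\<in>{..<d}. F i \<in> (\<lambda>a::real. {0..a}) ` {0..1}"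
      and G: "b = Pi\<^sub>E {..<d} G" "\<forall>i\<in>{..<d}. G i \<in> (\<lambda>a::real. {0..a}) ` {0..1}"
      by blast
    have "a \<inter> b = Pi\<^sub>E {..<d} (\<lambda>i. F i \<inter> G i)"
      by (simp add: F G PiE_Int)
    moreover have "F i \<inter> G i \<in> (\<lambda>a::real. {0..a}) ` {0..1}" if i: "i \<in> {..<d}" for i
    proof -
      obtain p where p: "F i = {0..p}" "p \<in> {0..1}"
        using bspec[OF F(2) i] by (rule imageE)
      obtain q where q: "G i = {0..q}" "q \<in> {0..1}"
        using bspec[OF G(2) i] by (rule imageE)
      show ?thesis unfolding p(1) q(1) by (rule image_eqI[of _ _ "min p q"]) (use p(2) q(2) in auto)
    qed
    ultimately show "a \<inter> b \<in> ?E" by blast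
  qed
  show "?E \<subseteq> Pow (cube d)" by (rule sub)
  show "sets M = sigma_sets (cube d) ?E" "sets N = sigma_sets (cube d) ?E"
    using gen assms by auto
  have "{0..1} \<in> (\<lambda>a::real. {0..a}) ` {0..1}" by (rule image_eqI[of _ _ 1]) auto
  then have "cube d \<in> ?E"
    unfolding cube_def by blast
  then show "range (\<lambda>_::nat. cube d) \<subseteq> ?E" by blast
  show "\<And>i. emeasure M (cube d) \<noteq> \<infinity>" using fin .
  fix X assume "X \<in> ?E"
  then obtain F where F: "X = Pi\<^sub>E {..<d} F" "\<forall>i\<in>{..<d}. F i \<in> (\<lambda>a::real. {0..a}) ` {0..1}" by blast
  define x where "x = (\<lambda>i\<in>{..<d}. SOME a::real. a \<in> {0..1} \<and> F i = {0..a})"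
  have x: "x i \<in> {0..1} \<and> F i = {0..x i}" if i: "i \<in> {..<d}" for i
  proof -
    have "\<exists>a::real. a \<in> {0..1} \<and> F i = {0..a}"
      using bspec[OF F(2) i] by blast
    from someI_ex[OF this] show ?thesis using i by (simp only: x_def restrict_apply if_True)
  qed
  have xc: "x \<in> cube d"
    unfolding cube_def by (rule PiE_I) (use x in \<open>auto simp: x_def\<close>)
  have "X = Pi\<^sub>E {..<d} (\<lambda>i. {0..x i})"
    unfolding F(1) by (rule PiE_cong) (use x in blast)
  also have "\<dots> = {y \<in> cube d. \<forall>i<d. y i \<le> x i}"
    by (rule Pi_E_down_eq[OF xc])
  finally have "X = {y \<in> cube d. \<forall>i<d. y i \<le> x i}" .
  then show "emeasure M X = emeasure N X" using eq[OF xc] by (simp only:)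
next
  show "(\<Union>i::nat. cube d) = cube d" by simp
qed

lemma unit_borel_eqI:
  assumes "sets M = sets unit_borel" "sets N = sets unit_borel"
    and fin: "emeasure M {0..1} \<noteq> \<infinity>"
    and eq: "\<And>a. 0 \<le> a \<Longrightarrow> a \<le> 1 \<Longrightarrow> emeasure M {0..a} = emeasure N {0..a}"
  shows "M = N"
proof (rule measure_eqI_generator_eq)
  let ?E = "(\<lambda>a::real. {0..a}) ` {0..1}"
  show "Int_stable ?E"
  proof (rule Int_stableI)
    fix a b assume "a \<in> ?E" "b \<in> ?E"
    then obtain p q where "a = {0..p}" "b = {0..q}" "p \<in> {0..1}" "q \<in> {0..1}" by auto
    then show "a \<inter> b \<in> ?E" by (intro image_eqI[of _ _ "min p q"]) auto
  qed
  show "?E \<subseteq> Pow {0..1}" by auto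
  show "sets M = sigma_sets {0..1} ?E" "sets N = sigma_sets {0..1} ?E"
    using assms sets_unit_borel by auto
  show "range (\<lambda>_::nat. {0..1::real}) \<subseteq> ?E" by auto
qed (use assms in auto)

lemma cubeD: "x \<in> cube d \<Longrightarrow> i < d \<Longrightarrow> 0 \<le> x i \<and> x i \<le> 1"
  by (simp add: cube_def PiE_iff)

lemma coord_measurable:
  "i < d \<Longrightarrow> (\<lambda>y. y i) \<in> borel_measurable (cube_borel d)"
  using measurable_component_singleton[of i "{..<d}" "\<lambda>_. unit_borel"]
  by (simp add: measurable_restrict_space2_iff)

lemma coord_measurable_unit:
  "i < d \<Longrightarrow> (\<lambda>y. y i) \<in> cube_borel d \<rightarrow>\<^sub>M unit_borel"
  using measurable_component_singleton[of i "{..<d}" "\<lambda>_. unit_borel"] by simp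

lemma sets_coord_in:
  assumes "i < d" "F \<in> sets borel"
  shows "{y \<in> cube d. y i \<in> F} \<in> sets (cube_borel d)"
proof -
  have "(\<lambda>y. y i) -` F \<inter> space (cube_borel d) \<in> sets (cube_borel d)"
    by (rule measurable_sets[OF coord_measurable]) fact+
  moreover have "(\<lambda>y. y i) -` F \<inter> space (cube_borel d) = {y \<in> cube d. y i \<in> F}"
    unfolding space_cube_borel by blast
  ultimately show ?thesis by simp
qed

lemma sets_down: "{y \<in> cube d. \<forall>i<d. y i \<le> x i} \<in> sets (cube_borel d)"
proof -
  have "{y \<in> space (cube_borel d). \<forall>i\<in>{..<d}. y i \<in> {..x i}} \<in> sets (cube_borel d)"
  proof (rule sets.sets_Collect_finite_All)
    fix i assume "i \<in> {..<d}"
    then show "{y \<in> space (cube_borel d). y i \<in> {..x i}} \<in> sets (cube_borel d)"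
      unfolding space_cube_borel by (intro sets_coord_in) simp_all
  qed simp
  then show ?thesis by (simp only: space_cube_borel Ball_def lessThan_iff atMost_iff)
qed

lemma has_distribution_functionD:
  assumes "has_distribution_function d M C"
  shows "prob_space M" "sets M = sets (cube_borel d)" "space M = cube d"
    "\<And>x. x \<in> cube d \<Longrightarrow> measure M {y \<in> cube d. \<forall>i<d. y i \<le> x i} = C x"
  using assms sets_eq_imp_space_eq[of M "cube_borel d"]
  by (auto simp: has_distribution_function_def space_cube_borel)

lemma has_distribution_function_unique:
  assumes "has_distribution_function d M C" "has_distribution_function d N C"
  shows "M = N"
proof (rule cube_borel_eqI)
  interpret M: prob_space M by (rule has_distribution_functionD(1)[OF assms(1)])
  interpret N: prob_space N by (rule has_distribution_functionD(1)[OF assms(2)])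
  show "sets M = sets (cube_borel d)" "sets N = sets (cube_borel d)"
    by (rule has_distribution_functionD(2)[OF assms(1)], rule has_distribution_functionD(2)[OF assms(2)])
  show "emeasure M (cube d) \<noteq> \<infinity>" by simp
  fix x assume "x \<in> cube d"
  then show "emeasure M {y \<in> cube d. \<forall>i<d. y i \<le> x i} = emeasure N {y \<in> cube d. \<forall>i<d. y i \<le> x i}"
    by (simp add: M.emeasure_eq_measure N.emeasure_eq_measure has_distribution_functionD(4)[OF assms(1)]
        has_distribution_functionD(4)[OF assms(2)])
qed

lemma copula_measure_eq: "has_distribution_function d M C \<Longrightarrow> copula_measure d C = M"
  unfolding copula_measure_def
  by (rule the_equality) (auto intro: has_distribution_function_unique)

lemma copula_measureD:
  assumes "copula d C"
  shows "has_distribution_function d (copula_measure d C) C"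
    "\<And>i. i < d \<Longrightarrow> distr (copula_measure d C) unit_borel (\<lambda>y. y i) = unit_lebesgue"
proof -
  obtain M where M: "has_distribution_function d M C"
    "\<And>i. i < d \<Longrightarrow> distr M unit_borel (\<lambda>y. y i) = unit_lebesgue"
    using assms unfolding copula_def by blast
  note eq = copula_measure_eq[OF M(1)]
  show "has_distribution_function d (copula_measure d C) C" using M(1) by (simp only: eq)
  show "distr (copula_measure d C) unit_borel (\<lambda>y. y i) = unit_lebesgue" if "i < d" for i
    using M(2)[OF that] by (simp only: eq)
qed

lemma copula_margin:
  assumes C: "copula d C" and i: "i < d" and F: "F \<in> sets unit_borel"
  shows "emeasure (copula_measure d C) {y \<in> cube d. y i \<in> F} = emeasure lborel F"
proof -
  let ?M = "copula_measure d C"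
  note hd = has_distribution_functionD[OF copula_measureD(1)[OF C]]
  have m: "(\<lambda>y. y i) \<in> ?M \<rightarrow>\<^sub>M unit_borel"
    using coord_measurable_unit[OF i] by (simp only: measurable_cong_sets[OF hd(2) refl])
  have "emeasure ?M {y \<in> cube d. y i \<in> F} = emeasure (distr ?M unit_borel (\<lambda>y. y i)) F"
  proof -
    have "(\<lambda>y. y i) -` F \<inter> space ?M = {y \<in> cube d. y i \<in> F}"
      unfolding hd(3) by blast
    then show ?thesis by (simp only: emeasure_distr[OF m F])
  qed
  also have "\<dots> = emeasure unit_lebesgue F" by (simp add: copula_measureD(2)[OF C i])
  also have "\<dots> = emeasure lborel F"
    by (rule emeasure_restrict_space) (use sets.sets_into_space[OF F] in \<open>simp_all add: space_restrict_space\<close>)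
  finally show ?thesis .
qed

lemma copula_margin_interval:
  assumes C: "copula d C" and i: "i < d" and ab: "0 \<le> a" "a \<le> b" "b \<le> 1"
  shows "measure (copula_measure d C) {y \<in> cube d. a < y i \<and> y i \<le> b} = b - a"
proof -
  have "{a<..b} \<in> sets unit_borel"
    using ab by (subst sets_restrict_space_iff) auto
  from copula_margin[OF C i this]
  have "emeasure (copula_measure d C) {y \<in> cube d. a < y i \<and> y i \<le> b} = ennreal (b - a)"
    using ab by simp
  then show ?thesis using ab by (simp add: measure_def)
qed

text \<open>Uniform margins do not charge the faces. Later arguments may thus apply
  \<open>gen_inv\<close>, which inverts the generator only on the interval from 0 (excluded) to 1,
  to every coordinate.\<close>

lemma copula_AE_interior:
  assumes C: "copula d C"
  shows "AE y in copula_measure d C. \<forall>i<d. 0 < y i \<and> y i < 1"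
proof -
  let ?M = "copula_measure d C"
  note hd = has_distribution_functionD[OF copula_measureD(1)[OF C]]
  have "AE y in ?M. 0 < y i \<and> y i < 1" if i: "i < d" for i
  proof (rule AE_I)
    show "{y \<in> space ?M. \<not> (0 < y i \<and> y i < 1)} \<subseteq> {y \<in> cube d. y i \<in> {0, 1}}"
    proof
      fix y assume y: "y \<in> {y \<in> space ?M. \<not> (0 < y i \<and> y i < 1)}"
      then have "y \<in> cube d" by (simp add: hd(3))
      moreover from cubeD[OF this i] y have "y i = 0 \<or> y i = 1" by auto
      ultimately show "y \<in> {y \<in> cube d. y i \<in> {0, 1}}" by simp
    qed
    have F: "{0, 1::real} \<in> sets unit_borel" by (subst sets_restrict_space_iff) auto
    then show "emeasure ?M {y \<in> cube d. y i \<in> {0, 1}} = 0"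
      using copula_margin[OF C i F] emeasure_lborel_countable[of "{0,1}"] by simp
    show "{y \<in> cube d. y i \<in> {0, 1}} \<in> sets ?M"
      unfolding hd(2) by (rule sets_coord_in[OF i]) simp
  qed
  then have "\<forall>i\<in>{..<d}. AE y in ?M. 0 < y i \<and> y i < 1" by auto
  then have "AE y in ?M. \<forall>i\<in>{..<d}. 0 < y i \<and> y i < 1"
    by (subst AE_finite_all) auto
  then show ?thesis by (simp add: Ball_def)
qed

text \<open>The orthant below \<open>x\<close> is covered by the orthant below \<open>y\<close> and
  one slab per coordinate, and uniform margins give the mass of each slab.\<close>

lemma copula_lipschitz_aux:
  assumes C: "copula d C" and x: "x \<in> cube d" and y: "y \<in> cube d"
  shows "C x - C y \<le> (\<Sum>i<d. \<bar>x i - y i\<bar>)"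
proof -
  let ?M = "copula_measure d C"
  note hd = has_distribution_functionD[OF copula_measureD(1)[OF C]]
  interpret prob_space ?M by (rule hd(1))
  let ?A = "\<lambda>x. {u \<in> cube d. \<forall>i<d. u i \<le> x i}"
  \<comment> \<open>The maximum makes the slab empty in coordinates with
    \<open>x i < y i\<close>.\<close>
  let ?B = "\<lambda>i. {u \<in> cube d. y i < u i \<and> u i \<le> max (x i) (y i)}"
  have B: "?B i \<in> sets ?M" if "i < d" for i
    unfolding hd(2) using sets_coord_in[OF that, of "{y i<..max (x i) (y i)}"] by simp
  have A: "?A x \<in> sets ?M" for x
    unfolding hd(2) by (rule sets_down)
  have UB: "(\<Union>i\<in>{..<d}. ?B i) \<in> sets ?M"
    by (rule sets.finite_UN) (use B in blast)+
  have xy: "0 \<le> x i" "x i \<le> 1" "0 \<le> y i" "y i \<le> 1" if "i < d" for i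
    using cubeD[OF x that] cubeD[OF y that] by blast+
  have "C x = measure ?M (?A x)" using hd(4)[OF x] by simp
  also have "\<dots> \<le> measure ?M (?A y \<union> (\<Union>i\<in>{..<d}. ?B i))"
  proof (rule finite_measure_mono)
    show "?A x \<subseteq> ?A y \<union> (\<Union>i\<in>{..<d}. ?B i)"
    proof
      fix u assume u: "u \<in> ?A x"
      show "u \<in> ?A y \<union> (\<Union>i\<in>{..<d}. ?B i)"
      proof (cases "\<forall>i<d. u i \<le> y i")
        case False
        then obtain i where "i < d" "y i < u i" by (auto simp: not_le)
        then have "u \<in> ?B i" using u by (auto simp: max_def)
        then show ?thesis using \<open>i < d\<close> by blast
      qed (use u in blast)
    qed
    show "?A y \<union> (\<Union>i\<in>{..<d}. ?B i) \<in> sets ?M"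
      by (rule sets.Un[OF A UB])
  qed
  also have "\<dots> \<le> measure ?M (?A y) + measure ?M (\<Union>i\<in>{..<d}. ?B i)"
    by (rule measure_Un_le[OF A UB])
  also have "measure ?M (\<Union>i\<in>{..<d}. ?B i) \<le> (\<Sum>i\<in>{..<d}. measure ?M (?B i))"
    by (rule finite_measure_subadditive_finite) (use B in blast)+
  also have "\<dots> \<le> (\<Sum>i<d. \<bar>x i - y i\<bar>)"
  proof (rule sum_mono)
    fix i assume "i \<in> {..<d}"
    then have "measure ?M (?B i) = max (x i) (y i) - y i"
      using xy[of i] by (intro copula_margin_interval[OF C]) auto
    then show "measure ?M (?B i) \<le> \<bar>x i - y i\<bar>" by auto
  qed
  finally show ?thesis using hd(4)[OF y] by simp
qed

lemma copula_lipschitz: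
  assumes "copula d C" "x \<in> cube d" "y \<in> cube d"
  shows "\<bar>C x - C y\<bar> \<le> (\<Sum>i<d. \<bar>x i - y i\<bar>)"
  using copula_lipschitz_aux[OF assms] copula_lipschitz_aux[OF assms(1,3,2)]
  by (simp add: abs_minus_commute abs_le_iff)

section \<open>Grid cells and the continuity of their masses\<close>

definition grid :: "nat \<Rightarrow> nat \<Rightarrow> (nat \<Rightarrow> real) \<Rightarrow> nat \<Rightarrow> int" where
  "grid d N u = (\<lambda>i\<in>{..<d}. \<lceil>real N * u i\<rceil>)"

text \<open>Ceilings produce cells that are open below and closed above, hence differences of lower
  orthants with corners in the grid. The index 0 occurs exactly at coordinate value 0, which makes
  \<open>N + 1\<close> indices per coordinate.\<close>

definition cells :: "nat \<Rightarrow> nat \<Rightarrow> (nat \<Rightarrow> int) set" where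
  "cells d N = {..<d} \<rightarrow>\<^sub>E {0..int N}"

lemma finite_cells: "finite (cells d N)" "card (cells d N) = (N + 1) ^ d"
  by (auto simp: cells_def finite_PiE card_PiE nat_add_distrib)

lemma grid_in_cells: "u \<in> cube d \<Longrightarrow> grid d N u \<in> cells d N"
proof -
  assume u: "u \<in> cube d"
  have "0 \<le> \<lceil>real N * u i\<rceil> \<and> \<lceil>real N * u i\<rceil> \<le> int N" if "i < d" for i
  proof -
    have *: "0 \<le> u i" "u i \<le> 1" using u that by (auto simp: cube_def PiE_iff)
    then have "-1 < real N * u i" by (meson less_le_trans mult_nonneg_nonneg neg_less_0_iff_less of_nat_0_le_iff zero_less_one)
    then show ?thesis using * by (auto simp: ceiling_le_iff mult_left_le le_ceiling_iff)
  qed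
  then show ?thesis by (simp add: grid_def cells_def PiE_iff)
qed

lemma grid_eq_dist:
  assumes "grid d N u = grid d N v" "N > 0" "i < d"
  shows "\<bar>u i - v i\<bar> \<le> 1 / N"
proof -
  have "\<lceil>real N * u i\<rceil> = \<lceil>real N * v i\<rceil>"
    using fun_cong[OF assms(1), of i] assms(3) by (simp add: grid_def)
  then have "\<bar>real N * u i - real N * v i\<bar> \<le> 1" by linarith
  then have "real N * \<bar>u i - v i\<bar> \<le> 1"
    by (simp add: abs_mult flip: right_diff_distrib)
  then show ?thesis using assms(2) by (simp add: field_simps)
qed

lemma grid_eq_copula:
  assumes "copula d C" "u \<in> cube d" "v \<in> cube d" "grid d N u = grid d N v" "N > 0"
  shows "\<bar>C u - C v\<bar> \<le> d / N"
proof -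
  have "\<bar>C u - C v\<bar> \<le> (\<Sum>i<d. \<bar>u i - v i\<bar>)" by (rule copula_lipschitz) fact+
  also have "\<dots> \<le> (\<Sum>i<d. 1 / N)"
    by (rule sum_mono) (use grid_eq_dist assms in auto)
  finally show ?thesis by simp
qed

lemma sets_ceiling_box:
  "{y \<in> cube d. \<forall>i<d. \<lceil>real N * y i\<rceil> \<in> B i} \<in> sets (cube_borel d)"
proof -
  have "{y \<in> space (cube_borel d). \<forall>i\<in>{..<d}. y i \<in> {t. \<lceil>real N * t\<rceil> \<in> B i}} \<in> sets (cube_borel d)"
  proof (rule sets.sets_Collect_finite_All)
    fix i assume "i \<in> {..<d}"
    moreover have "{t. \<lceil>real N * t\<rceil> \<in> B i} \<in> sets borel" by measurable
    ultimately show "{y \<in> space (cube_borel d). y i \<in> {t. \<lceil>real N * t\<rceil> \<in> B i}} \<in> sets (cube_borel d)"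
      unfolding space_cube_borel by (intro sets_coord_in) simp_all
  qed simp
  then show ?thesis by (simp only: space_cube_borel Ball_def lessThan_iff mem_Collect_eq)
qed

lemma grid_eq_iff: "k \<in> cells d N \<Longrightarrow> grid d N y = k \<longleftrightarrow> (\<forall>i<d. \<lceil>real N * y i\<rceil> \<in> {k i})"
  by (auto simp: grid_def cells_def PiE_iff fun_eq_iff extensional_def)

lemma sets_grid: "{y \<in> cube d. grid d N y \<in> K} \<in> sets (cube_borel d)"
proof -
  have "{y \<in> cube d. grid d N y \<in> K} =
      (\<Union>k\<in>K \<inter> cells d N. {y \<in> cube d. \<forall>i<d. \<lceil>real N * y i\<rceil> \<in> {k i}})" (is "?L = ?R")
  proof
    show "?L \<subseteq> ?R"
    proof
      fix y assume "y \<in> ?L"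
      moreover then have "grid d N y \<in> cells d N" using grid_in_cells by blast
      ultimately show "y \<in> ?R" using grid_eq_iff[of "grid d N y" d N y] by blast
    qed
    show "?R \<subseteq> ?L"
    proof
      fix y assume "y \<in> ?R"
      then obtain k where k: "k \<in> K" "k \<in> cells d N" "y \<in> cube d" "\<forall>i<d. \<lceil>real N * y i\<rceil> \<in> {k i}" by blast
      then have "grid d N y = k" using grid_eq_iff[OF k(2), of y] by blast
      then show "y \<in> ?L" using k by blast
    qed
  qed
  also have "\<dots> \<in> sets (cube_borel d)"
    using finite_cells(1) by (intro sets.finite_UN sets_ceiling_box) blast
  finally show ?thesis .
qed

text \<open>Induction on the number \<open>j\<close> of coordinates in which the upper bound has
  been sharpened to an equality. Sharpening one more is a difference of two sets of the previous
  kind, so the error doubles.\<close>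

lemma cell_measure_diff:
  assumes hM: "has_distribution_function d M A" and hM': "has_distribution_function d M' A'"
    and e: "\<And>x. x \<in> cube d \<Longrightarrow> \<bar>A x - A' x\<bar> \<le> e" and N: "N > 0"
    and j: "j \<le> d"
  shows "(\<And>i. i < d \<Longrightarrow> k i \<le> int N) \<Longrightarrow>
    \<bar>measure M {y \<in> cube d. \<forall>i<d. if i < j then \<lceil>real N * y i\<rceil> = k i else \<lceil>real N * y i\<rceil> \<le> k i}
     - measure M' {y \<in> cube d. \<forall>i<d. if i < j then \<lceil>real N * y i\<rceil> = k i else \<lceil>real N * y i\<rceil> \<le> k i}\<bar> \<le> 2 ^ j * e"
  using j
proof (induction j arbitrary: k)
  case 0
  let ?S = "{y \<in> cube d. \<forall>i<d. if i < 0 then \<lceil>real N * y i\<rceil> = k i else \<lceil>real N * y i\<rceil> \<le> k i}"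
  show ?case
  proof (cases "\<forall>i<d. 0 \<le> k i")
    case True
    define x where "x = (\<lambda>i\<in>{..<d}. real_of_int (k i) / N)"
    have "real_of_int (k i) \<le> real N" if "i < d" for i using 0(1)[OF that] by linarith
    then have x: "x \<in> cube d" using True N by (auto simp: x_def cube_def)
    have "?S = {y \<in> cube d. \<forall>i<d. y i \<le> x i}"
    proof -
      have "\<lceil>real N * y i\<rceil> \<le> k i \<longleftrightarrow> y i \<le> x i" if "i < d" for y i
        using N that by (simp add: x_def ceiling_le_iff pos_le_divide_eq mult.commute)
      then show ?thesis by auto
    qed
    then show ?thesis
      using e[OF x] has_distribution_functionD(4)[OF hM x] has_distribution_functionD(4)[OF hM' x] by simp
  next
    \<comment> \<open>The induction lowers indices and may reach negative ones; such a set is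
      empty.\<close>
    case False
    then obtain i where i: "i < d" "k i < 0" by force
    have "\<lceil>real N * y i\<rceil> \<ge> 0" if "y \<in> cube d" for y
    proof -
      have "0 \<le> y i" using that i by (auto simp: cube_def PiE_iff)
      then have "0 \<le> real N * y i" by simp
      then show ?thesis by linarith
    qed
    then have "\<not> \<lceil>real N * y i\<rceil> \<le> k i" if "y \<in> cube d" for y using i that by fastforce
    then have "?S = {}" using i(1) by auto
    moreover have "e \<ge> 0" using cube_nonempty[of d] e by fastforce
    ultimately show ?thesis by (simp only: measure_empty) simp
  qed
next
  case (Suc j)
  let ?S = "\<lambda>j k. {y \<in> cube d. \<forall>i<d. if i < j then \<lceil>real N * y i\<rceil> = k i else \<lceil>real N * y i\<rceil> \<le> k i}"
  let ?k = "k(j := k j - 1)"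
  have jd: "j < d" using Suc by simp
  have meas: "?S j k \<in> sets (cube_borel d)" if "j \<le> d" for j k
  proof -
    have "?S j k = {y \<in> cube d. \<forall>i<d. \<lceil>real N * y i\<rceil> \<in> (if i < j then {k i} else {..k i})}"
      by auto
    then show ?thesis by (simp only: sets_ceiling_box)
  qed
  have split: "?S (Suc j) k = ?S j k - ?S j ?k"
  proof -
    have Sj: "y \<in> ?S j k \<longleftrightarrow> y \<in> cube d \<and> \<lceil>real N * y j\<rceil> \<le> k j \<and>
        (\<forall>i<d. i \<noteq> j \<longrightarrow> (if i < j then \<lceil>real N * y i\<rceil> = k i else \<lceil>real N * y i\<rceil> \<le> k i))" for y k
      using jd by auto
    have SSj: "y \<in> ?S (Suc j) k \<longleftrightarrow> y \<in> cube d \<and> \<lceil>real N * y j\<rceil> = k j \<and>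
        (\<forall>i<d. i \<noteq> j \<longrightarrow> (if i < j then \<lceil>real N * y i\<rceil> = k i else \<lceil>real N * y i\<rceil> \<le> k i))" for y
      using jd by (auto simp: less_Suc_eq)
    have "y \<in> ?S (Suc j) k \<longleftrightarrow> y \<in> ?S j k \<and> y \<notin> ?S j ?k" for y
      unfolding Sj SSj by (cases "\<lceil>real N * y j\<rceil> = k j") auto
    then show ?thesis by blast
  qed
  have sub: "?S j ?k \<subseteq> ?S j k"
  proof
    fix y assume y: "y \<in> ?S j ?k"
    have "if i < j then \<lceil>real N * y i\<rceil> = k i else \<lceil>real N * y i\<rceil> \<le> k i" if "i < d" for i
    proof -
      have "if i < j then \<lceil>real N * y i\<rceil> = ?k i else \<lceil>real N * y i\<rceil> \<le> ?k i" using y that by blast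
      then show ?thesis by (auto split: if_splits)
    qed
    then show "y \<in> ?S j k" using y by auto
  qed
  have diff: "measure L (?S (Suc j) k) = measure L (?S j k) - measure L (?S j ?k)"
    if "has_distribution_function d L B" for L B
  proof -
    interpret prob_space L by (rule has_distribution_functionD(1)[OF that])
    show ?thesis unfolding split
      by (rule finite_measure_Diff[OF _ _ sub])
         (simp_all only: has_distribution_functionD(2)[OF that] meas jd less_imp_le)
  qed
  have "\<bar>measure M (?S j k) - measure M' (?S j k)\<bar> \<le> 2 ^ j * e"
    using Suc by (intro Suc.IH) auto
  moreover have "\<bar>measure M (?S j ?k) - measure M' (?S j ?k)\<bar> \<le> 2 ^ j * e"
  proof (intro Suc.IH)
    show "?k i \<le> int N" if "i < d" for i using Suc.prems(1)[OF that] by auto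
  qed (use Suc in auto)
  ultimately show ?case unfolding diff[OF hM] diff[OF hM'] power_Suc by linarith
qed

text \<open>The constant counts \<open>(N + 1) ^ d\<close> cells with an error of
  \<open>2 ^ d * e\<close> each. It is the same for every set \<open>K\<close> of cells.\<close>

lemma cells_measure_diff:
  assumes hM: "has_distribution_function d M A" and hM': "has_distribution_function d M' A'"
    and e: "\<And>x. x \<in> cube d \<Longrightarrow> \<bar>A x - A' x\<bar> \<le> e" and N: "N > 0"
  shows "\<bar>measure M {y \<in> cube d. grid d N y \<in> K} - measure M' {y \<in> cube d. grid d N y \<in> K}\<bar>
    \<le> (2 * (real N + 1)) ^ d * e"
proof -
  let ?S = "\<lambda>k. {y \<in> cube d. grid d N y = k}"
  let ?K = "K \<inter> cells d N"
  have 1: "{y \<in> cube d. grid d N y \<in> K} = (\<Union>k\<in>?K. ?S k)"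
    using grid_in_cells by auto
  have meas: "?S k \<in> sets (cube_borel d)" for k
    using sets_grid[of d N "{k}"] by (simp only: singleton_iff)
  have fin: "finite ?K" using finite_cells by auto
  have sum: "measure L {y \<in> cube d. grid d N y \<in> K} = (\<Sum>k\<in>?K. measure L (?S k))"
    if "has_distribution_function d L B" for L B
  proof -
    interpret prob_space L by (rule has_distribution_functionD(1)[OF that])
    show ?thesis unfolding 1
    proof (rule finite_measure_finite_Union[OF fin])
      show "?S ` ?K \<subseteq> sets L" unfolding has_distribution_functionD(2)[OF that] using meas by blast
    qed (auto simp: disjoint_family_on_def)
  qed
  have e0: "e \<ge> 0" using cube_nonempty[of d] e by fastforce
  have cell: "\<bar>measure M (?S k) - measure M' (?S k)\<bar> \<le> 2 ^ d * e" if k: "k \<in> ?K" for k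
  proof -
    have "?S k = {y \<in> cube d. \<forall>i<d. if i < d then \<lceil>real N * y i\<rceil> = k i else \<lceil>real N * y i\<rceil> \<le> k i}"
      using k by (auto simp: grid_def cells_def PiE_iff fun_eq_iff extensional_def)
    then show ?thesis
      using cell_measure_diff[OF hM hM' e N, of d k] k by (auto simp: cells_def PiE_iff)
  qed
  have "\<bar>measure M {y \<in> cube d. grid d N y \<in> K} - measure M' {y \<in> cube d. grid d N y \<in> K}\<bar>
      = \<bar>\<Sum>k\<in>?K. measure M (?S k) - measure M' (?S k)\<bar>"
    by (simp add: sum[OF hM] sum[OF hM'] sum_subtractf)
  also have "\<dots> \<le> (\<Sum>k\<in>?K. 2 ^ d * e)"
    by (rule order_trans[OF sum_abs sum_mono]) (rule cell)
  also have "\<dots> \<le> (\<Sum>k\<in>cells d N. 2 ^ d * e)"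
    by (rule sum_mono2) (use finite_cells e0 in auto)
  also have "\<dots> = (2 * (real N + 1)) ^ d * e"
    by (simp add: finite_cells algebra_simps flip: power_mult_distrib)
  finally show ?thesis .
qed

section \<open>Generators and their pseudo-inverses\<close>

text \<open>
  The generalized inverse \<open>pseudo_inverse \<psi> 0\<close> may be infinite. The real-valued \<open>gen_inv\<close> has the
  junk value \<open>0\<close> there, so \<open>arch\<close> treats points with a vanishing coordinate separately.
\<close>

definition gen_inv :: "(real \<Rightarrow> real) \<Rightarrow> real \<Rightarrow> real" where
  "gen_inv \<psi> y = (if 0 < y \<and> y \<le> 1 then Inf {z. 0 \<le> z \<and> \<psi> z = y} else 0)"

definition arch :: "(real \<Rightarrow> real) \<Rightarrow> nat \<Rightarrow> (nat \<Rightarrow> real) \<Rightarrow> real" where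
  "arch \<psi> d x = (if \<exists>i<d. x i = 0 then 0 else \<psi> (\<Sum>i<d. gen_inv \<psi> (x i)))"

locale generator_fun =
  fixes \<psi> :: "real \<Rightarrow> real"
  assumes generator: "generator \<psi>"
begin

lemma bounds: "0 \<le> z \<Longrightarrow> 0 \<le> \<psi> z \<and> \<psi> z \<le> 1"
  using generator by (force simp: generator_def)

lemma cont: "continuous_on {0..} \<psi>"
  using generator by (simp add: generator_def)

lemma mono: "0 \<le> x \<Longrightarrow> x \<le> y \<Longrightarrow> \<psi> y \<le> \<psi> x"
  using generator monotone_onD[of "{0..}" "(\<le>)" "(\<ge>)" \<psi> x y] by (simp add: generator_def)

lemma at_zero: "\<psi> 0 = 1"
  using generator by (simp add: generator_def)

lemma lim: "(\<psi> \<longlongrightarrow> 0) at_top"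
  using generator by (simp add: generator_def)

lemma Lim_eq: "Lim at_top \<psi> = 0"
  using lim by (intro tendsto_Lim) simp_all

text \<open>The strictness clause of \<open>generator\<close> speaks of points strictly below an
  infimum in \<open>ennreal\<close>. Continuity supplies the gap before the first zero that turns
  positivity of \<open>\<psi> y\<close> into that strict inequality.\<close>

lemma zeros_away:
  assumes "0 \<le> y" "0 < \<psi> y"
  obtains e where "e > 0" "\<And>x. 0 \<le> x \<Longrightarrow> \<psi> x = 0 \<Longrightarrow> y + e \<le> x"
proof -
  obtain e where e: "e > 0" "\<And>x. x \<in> {0..} \<Longrightarrow> dist x y < e \<Longrightarrow> dist (\<psi> x) (\<psi> y) < \<psi> y"
    using cont assms unfolding continuous_on_iff by (metis atLeast_iff)
  have "y + e \<le> x" if x: "0 \<le> x" "\<psi> x = 0" for x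
  proof (rule ccontr)
    assume "\<not> y + e \<le> x"
    moreover have "\<not> x \<le> y" using mono[of x y] x assms by auto
    ultimately have "dist x y < e" by (auto simp: dist_real_def)
    then show False using e(2)[of x] x assms by (auto simp: dist_real_def)
  qed
  then show ?thesis using that e(1) by blast
qed

lemma strict:
  assumes "0 \<le> x" "x < y" "0 < \<psi> x"
  shows "\<psi> y < \<psi> x"
proof (cases "\<psi> y > 0")
  case False
  then show ?thesis using bounds[of y] assms by auto
next
  case True
  let ?I = "INF x\<in>{x. 0 \<le> x \<and> \<psi> x = 0}. ennreal x"
  obtain e where e: "e > 0" "\<And>x. 0 \<le> x \<Longrightarrow> \<psi> x = 0 \<Longrightarrow> y + e \<le> x"
    using zeros_away[OF _ True] assms by auto
  have "ennreal y < ennreal (y + e)" using e assms by (intro ennreal_lessI) auto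
  also have "\<dots> \<le> ?I" using e(2) by (intro INF_greatest ennreal_leI) auto
  finally have y: "ennreal y < ?I" .
  moreover have "ennreal x \<le> ennreal y" using assms by (intro ennreal_leI) auto
  ultimately have "ennreal x < ?I" by (rule le_less_trans[rotated])
  moreover have "strict_antimono_on {z. 0 \<le> z \<and> ennreal z < ?I} \<psi>"
    using generator by (simp add: generator_def)
  ultimately show ?thesis
    using y assms monotone_onD[of "{z. 0 \<le> z \<and> ennreal z < ?I}" "(<)" "(>)" \<psi> x y] by simp
qed

lemma inj: "0 \<le> x \<Longrightarrow> 0 \<le> y \<Longrightarrow> \<psi> x = \<psi> y \<Longrightarrow> 0 < \<psi> x \<Longrightarrow> x = y"
  using strict[of x y] strict[of y x] by (cases x y rule: linorder_cases) auto

lemma gen_inv_eq: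
  assumes "0 \<le> z" "0 < \<psi> z"
  shows "gen_inv \<psi> (\<psi> z) = z"
proof -
  have "{x. 0 \<le> x \<and> \<psi> x = \<psi> z} = {z}" using assms inj by auto
  then show ?thesis using assms bounds[of z] by (simp add: gen_inv_def)
qed

lemma gen_inv_exists:
  assumes "0 < y" "y \<le> 1"
  obtains z where "0 \<le> z" "\<psi> z = y"
proof -
  have "eventually (\<lambda>z. \<psi> z < y) at_top" using order_tendstoD(2)[OF lim assms(1)] .
  then obtain Z where Z: "\<And>z. z \<ge> Z \<Longrightarrow> \<psi> z < y" by (auto simp: eventually_at_top_linorder)
  have "\<exists>z\<ge>0. z \<le> max 0 Z \<and> \<psi> z = y"
    using Z[of "max 0 Z"] assms at_zero
    by (intro IVT2' continuous_on_subset[OF cont]) auto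
  then show ?thesis using that by blast
qed

lemma gen_inv:
  assumes "0 < y" "y \<le> 1"
  shows "0 \<le> gen_inv \<psi> y" "\<psi> (gen_inv \<psi> y) = y"
proof -
  obtain z where z: "0 \<le> z" "\<psi> z = y" using gen_inv_exists[OF assms] .
  then have "gen_inv \<psi> y = z" using gen_inv_eq[of z] assms by auto
  then show "0 \<le> gen_inv \<psi> y" "\<psi> (gen_inv \<psi> y) = y" using z by auto
qed

lemma gen_inv_nonneg: "0 \<le> gen_inv \<psi> y"
  using gen_inv(1)[of y] by (cases "0 < y \<and> y \<le> 1") (auto simp: gen_inv_def)

text \<open>A generator is injective where it is positive, so this equivalence and its mirror image
  \<open>le_gen_inv_iff\<close> both hold; \<open>0 < u\<close> keeps away from the plateau of
  zeros.\<close>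

lemma gen_inv_le_iff:
  assumes "0 < u" "u \<le> 1" "0 \<le> x"
  shows "gen_inv \<psi> u \<le> x \<longleftrightarrow> \<psi> x \<le> u"
proof
  assume "gen_inv \<psi> u \<le> x"
  then show "\<psi> x \<le> u" using mono[of "gen_inv \<psi> u" x] gen_inv[OF assms(1,2)] by auto
next
  assume "\<psi> x \<le> u"
  then show "gen_inv \<psi> u \<le> x"
    using strict[of x "gen_inv \<psi> u"] mono[of x "gen_inv \<psi> u"] gen_inv[OF assms(1,2)] assms by force
qed

lemma le_gen_inv_iff:
  assumes "0 < u" "u \<le> 1" "0 \<le> x"
  shows "x \<le> gen_inv \<psi> u \<longleftrightarrow> u \<le> \<psi> x"
proof
  assume "x \<le> gen_inv \<psi> u"
  then show "u \<le> \<psi> x" using mono[of x "gen_inv \<psi> u"] gen_inv[OF assms(1,2)] assms by auto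
next
  assume *: "u \<le> \<psi> x"
  show "x \<le> gen_inv \<psi> u"
  proof (rule ccontr)
    assume "\<not> x \<le> gen_inv \<psi> u"
    then show False
      using strict[of "gen_inv \<psi> u" x] gen_inv[OF assms(1,2)] assms * by force
  qed
qed

lemma gen_inv_measurable: "gen_inv \<psi> \<in> borel_measurable borel"
proof (rule borel_measurableI_le)
  fix a
  show "{x \<in> space borel. gen_inv \<psi> x \<le> a} \<in> sets borel"
  proof (cases "a < 0")
    case True
    then have "\<not> gen_inv \<psi> x \<le> a" for x using gen_inv_nonneg[of x] by linarith
    then show ?thesis by simp
  next
    case False
    have "gen_inv \<psi> x \<le> a \<longleftrightarrow> x \<in> ({0<..1} \<inter> {\<psi> a..}) \<union> (UNIV - {0<..1})" for x
    proof (cases "0 < x \<and> x \<le> 1")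
      case True
      then show ?thesis using gen_inv_le_iff[of x a] False by simp
    next
      case F: False
      then have "gen_inv \<psi> x = 0" unfolding gen_inv_def by (simp only: if_False)
      then show ?thesis using False F by simp
    qed
    then have "{x \<in> space borel. gen_inv \<psi> x \<le> a} = ({0<..1} \<inter> {\<psi> a..}) \<union> (UNIV - {0<..1})"
      by (simp only: space_borel UNIV_I simp_thms Collect_mem_eq)
    then show ?thesis by simp
  qed
qed

lemma ext_ennreal: "0 \<le> r \<Longrightarrow> generator_ext \<psi> (ennreal r) = \<psi> r"
  by (simp add: generator_ext_def)

lemma ext_top: "generator_ext \<psi> \<top> = 0"
  by (simp add: generator_ext_def Lim_eq)

lemma pseudo_inverse_pos:
  assumes "0 < y" "y \<le> 1"
  shows "pseudo_inverse \<psi> y = ennreal (gen_inv \<psi> y)"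
proof -
  have "z = ennreal (gen_inv \<psi> y)" if "generator_ext \<psi> z = y" for z
  proof (cases z)
    case (real r)
    then show ?thesis using that ext_ennreal[of r] gen_inv_eq[of r] assms by auto
  qed (use that assms ext_top in auto)
  then have "{z. generator_ext \<psi> z = y} = {ennreal (gen_inv \<psi> y)}"
    using gen_inv[OF assms] ext_ennreal by auto
  then show ?thesis by (simp add: pseudo_inverse_def)
qed

text \<open>The infimum defining \<open>pseudo_inverse \<psi> 0\<close> is attained, either at the
  first zero by continuity or at infinity through the limit. Hence an Archimedean copula vanishes as
  soon as a coordinate does, whether or not its generator has zeros.\<close>

lemma ext_above_pseudo_inverse_zero:
  assumes "pseudo_inverse \<psi> 0 \<le> s"
  shows "generator_ext \<psi> s = 0"
proof (cases s)
  case (real r)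
  show ?thesis
  proof (rule ccontr)
    assume "generator_ext \<psi> s \<noteq> 0"
    then have pos: "0 < \<psi> r" using real ext_ennreal bounds[of r] by force
    obtain e where e: "e > 0" "\<And>x. 0 \<le> x \<Longrightarrow> \<psi> x = 0 \<Longrightarrow> r + e \<le> x"
      using zeros_away[OF real(1) pos] by blast
    have "ennreal (r + e) \<le> z" if "generator_ext \<psi> z = 0" for z
    proof (cases z)
      case (real q)
      then show ?thesis using that e(2)[of q] ext_ennreal by (auto intro!: ennreal_leI)
    qed simp
    then have "ennreal (r + e) \<le> pseudo_inverse \<psi> 0"
      unfolding pseudo_inverse_def by (intro Inf_greatest) blast
    moreover have "ennreal r < ennreal (r + e)" using e real by (intro ennreal_lessI) auto
    ultimately show False using assms real by (metis leD order_trans)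
  qed
qed (simp add: ext_top)

lemma arch_eq:
  assumes x: "x \<in> cube d"
  shows "generator_ext \<psi> (\<Sum>i<d. pseudo_inverse \<psi> (x i)) = arch \<psi> d x"
proof (cases "\<exists>i<d. x i = 0")
  case True
  then obtain i where i: "i < d" "x i = 0" by blast
  have "pseudo_inverse \<psi> (x i) \<le> (\<Sum>i<d. pseudo_inverse \<psi> (x i))"
    using i by (intro member_le_sum) auto
  then show ?thesis using ext_above_pseudo_inverse_zero i True by (auto simp: arch_def)
next
  case False
  have "x i > 0 \<and> x i \<le> 1" if "i < d" for i
    using cubeD[OF x that] False that by (metis order_le_less)
  then have "(\<Sum>i<d. pseudo_inverse \<psi> (x i)) = (\<Sum>i<d. ennreal (gen_inv \<psi> (x i)))"
    by (intro sum.cong) (auto simp: pseudo_inverse_pos)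
  also have "\<dots> = ennreal (\<Sum>i<d. gen_inv \<psi> (x i))"
    by (rule sum_ennreal) (rule gen_inv_nonneg)
  finally show ?thesis
    using False by (auto simp: arch_def ext_ennreal sum_nonneg gen_inv_nonneg)
qed

lemma arch_positive:
  assumes x: "x \<in> cube d" and pos: "0 < arch \<psi> d x"
  shows "\<And>i. i < d \<Longrightarrow> 0 < x i" "arch \<psi> d x = \<psi> (\<Sum>i<d. gen_inv \<psi> (x i))"
    "(\<Sum>i<d. gen_inv \<psi> (x i)) = gen_inv \<psi> (arch \<psi> d x)"
proof -
  have *: "\<not> (\<exists>i<d. x i = 0)" using pos by (auto simp: arch_def split: if_splits)
  then show "0 < x i" if "i < d" for i
    using cubeD[OF x that] that by (metis order_le_less)
  show "arch \<psi> d x = \<psi> (\<Sum>i<d. gen_inv \<psi> (x i))" using * by (auto simp: arch_def)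
  then show "(\<Sum>i<d. gen_inv \<psi> (x i)) = gen_inv \<psi> (arch \<psi> d x)"
    using pos gen_inv_eq[of "\<Sum>i<d. gen_inv \<psi> (x i)"] by (simp add: sum_nonneg gen_inv_nonneg)
qed

text \<open>Turns a relative change of the argument into a uniform estimate: uniform continuity
  handles a compact interval, and beyond it both values are small.\<close>

lemma scale_close:
  assumes "e > 0"
  obtains h where "h > 0" "\<And>z. 0 \<le> z \<Longrightarrow> \<psi> (z / (1 + h)) \<le> \<psi> z + e"
proof -
  have "eventually (\<lambda>z. \<psi> z < e) at_top" using order_tendstoD(2)[OF lim assms] .
  then obtain Z0 where Z0: "\<And>z. z \<ge> Z0 \<Longrightarrow> \<psi> z < e" by (auto simp: eventually_at_top_linorder)
  define Z where "Z = max 1 Z0"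
  have Z: "Z \<ge> 1" "\<And>z. z \<ge> Z \<Longrightarrow> \<psi> z < e" using Z0 by (auto simp: Z_def)
  have "uniformly_continuous_on {0..2 * Z} \<psi>"
    by (intro compact_uniformly_continuous continuous_on_subset[OF cont]) auto
  then obtain q where q: "q > 0"
    "\<And>x x'. x \<in> {0..2 * Z} \<Longrightarrow> x' \<in> {0..2 * Z} \<Longrightarrow> dist x' x < q \<Longrightarrow> dist (\<psi> x') (\<psi> x) < e"
    using assms unfolding uniformly_continuous_on_def by metis
  \<comment> \<open>\<open>h \<le> 1\<close> keeps \<open>z / (1 + h)\<close> above \<open>Z\<close>
    when \<open>z > 2 * Z\<close>; the quotient makes the displacement at most \<open>q / 2\<close>
    for \<open>z \<le> 2 * Z\<close>.\<close>
  define h where "h = min 1 (q / (4 * Z))"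
  have h: "h > 0" "h \<le> 1" "h * (2 * Z) < q"
  proof -
    show "h > 0" "h \<le> 1" using q Z by (auto simp: h_def)
    have "h * (2 * Z) \<le> q / (4 * Z) * (2 * Z)" using Z by (intro mult_right_mono) (auto simp: h_def)
    also have "\<dots> < q" using Z q by simp
    finally show "h * (2 * Z) < q" .
  qed
  have "\<psi> (z / (1 + h)) \<le> \<psi> z + e" if z: "0 \<le> z" for z
  proof (cases "z \<le> 2 * Z")
    case True
    have le: "z / (1 + h) \<le> z" using z h by (simp add: field_simps)
    have "z - z / (1 + h) = z * h / (1 + h)" using h by (simp add: field_simps)
    also have "\<dots> \<le> z * h" using h z by (simp add: divide_le_eq mult_left_le_one_le field_simps)
    also have "\<dots> \<le> 2 * Z * h" using True h by (intro mult_right_mono) auto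
    finally have "dist (z / (1 + h)) z < q" using h le by (simp add: dist_real_def mult.commute)
    then have "dist (\<psi> (z / (1 + h))) (\<psi> z) < e"
      using z le True h by (intro q(2)) auto
    then show ?thesis by (auto simp: dist_real_def)
  next
    case False
    have "Z \<le> z / (1 + h)"
    proof -
      have "Z * (1 + h) \<le> Z * 2" using h Z by (intro mult_left_mono) auto
      then show ?thesis using False h by (simp add: pos_le_divide_eq)
    qed
    then show ?thesis using Z(2)[of "z / (1 + h)"] bounds[OF z] by auto
  qed
  then show ?thesis using that h by blast
qed

end

lemma archimedean_copulas_iff:
  "C \<in> archimedean_copulas d \<longleftrightarrow> copula d C \<and> (\<exists>\<psi>. generator \<psi> \<and> (\<forall>x\<in>cube d. C x = arch \<psi> d x))"
  unfolding archimedean_copulas_def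
  by (simp add: generator_fun.arch_eq[OF generator_fun.intro] cong: conj_cong)

section \<open>Uniform distribution on the simplex\<close>

text \<open>The survival function of one coordinate of a uniform point of the simplex with
  \<open>n + 1\<close> vertices, continued by 1 to the left of 0. The explicit case
  \<open>s \<le> 1\<close> matters for \<open>n = 0\<close>, where the truncated power would be 1
  everywhere.\<close>

definition tail :: "nat \<Rightarrow> real \<Rightarrow> real" where
  "tail n s = (if s \<le> 1 then (1 - max 0 s) ^ n else 0)"

lemma tail_bounds: "0 \<le> tail n s" "tail n s \<le> 1"
  by (auto simp: tail_def power_le_one)

lemma tail_antimono: "s \<le> t \<Longrightarrow> tail n t \<le> tail n s"
  by (auto simp: tail_def intro!: power_mono)

lemma tail_measurable[measurable]: "tail n \<in> borel_measurable borel"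
  unfolding tail_def by measurable

text \<open>The Beta law with parameters \<open>n + 1\<close> and 1: it is the law of one minus a
  coordinate of a uniform point of the simplex with \<open>n + 2\<close> vertices.\<close>

definition beta_top :: "nat \<Rightarrow> real measure" where
  "beta_top n = density lborel (\<lambda>w. ennreal (real (Suc n) * w ^ n) * indicator {0..1} w)"

lemma beta_top_sets[measurable_cong, simp]: "sets (beta_top n) = sets borel"
  by (simp add: beta_top_def)

lemma nn_integral_beta_top:
  "f \<in> borel_measurable borel \<Longrightarrow>
    (\<integral>\<^sup>+w. f w \<partial>beta_top n) = (\<integral>\<^sup>+w. ennreal (real (Suc n) * w ^ n) * indicator {0..1} w * f w \<partial>lborel)"
  unfolding beta_top_def by (subst nn_integral_density) auto

lemma nn_integral_shifted_power:
  assumes "s \<le> b"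
  shows "(\<integral>\<^sup>+w. ennreal (real (Suc n) * (w - s) ^ n) * indicator {s..b} w \<partial>lborel) = ennreal ((b - s) ^ Suc n)"
proof -
  have der: "((\<lambda>w. (w - s) ^ Suc n) has_real_derivative real (Suc n) * (w - s) ^ n) (at w)" for w
    by (rule derivative_eq_intros refl | simp del: power_Suc)+
  have nonneg: "0 \<le> real (Suc n) * (w - s) ^ n" if "s \<le> w" for w using that by simp
  have "(\<integral>\<^sup>+w. ennreal (real (Suc n) * (w - s) ^ n) * indicator {s..b} w \<partial>lborel) =
      ennreal ((b - s) ^ Suc n - (s - s) ^ Suc n)"
    by (rule nn_integral_FTC_Icc[OF _ der nonneg assms]) measurable
  then show ?thesis by simp
qed

lemma prob_space_beta_top: "prob_space (beta_top n)"
proof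
  have "emeasure (beta_top n) (space (beta_top n)) = (\<integral>\<^sup>+w. 1 \<partial>beta_top n)" by simp
  also have "\<dots> = (\<integral>\<^sup>+w. ennreal (real (Suc n) * w ^ n) * indicator {0..1} w \<partial>lborel)"
    by (subst nn_integral_beta_top) auto
  also have "\<dots> = 1" using nn_integral_shifted_power[of 0 1 n] by simp
  finally show "emeasure (beta_top n) (space (beta_top n)) = 1" .
qed

lemma AE_beta_top: "AE w in beta_top n. 0 < w \<and> w < 1"
proof -
  have "AE w in lborel. w \<noteq> 0 \<and> w \<noteq> (1::real)"
    using AE_lborel_singleton[of "0::real"] AE_lborel_singleton[of "1::real"] by eventually_elim simp
  then have "AE w in lborel. 0 < ennreal (real (Suc n) * w ^ n) * indicator {0..1} w \<longrightarrow> 0 < w \<and> w < 1"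
    by eventually_elim (auto split: split_indicator)
  then show ?thesis
    unfolding beta_top_def by (subst AE_density) auto
qed

abbreviation rborel :: "nat \<Rightarrow> (nat \<Rightarrow> real) measure" where
  "rborel d \<equiv> PiM {..<d} (\<lambda>_. borel)"

lemma sets_up: "{s \<in> space (rborel d). \<forall>i<d. c i \<le> s i} \<in> sets (rborel d)"
proof -
  have "{s \<in> space (rborel d). \<forall>i\<in>{..<d}. c i \<le> s i} \<in> sets (rborel d)"
    by (rule sets.sets_Collect_finite_All) simp_all
  then show ?thesis by (simp only: Ball_def lessThan_iff)
qed

text \<open>
  Stick breaking: given a uniform point of the simplex of one dimension less, the last
  coordinate is \<open>1 - w\<close> with \<open>w\<close> having density proportional to a power of \<open>w\<close>.
\<close>

fun simplex_law :: "nat \<Rightarrow> (nat \<Rightarrow> real) measure" where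
  "simplex_law 0 = return (rborel 1) (\<lambda>i\<in>{..<1}. 1)"
| "simplex_law (Suc n) = distr (simplex_law n \<Otimes>\<^sub>M beta_top n) (rborel (Suc (Suc n)))
     (\<lambda>(s, w). \<lambda>i\<in>{..<Suc (Suc n)}. if i < Suc n then w * s i else 1 - w)"

lemma simplex_sets[measurable_cong, simp]: "sets (simplex_law n) = sets (rborel (Suc n))"
  by (cases n) auto

lemma simplex_step_measurable[measurable]:
  "(\<lambda>(s, w). \<lambda>i\<in>{..<Suc (Suc n)}. if i < Suc n then w * s i else 1 - w)
     \<in> rborel (Suc n) \<Otimes>\<^sub>M borel \<rightarrow>\<^sub>M rborel (Suc (Suc n))"
  unfolding split_beta
proof (rule measurable_restrict)
  fix i assume "i \<in> {..<Suc (Suc n)}"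
  show "(\<lambda>x. if i < Suc n then snd x * fst x i else 1 - snd x) \<in> rborel (Suc n) \<Otimes>\<^sub>M borel \<rightarrow>\<^sub>M borel"
  proof (cases "i < Suc n")
    case True
    then have [measurable]: "(\<lambda>s. s i) \<in> rborel (Suc n) \<rightarrow>\<^sub>M borel"
      by (intro measurable_component_singleton) simp
    show ?thesis using True by simp
  qed simp
qed

lemma simplex_step_measurable':
  "(\<lambda>(s, w). \<lambda>i\<in>{..<Suc (Suc n)}. if i < Suc n then w * s i else 1 - w)
     \<in> simplex_law n \<Otimes>\<^sub>M beta_top n \<rightarrow>\<^sub>M rborel (Suc (Suc n))"
  using simplex_step_measurable[of n]
  by (simp only: measurable_cong_sets[OF sets_pair_measure_cong[OF simplex_sets beta_top_sets] refl])

lemma prob_space_simplex: "prob_space (simplex_law n)"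
proof (induction n)
  case 0
  show ?case by (simp, intro prob_space_return) (simp add: space_PiM)
next
  case (Suc n)
  interpret a: prob_space "simplex_law n" by fact
  interpret b: prob_space "beta_top n" by (rule prob_space_beta_top)
  interpret pair_prob_space "simplex_law n" "beta_top n" ..
  show ?case unfolding simplex_law.simps by (rule P.prob_space_distr[OF simplex_step_measurable'])
qed

lemma space_simplex: "space (simplex_law n) = space (rborel (Suc n))"
  by (rule sets_eq_imp_space_eq) simp

definition std_simplex :: "nat \<Rightarrow> (nat \<Rightarrow> real) set" where
  "std_simplex d = {s \<in> space (rborel d). (\<forall>i<d. 0 \<le> s i) \<and> (\<Sum>i<d. s i) = 1}"

lemma sets_std_simplex: "std_simplex d \<in> sets (rborel d)"
proof -
  have "(\<lambda>s. \<Sum>i\<in>{..<d}. s i) \<in> borel_measurable (rborel d)"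
    by (intro borel_measurable_sum measurable_component_singleton)
  then have "(\<lambda>s. \<Sum>i<d. s i) -` {1} \<inter> space (rborel d) \<in> sets (rborel d)"
    by (rule measurable_sets) simp
  then have "{s \<in> space (rborel d). \<forall>i<d. 0 \<le> s i} \<inter> ((\<lambda>s. \<Sum>i<d. s i) -` {1} \<inter> space (rborel d))
      \<in> sets (rborel d)"
    using sets_up[of d "\<lambda>_. 0"] by (rule sets.Int[rotated])
  moreover have "std_simplex d = {s \<in> space (rborel d). \<forall>i<d. 0 \<le> s i} \<inter>
      ((\<lambda>s. \<Sum>i<d. s i) -` {1} \<inter> space (rborel d))"
    unfolding std_simplex_def by blast
  ultimately show ?thesis by (simp only:)
qed

lemma AE_simplex: "AE s in simplex_law n. s \<in> std_simplex (Suc n)"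
proof (induction n)
  case 0
  have "(\<lambda>i\<in>{..<1}. 1) \<in> std_simplex (Suc 0)" by (simp add: std_simplex_def space_PiM)
  then have "emeasure (simplex_law 0) (std_simplex (Suc 0)) = 1"
    using emeasure_return[OF sets_std_simplex[of 1], of "\<lambda>i\<in>{..<1}. 1"]
    by (simp add: indicator_def)
  then show ?case
    using sets_std_simplex[of "Suc 0"]
    by (intro prob_space.AE_prob_1[OF prob_space_simplex]) (simp add: measure_def)
next
  case (Suc n)
  interpret a: prob_space "simplex_law n" by (rule prob_space_simplex)
  interpret b: prob_space "beta_top n" by (rule prob_space_beta_top)
  interpret pair_prob_space "simplex_law n" "beta_top n" ..
  let ?f = "\<lambda>(s, w). \<lambda>i\<in>{..<Suc (Suc n)}. if i < Suc n then w * s i else 1 - w :: real"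
  let ?P = "simplex_law n \<Otimes>\<^sub>M beta_top n"
  let ?A = "?f -` std_simplex (Suc (Suc n)) \<inter> space ?P"
  have A: "?A \<in> sets ?P"
    by (rule measurable_sets[OF simplex_step_measurable' sets_std_simplex])
  have "AE x in ?P. x \<in> ?A"
  proof (rule AE_pair_measure)
    have "{x \<in> space ?P. x \<in> ?A} = ?A" by blast
    with A show "{x \<in> space ?P. x \<in> ?A} \<in> sets ?P" by (simp only:)
    show "AE s in simplex_law n. AE w in beta_top n. (s, w) \<in> ?A"
      using Suc
    proof eventually_elim
      case (elim s)
      show ?case
        using AE_beta_top
      proof eventually_elim
        case (elim w)
        have s: "s \<in> space (rborel (Suc n))" "\<And>i. i < Suc n \<Longrightarrow> 0 \<le> s i" "(\<Sum>i<Suc n. s i) = 1"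
          using \<open>s \<in> std_simplex (Suc n)\<close> unfolding std_simplex_def by blast+
        have "(\<Sum>i<Suc (Suc n). ?f (s, w) i) = (\<Sum>i<Suc n. w * s i) + (1 - w)"
          by simp
        also have "\<dots> = 1" using s(3) by (simp only: sum_distrib_left[symmetric])
        finally have "(\<Sum>i<Suc (Suc n). ?f (s, w) i) = 1" .
        moreover have "\<forall>i<Suc (Suc n). 0 \<le> ?f (s, w) i" using s(2) elim by auto
        moreover have "?f (s, w) \<in> space (rborel (Suc (Suc n)))" by (simp add: space_PiM)
        ultimately have "?f (s, w) \<in> std_simplex (Suc (Suc n))" unfolding std_simplex_def by blast
        moreover have "(s, w) \<in> space ?P" using s(1) by (simp add: space_pair_measure space_simplex beta_top_def)
        ultimately show ?case by blast
      qed
    qed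
  qed
  then have "AE x in ?P. ?f x \<in> std_simplex (Suc (Suc n))" by eventually_elim blast
  moreover have "{x \<in> space (rborel (Suc (Suc n))). x \<in> std_simplex (Suc (Suc n))} \<in> sets (rborel (Suc (Suc n)))"
    using sets_std_simplex[of "Suc (Suc n)"] by (simp add: std_simplex_def conj_ac)
  ultimately show ?case
    by (simp only: simplex_law.simps AE_distr_iff[OF simplex_step_measurable'])
qed

definition up :: "nat \<Rightarrow> (nat \<Rightarrow> real) \<Rightarrow> (nat \<Rightarrow> real) set" where
  "up d c = {s \<in> space (rborel d). \<forall>i<d. c i \<le> s i}"

text \<open>The powers of \<open>w\<close> cancel,
  \<open>w ^ n * (1 - s / w) ^ n = (w - s) ^ n\<close>, and integrating over
  \<open>{s..1 - c}\<close> raises the exponent by one. The point \<open>w = 0\<close>, where the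
  quotient has a default value, is null.\<close>

lemma nn_integral_tail_beta_top:
  assumes "0 \<le> s" "0 \<le> c"
  shows "(\<integral>\<^sup>+w. ennreal (tail n (s / w)) * indicator {..1 - c} w \<partial>beta_top n) = ennreal (tail (Suc n) (s + c))"
proof -
  have "(\<integral>\<^sup>+w. ennreal (tail n (s / w)) * indicator {..1 - c} w \<partial>beta_top n) =
      (\<integral>\<^sup>+w. ennreal (real (Suc n) * w ^ n) * indicator {0..1} w * (ennreal (tail n (s / w)) * indicator {..1 - c} w) \<partial>lborel)"
    by (rule nn_integral_beta_top) measurable
  also have "\<dots> = (\<integral>\<^sup>+w. ennreal (real (Suc n) * (w - s) ^ n) * indicator {s..1 - c} w \<partial>lborel)"
  proof (rule nn_integral_cong_AE)
    have eq: "ennreal (real (Suc n) * w ^ n) * indicator {0..1} w * (ennreal (tail n (s / w)) * indicator {..1 - c} w)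
        = ennreal (real (Suc n) * (w - s) ^ n) * indicator {s..1 - c} w" if w: "w \<noteq> 0" for w
    proof (cases "s \<le> w \<and> w \<le> 1 - c")
      case True
      then have pos: "0 < w" using w assms by auto
      have "w ^ n * tail n (s / w) = (w * (1 - s / w)) ^ n"
        using True pos assms by (simp add: tail_def power_mult_distrib)
      also have "w * (1 - s / w) = w - s" using pos by (simp add: field_simps)
      finally have "real (Suc n) * w ^ n * tail n (s / w) = real (Suc n) * (w - s) ^ n" by simp
      then show ?thesis
        using True pos assms tail_bounds[of n "s / w"]
        by (simp add: indicator_def flip: ennreal_mult)
    next
      case False
      then show ?thesis using assms w
        by (cases "w < 0") (auto simp: indicator_def tail_def field_simps)
    qed
    show "AE w in lborel. ennreal (real (Suc n) * w ^ n) * indicator {0..1} w * (ennreal (tail n (s / w)) * indicator {..1 - c} w)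
        = ennreal (real (Suc n) * (w - s) ^ n) * indicator {s..1 - c} w"
      using AE_lborel_singleton[of "0::real"] by eventually_elim (rule eq)
  qed
  also have "\<dots> = ennreal (tail (Suc n) (s + c))"
  proof (cases "s \<le> 1 - c")
    case True
    have "(1 - c - s) ^ Suc n = tail (Suc n) (s + c)"
      using True assms by (simp add: tail_def algebra_simps del: power_Suc)
    then show ?thesis using nn_integral_shifted_power[OF True, of n] by (simp only:)
  next
    case False
    then have "{s..1 - c} = {}" by auto
    then show ?thesis using False assms by (simp add: tail_def)
  qed
  finally show ?thesis .
qed

text \<open>Conditioning on the last coordinate \<open>1 - w\<close> leaves \<open>w\<close> times a
  uniform point of the smaller simplex, so the remaining corner is divided by \<open>w\<close> and
  the induction hypothesis applies inside the integral.\<close>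

lemma emeasure_simplex_up:
  assumes "\<And>i. i < Suc n \<Longrightarrow> 0 \<le> c i"
  shows "emeasure (simplex_law n) (up (Suc n) c) = ennreal (tail n (\<Sum>i<Suc n. c i))"
  using assms
proof (induction n arbitrary: c)
  case 0
  have "emeasure (simplex_law 0) (up 1 c) = indicator (up 1 c) (\<lambda>i\<in>{..<1}. 1)"
    unfolding simplex_law.simps up_def by (rule emeasure_return[OF sets_up])
  then show ?case by (simp add: up_def space_PiM indicator_def tail_def)
next
  case (Suc n)
  interpret a: prob_space "simplex_law n" by (rule prob_space_simplex)
  interpret b: prob_space "beta_top n" by (rule prob_space_beta_top)
  interpret pair_prob_space "simplex_law n" "beta_top n" ..
  let ?f = "\<lambda>(s, w). \<lambda>i\<in>{..<Suc (Suc n)}. if i < Suc n then w * s i else 1 - w :: real"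
  let ?P = "simplex_law n \<Otimes>\<^sub>M beta_top n"
  let ?A = "?f -` up (Suc (Suc n)) c \<inter> space ?P"
  have A: "?A \<in> sets ?P"
    unfolding up_def by (rule measurable_sets[OF simplex_step_measurable' sets_up])
  have "emeasure (simplex_law (Suc n)) (up (Suc (Suc n)) c) = emeasure ?P ?A"
    unfolding simplex_law.simps up_def by (rule emeasure_distr[OF simplex_step_measurable' sets_up])
  also have "\<dots> = (\<integral>\<^sup>+w. emeasure (simplex_law n) ((\<lambda>s. (s, w)) -` ?A) \<partial>beta_top n)"
    by (rule emeasure_pair_measure_alt2[OF A])
  also have "\<dots> = (\<integral>\<^sup>+w. ennreal (tail n ((\<Sum>i<Suc n. c i) / w)) * indicator {..1 - c (Suc n)} w \<partial>beta_top n)"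
  proof (rule nn_integral_cong_AE, use AE_beta_top in eventually_elim)
    case (elim w)
    have eq: "(\<lambda>s. (s, w)) -` ?A = (if w \<le> 1 - c (Suc n) then up (Suc n) (\<lambda>i. c i / w) else {})"
    proof (rule set_eqI)
      fix s
      have all: "(\<forall>i<Suc (Suc n). c i \<le> (if i < Suc n then w * s i else 1 - w)) \<longleftrightarrow>
          (\<forall>i<Suc n. c i \<le> w * s i) \<and> c (Suc n) \<le> 1 - w"
        by (auto simp: less_Suc_eq)
      have "s \<in> (\<lambda>s. (s, w)) -` ?A \<longleftrightarrow> s \<in> space (simplex_law n) \<and> (\<forall>i<Suc n. c i \<le> w * s i) \<and> c (Suc n) \<le> 1 - w"
        using all by (auto simp: up_def space_pair_measure space_PiM beta_top_def)
      also have "\<dots> \<longleftrightarrow> s \<in> (if w \<le> 1 - c (Suc n) then up (Suc n) (\<lambda>i. c i / w) else {})"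
        using elim by (auto simp: up_def space_simplex pos_divide_le_eq mult.commute)
      finally show "s \<in> (\<lambda>s. (s, w)) -` ?A \<longleftrightarrow> s \<in> (if w \<le> 1 - c (Suc n) then up (Suc n) (\<lambda>i. c i / w) else {})" .
    qed
    have "emeasure (simplex_law n) (up (Suc n) (\<lambda>i. c i / w)) = ennreal (tail n (\<Sum>i<Suc n. c i / w))"
      using elim Suc.prems by (intro Suc.IH) auto
    then show ?case unfolding eq by (simp add: sum_divide_distrib add_divide_distrib)
  qed
  also have "\<dots> = ennreal (tail (Suc n) ((\<Sum>i<Suc n. c i) + c (Suc n)))"
    using Suc.prems by (intro nn_integral_tail_beta_top sum_nonneg) auto
  finally show ?case by simp
qed

lemma tail_eq_max: "n \<ge> 1 \<Longrightarrow> tail n s = (max 0 (1 - max 0 s)) ^ n"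
  by (auto simp: tail_def max_def)

lemma tail_continuous: "n \<ge> 1 \<Longrightarrow> continuous_on UNIV (tail n)"
proof -
  assume "n \<ge> 1"
  then have "tail n = (\<lambda>s. (max 0 (1 - max 0 s)) ^ n)" using tail_eq_max by blast
  then show ?thesis by (simp only:) (intro continuous_intros)
qed

text \<open>Strict decrease up to the first zero, phrased with an equality so that it can be used
  almost everywhere once an integral of differences is known to vanish.\<close>

lemma tail_strict: "n \<ge> 1 \<Longrightarrow> 0 \<le> s \<Longrightarrow> s < t \<Longrightarrow> tail n s = tail n t \<Longrightarrow> tail n s = 0"
  using power_strict_mono[of "1 - t" "1 - s" n] by (auto simp: tail_def split: if_splits)

section \<open>Copulas with a given radial law\<close>

text \<open>The exponent \<open>n\<close> is one less than the dimension \<open>n + 1\<close> of the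
  copula, as for the survival function of a coordinate on the simplex.\<close>

definition williamson :: "nat \<Rightarrow> real measure \<Rightarrow> real \<Rightarrow> real" where
  "williamson n \<nu> z = (\<integral>r. tail n (z / r) \<partial>\<nu>)"

definition l1_law :: "nat \<Rightarrow> real measure \<Rightarrow> (nat \<Rightarrow> real) measure" where
  "l1_law n \<nu> = distr (\<nu> \<Otimes>\<^sub>M simplex_law n) (rborel (Suc n)) (\<lambda>(r, s). \<lambda>i\<in>{..<Suc n}. r * s i)"

definition copula_law :: "nat \<Rightarrow> real measure \<Rightarrow> (nat \<Rightarrow> real) measure" where
  "copula_law n \<nu> = distr (l1_law n \<nu>) (cube_borel (Suc n)) (\<lambda>x. \<lambda>i\<in>{..<Suc n}. williamson n \<nu> (x i))"

definition radial_copula :: "nat \<Rightarrow> real measure \<Rightarrow> (nat \<Rightarrow> real) \<Rightarrow> real" where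
  "radial_copula n \<nu> = restrict (arch (williamson n \<nu>) (Suc n)) (cube (Suc n))"

lemma scale_measurable: "(\<lambda>(r, s). \<lambda>i\<in>{..<d}. r * s i) \<in> borel \<Otimes>\<^sub>M rborel d \<rightarrow>\<^sub>M rborel d"
  unfolding split_beta
proof (rule measurable_restrict)
  fix i assume "i \<in> {..<d}"
  then have [measurable]: "(\<lambda>s. s i) \<in> rborel d \<rightarrow>\<^sub>M borel"
    by (intro measurable_component_singleton)
  show "(\<lambda>x. fst x * snd x i) \<in> borel \<Otimes>\<^sub>M rborel d \<rightarrow>\<^sub>M borel" by measurable
qed

text \<open>\<open>n \<ge> 1\<close> is the condition that the dimension is at least 2 and makes
  \<open>tail n\<close> continuous. Mass of the radius at 0 would leave the transform with a
  positive limit at infinity, since division by 0 yields 0 and \<open>tail n 0 = 1\<close>.\<close>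

locale radial =
  fixes n :: nat and \<nu> :: "real measure"
  assumes n: "n \<ge> 1" and prob: "prob_space \<nu>" and sets_nu[measurable_cong]: "sets \<nu> = sets borel"
    and pos: "AE r in \<nu>. 0 < r"
begin

sublocale nu: prob_space \<nu> by (rule prob)
sublocale sx: prob_space "simplex_law n" by (rule prob_space_simplex)
sublocale pair: pair_prob_space \<nu> "simplex_law n" ..

lemma space_nu: "space \<nu> = UNIV"
  using sets_eq_imp_space_eq[OF sets_nu] by simp

lemma tail_integrable: "integrable \<nu> (\<lambda>r. tail n (z / r))"
  by (rule nu.integrable_const_bound[of _ 1]) (auto simp: tail_bounds abs_of_nonneg)

lemma williamson_ennreal: "ennreal (williamson n \<nu> z) = (\<integral>\<^sup>+r. ennreal (tail n (z / r)) \<partial>\<nu>)"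
  unfolding williamson_def by (rule nn_integral_eq_integral[symmetric]) (auto simp: tail_integrable tail_bounds)

lemma williamson_bounds: "0 \<le> williamson n \<nu> z" "williamson n \<nu> z \<le> 1"
proof -
  show "0 \<le> williamson n \<nu> z" unfolding williamson_def by (intro integral_nonneg_AE) (simp add: tail_bounds)
  have "williamson n \<nu> z \<le> (\<integral>r. 1 \<partial>\<nu>)"
    unfolding williamson_def by (intro integral_mono tail_integrable) (auto simp: tail_bounds)
  then show "williamson n \<nu> z \<le> 1" by (simp add: nu.prob_space)
qed

lemma williamson_measurable[measurable]: "williamson n \<nu> \<in> borel_measurable borel"
  unfolding williamson_def[abs_def] by measurable

lemma williamson_antimono: "z \<le> z' \<Longrightarrow> williamson n \<nu> z' \<le> williamson n \<nu> z"
  unfolding williamson_def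
  by (intro integral_mono_AE tail_integrable, use pos in eventually_elim)
     (auto intro!: tail_antimono divide_right_mono)

lemma williamson_nonpos: "z \<le> 0 \<Longrightarrow> williamson n \<nu> z = 1"
proof -
  assume z: "z \<le> 0"
  have "williamson n \<nu> z = (\<integral>r. 1 \<partial>\<nu>)"
    unfolding williamson_def
  proof (rule integral_cong_AE)
    show "AE r in \<nu>. tail n (z / r) = 1"
      using pos
    proof eventually_elim
      case (elim r)
      then have "z / r \<le> 0" using z by (simp add: divide_le_0_iff)
      then show ?case by (simp add: tail_def max_def)
    qed
  qed measurable
  then show ?thesis by (simp add: nu.prob_space)
qed

lemma williamson_continuous: "continuous_on UNIV (williamson n \<nu>)"
  unfolding continuous_on_sequentially
proof (intro allI ballI impI)
  fix X :: "nat \<Rightarrow> real" and a assume X: "(\<forall>k. X k \<in> UNIV) \<and> X \<longlonglongrightarrow> a"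
  show "(williamson n \<nu> \<circ> X) \<longlonglongrightarrow> williamson n \<nu> a"
    unfolding williamson_def o_def
  proof (rule integral_dominated_convergence[where w="\<lambda>_. 1"])
    show "AE r in \<nu>. (\<lambda>k. tail n (X k / r)) \<longlonglongrightarrow> tail n (a / r)"
      using pos
    proof eventually_elim
      case (elim r)
      have "(\<lambda>k. X k / r) \<longlonglongrightarrow> a / r" using X elim by (intro tendsto_intros) auto
      with tail_continuous[OF n] show ?case
        by (intro continuous_on_tendsto_compose[where f="tail n" and s=UNIV]) auto
    qed
  qed (auto simp: tail_bounds abs_of_nonneg)
qed

lemma williamson_lim: "(williamson n \<nu> \<longlongrightarrow> 0) at_top"
proof (rule tendsto_at_topI_sequentially)
  fix X :: "nat \<Rightarrow> real" assume X: "filterlim X at_top sequentially"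
  have "(\<lambda>k. \<integral>r. tail n (X k / r) \<partial>\<nu>) \<longlonglongrightarrow> (\<integral>r. 0 \<partial>\<nu>)"
  proof (rule integral_dominated_convergence[where w="\<lambda>_. 1"])
    show "AE r in \<nu>. (\<lambda>k. tail n (X k / r)) \<longlonglongrightarrow> 0"
      using pos
    proof eventually_elim
      case (elim r)
      have "eventually (\<lambda>k. r < X k) sequentially"
        using X by (simp add: filterlim_at_top_dense)
      then have "eventually (\<lambda>k. tail n (X k / r) = 0) sequentially"
        by eventually_elim (use elim in \<open>auto simp: tail_def\<close>)
      then show ?case by (rule tendsto_eventually)
    qed
  qed (auto simp: tail_bounds abs_of_nonneg)
  then show "(\<lambda>k. williamson n \<nu> (X k)) \<longlonglongrightarrow> 0" by (simp add: williamson_def)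
qed

text \<open>The integrands are ordered almost everywhere, so equal integrals force equal integrands;
  each tail is then constant on an interval and already zero at its left end.\<close>

lemma williamson_strict:
  assumes "0 \<le> z" "z < z'" "williamson n \<nu> z = williamson n \<nu> z'"
  shows "williamson n \<nu> z = 0"
proof -
  have "(\<integral>r. tail n (z / r) - tail n (z' / r) \<partial>\<nu>) = 0"
    using assms(3) by (subst Bochner_Integration.integral_diff) (auto simp: williamson_def tail_integrable)
  moreover have "AE r in \<nu>. 0 \<le> tail n (z / r) - tail n (z' / r)"
    using pos by eventually_elim (use assms in \<open>auto intro!: tail_antimono divide_right_mono\<close>)
  ultimately have "AE r in \<nu>. tail n (z / r) - tail n (z' / r) = 0"
    by (subst (asm) integral_nonneg_eq_0_iff_AE) (auto intro!: tail_integrable)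
  with pos have "AE r in \<nu>. tail n (z / r) = 0"
  proof eventually_elim
    case (elim r)
    then show ?case
      using assms by (intro tail_strict[OF n, of "z / r" "z' / r"]) (auto intro: divide_strict_right_mono)
  qed
  then have "williamson n \<nu> z = (\<integral>r. 0 \<partial>\<nu>)" unfolding williamson_def by (intro integral_cong_AE) auto
  then show ?thesis by simp
qed

lemma generator_williamson: "generator (williamson n \<nu>)"
  unfolding generator_def
proof (intro conjI)
  show "williamson n \<nu> ` {0..} \<subseteq> {0..1}" using williamson_bounds by auto
  show "continuous_on {0..} (williamson n \<nu>)" using williamson_continuous by (rule continuous_on_subset) simp
  show "antimono_on {0..} (williamson n \<nu>)" using williamson_antimono by (auto simp: monotone_on_def)
  show "williamson n \<nu> 0 = 1" by (simp add: williamson_nonpos)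
  show "(williamson n \<nu> \<longlongrightarrow> 0) at_top" by (rule williamson_lim)
  show "strict_antimono_on {z. 0 \<le> z \<and> ennreal z < (INF x\<in>{x. 0 \<le> x \<and> williamson n \<nu> x = 0}. ennreal x)} (williamson n \<nu>)"
  proof (rule monotone_onI)
    fix x y :: real
    assume "x \<in> {z. 0 \<le> z \<and> ennreal z < (INF x\<in>{x. 0 \<le> x \<and> williamson n \<nu> x = 0}. ennreal x)}"
    then have x: "0 \<le> x" "ennreal x < (INF x\<in>{x. 0 \<le> x \<and> williamson n \<nu> x = 0}. ennreal x)" by auto
    have "williamson n \<nu> x \<noteq> 0"
    proof
      assume "williamson n \<nu> x = 0"
      then have "(INF x\<in>{x. 0 \<le> x \<and> williamson n \<nu> x = 0}. ennreal x) \<le> ennreal x"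
        using x(1) by (intro INF_lower) auto
      then show False using x(2) by simp
    qed
    moreover assume "x < y"
    ultimately show "williamson n \<nu> y < williamson n \<nu> x"
      using williamson_strict[of x y] williamson_antimono[of x y] x(1) by fastforce
  qed
qed

sublocale generator_fun "williamson n \<nu>" by unfold_locales (rule generator_williamson)

lemma scale_measurable': "(\<lambda>(r, s). \<lambda>i\<in>{..<Suc n}. r * s i) \<in> \<nu> \<Otimes>\<^sub>M simplex_law n \<rightarrow>\<^sub>M rborel (Suc n)"
  using scale_measurable[of "Suc n"]
  by (simp only: measurable_cong_sets[OF sets_pair_measure_cong[OF sets_nu simplex_sets] refl])

lemma sets_l1_law[simp]: "sets (l1_law n \<nu>) = sets (rborel (Suc n))"
  by (simp add: l1_law_def)

lemma space_l1_law[simp]: "space (l1_law n \<nu>) = space (rborel (Suc n))"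
  by (simp add: l1_law_def)

lemma prob_space_l1_law: "prob_space (l1_law n \<nu>)"
  unfolding l1_law_def by (rule pair.P.prob_space_distr[OF scale_measurable'])

sublocale el: prob_space "l1_law n \<nu>" by (rule prob_space_l1_law)

text \<open>Given the radius, the corner is divided by \<open>r\<close>, so the formula on the
  simplex is mixed into the Williamson transform. Dependence on the corner through its sum alone is
  the source of the Archimedean form.\<close>

lemma emeasure_l1_law_up:
  assumes c: "\<And>i. i < Suc n \<Longrightarrow> 0 \<le> c i"
  shows "emeasure (l1_law n \<nu>) (up (Suc n) c) = ennreal (williamson n \<nu> (\<Sum>i<Suc n. c i))"
proof -
  let ?f = "\<lambda>(r, s). \<lambda>i\<in>{..<Suc n}. r * s i :: real"
  let ?P = "\<nu> \<Otimes>\<^sub>M simplex_law n"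
  let ?A = "?f -` up (Suc n) c \<inter> space ?P"
  have A: "?A \<in> sets ?P"
    unfolding up_def by (rule measurable_sets[OF scale_measurable' sets_up])
  have "emeasure (l1_law n \<nu>) (up (Suc n) c) = emeasure ?P ?A"
    unfolding l1_law_def up_def by (rule emeasure_distr[OF scale_measurable' sets_up])
  also have "\<dots> = (\<integral>\<^sup>+r. emeasure (simplex_law n) (Pair r -` ?A) \<partial>\<nu>)"
    by (rule sx.emeasure_pair_measure_alt[OF A])
  also have "\<dots> = (\<integral>\<^sup>+r. ennreal (tail n ((\<Sum>i<Suc n. c i) / r)) \<partial>\<nu>)"
  proof (rule nn_integral_cong_AE, use pos in eventually_elim)
    case (elim r)
    have "Pair r -` ?A = up (Suc n) (\<lambda>i. c i / r)"
      using elim by (auto simp: up_def space_pair_measure space_nu space_simplex pos_divide_le_eq mult.commute)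
         (auto simp: space_PiM)
    moreover have "emeasure (simplex_law n) (up (Suc n) (\<lambda>i. c i / r)) = ennreal (tail n (\<Sum>i<Suc n. c i / r))"
      using elim c by (intro emeasure_simplex_up) auto
    ultimately show ?case by (simp add: sum_divide_distrib add_divide_distrib)
  qed
  finally show ?thesis by (simp add: williamson_ennreal)
qed

lemma AE_l1_law_nonneg: "AE x in l1_law n \<nu>. \<forall>i<Suc n. 0 \<le> x i"
proof -
  have "emeasure (l1_law n \<nu>) (up (Suc n) (\<lambda>_. 0)) = 1"
    using emeasure_l1_law_up[of "\<lambda>_. 0"] by (simp add: williamson_nonpos)
  then have "AE x in l1_law n \<nu>. x \<in> up (Suc n) (\<lambda>_. 0)"
    by (intro el.AE_prob_1) (simp add: measure_def)
  then show ?thesis by eventually_elim (simp add: up_def)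
qed

text \<open>The simplex coordinates sum to 1, so the radius can be read off the scaled vector.
  \<open>measure_level\<close> uses this to pass from level sets of the copula to the radial
  law.\<close>

lemma distr_l1_law_sum: "distr (l1_law n \<nu>) borel (\<lambda>x. \<Sum>i<Suc n. x i) = \<nu>"
proof -
  have m: "(\<lambda>x. \<Sum>i\<in>{..<Suc n}. x i) \<in> rborel (Suc n) \<rightarrow>\<^sub>M borel"
    by (intro borel_measurable_sum measurable_component_singleton)
  have "distr (l1_law n \<nu>) borel (\<lambda>x. \<Sum>i<Suc n. x i) =
      distr (\<nu> \<Otimes>\<^sub>M simplex_law n) borel ((\<lambda>x. \<Sum>i<Suc n. x i) \<circ> (\<lambda>(r, s). \<lambda>i\<in>{..<Suc n}. r * s i))"
    unfolding l1_law_def by (rule distr_distr[OF m scale_measurable'])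
  also have "\<dots> = distr (\<nu> \<Otimes>\<^sub>M simplex_law n) borel fst"
  proof (rule distr_cong_AE[OF refl refl])
    have "AE x in \<nu> \<Otimes>\<^sub>M simplex_law n. snd x \<in> std_simplex (Suc n)"
    proof (rule pair.AE_pair_measure)
      have "snd -` std_simplex (Suc n) \<inter> space (\<nu> \<Otimes>\<^sub>M simplex_law n) \<in> sets (\<nu> \<Otimes>\<^sub>M simplex_law n)"
        by (rule measurable_sets[OF measurable_snd]) (simp only: simplex_sets sets_std_simplex)
      then show "{x \<in> space (\<nu> \<Otimes>\<^sub>M simplex_law n). snd x \<in> std_simplex (Suc n)} \<in> sets (\<nu> \<Otimes>\<^sub>M simplex_law n)"
        by (simp only: vimage_def Int_def mem_Collect_eq conj_commute)
    qed (use AE_simplex in auto)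
    then show "AE x in \<nu> \<Otimes>\<^sub>M simplex_law n. ((\<lambda>x. \<Sum>i<Suc n. x i) \<circ> (\<lambda>(r, s). \<lambda>i\<in>{..<Suc n}. r * s i)) x = fst x"
    proof eventually_elim
      case (elim x)
      then have "(\<Sum>i<Suc n. snd x i) = 1" unfolding std_simplex_def by blast
      then show ?case by (simp add: split_beta flip: sum_distrib_left distrib_left del: sum.lessThan_Suc)
    qed
    show "(\<lambda>x. \<Sum>i<Suc n. x i) \<circ> (\<lambda>(r, s). \<lambda>i\<in>{..<Suc n}. r * s i) \<in> borel_measurable (\<nu> \<Otimes>\<^sub>M simplex_law n)"
      by (rule measurable_comp[OF scale_measurable' m])
    show "fst \<in> borel_measurable (\<nu> \<Otimes>\<^sub>M simplex_law n)" by measurable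
  qed
  also have "\<dots> = distr \<nu> borel id"
  proof (rule measure_eqI)
    fix A assume "A \<in> sets (distr (\<nu> \<Otimes>\<^sub>M simplex_law n) borel fst)"
    then have A: "A \<in> sets \<nu>" by (simp add: sets_nu)
    have "fst -` A \<inter> space (\<nu> \<Otimes>\<^sub>M simplex_law n) = A \<times> space (simplex_law n)"
      using sets.sets_into_space[OF A] by (auto simp: space_pair_measure)
    then show "emeasure (distr (\<nu> \<Otimes>\<^sub>M simplex_law n) borel fst) A = emeasure (distr \<nu> borel id) A"
      using A sx.emeasure_pair_measure_Times[OF A sets.top]
      by (simp add: emeasure_distr sets_nu space_nu sx.emeasure_space_1)
  qed simp
  also have "\<dots> = \<nu>" by (simp add: distr_id2 sets_nu id_def)
  finally show ?thesis .
qed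

lemma copula_law_measurable: "(\<lambda>x. \<lambda>i\<in>{..<Suc n}. williamson n \<nu> (x i)) \<in> l1_law n \<nu> \<rightarrow>\<^sub>M cube_borel (Suc n)"
proof (rule measurable_restrict)
  fix i assume "i \<in> {..<Suc n}"
  then have m: "(\<lambda>s. s i) \<in> rborel (Suc n) \<rightarrow>\<^sub>M borel"
    by (intro measurable_component_singleton)
  have "(\<lambda>x. williamson n \<nu> (x i)) \<in> rborel (Suc n) \<rightarrow>\<^sub>M unit_borel"
    using measurable_compose[OF m williamson_measurable] williamson_bounds
    by (intro measurable_restrict_space2) auto
  then show "(\<lambda>x. williamson n \<nu> (x i)) \<in> l1_law n \<nu> \<rightarrow>\<^sub>M unit_borel"
    by (simp only: measurable_cong_sets[OF sets_l1_law refl])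
qed

lemma prob_space_copula_law: "prob_space (copula_law n \<nu>)"
  unfolding copula_law_def by (rule el.prob_space_distr[OF copula_law_measurable])

lemma sets_copula_law: "sets (copula_law n \<nu>) = sets (cube_borel (Suc n))"
  by (simp add: copula_law_def)

definition low :: "(nat \<Rightarrow> real) \<Rightarrow> (nat \<Rightarrow> real) set" where
  "low x = {z \<in> space (rborel (Suc n)). \<forall>i<Suc n. williamson n \<nu> (z i) \<le> x i}"

lemma emeasure_copula_law_down:
  "emeasure (copula_law n \<nu>) {y \<in> cube (Suc n). \<forall>i<Suc n. y i \<le> x i} = emeasure (l1_law n \<nu>) (low x)"
proof -
  have "(\<lambda>x. \<lambda>i\<in>{..<Suc n}. williamson n \<nu> (x i)) -` {y \<in> cube (Suc n). \<forall>i<Suc n. y i \<le> x i} \<inter> space (l1_law n \<nu>) = low x"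
    using williamson_bounds by (auto simp: low_def cube_def)
  then show ?thesis
    unfolding copula_law_def by (simp only: emeasure_distr[OF copula_law_measurable sets_down])
qed

lemma sets_low: "low x \<in> sets (l1_law n \<nu>)"
proof -
  have "{z \<in> space (rborel (Suc n)). \<forall>i\<in>{..<Suc n}. williamson n \<nu> (z i) \<le> x i} \<in> sets (rborel (Suc n))"
  proof (rule sets.sets_Collect_finite_All)
    fix i assume "i \<in> {..<Suc n}"
    then have [measurable]: "(\<lambda>s. s i) \<in> rborel (Suc n) \<rightarrow>\<^sub>M borel"
      by (intro measurable_component_singleton)
    show "{z \<in> space (rborel (Suc n)). williamson n \<nu> (z i) \<le> x i} \<in> sets (rborel (Suc n))" by measurable
  qed simp
  then show ?thesis by (simp only: low_def sets_l1_law Ball_def lessThan_iff)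
qed

lemma emeasure_low_pos:
  assumes x: "x \<in> cube (Suc n)" and xpos: "\<And>i. i < Suc n \<Longrightarrow> 0 < x i"
  shows "emeasure (l1_law n \<nu>) (low x) = ennreal (arch (williamson n \<nu>) (Suc n) x)"
proof -
  have "emeasure (l1_law n \<nu>) (low x) = emeasure (l1_law n \<nu>) (up (Suc n) (\<lambda>i. gen_inv (williamson n \<nu>) (x i)))"
  proof (rule emeasure_eq_AE)
    show "AE z in l1_law n \<nu>. z \<in> low x \<longleftrightarrow> z \<in> up (Suc n) (\<lambda>i. gen_inv (williamson n \<nu>) (x i))"
      using AE_l1_law_nonneg
    proof eventually_elim
      case (elim z)
      have "williamson n \<nu> (z i) \<le> x i \<longleftrightarrow> gen_inv (williamson n \<nu>) (x i) \<le> z i" if "i < Suc n" for i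
        using gen_inv_le_iff[of "x i" "z i"] xpos[OF that] cubeD[OF x that] elim that by blast
      then show ?case by (auto simp: low_def up_def)
    qed
    show "low x \<in> sets (l1_law n \<nu>)" by (rule sets_low)
    show "up (Suc n) (\<lambda>i. gen_inv (williamson n \<nu>) (x i)) \<in> sets (l1_law n \<nu>)"
      unfolding up_def sets_l1_law by (rule sets_up)
  qed
  also have "\<dots> = ennreal (williamson n \<nu> (\<Sum>i<Suc n. gen_inv (williamson n \<nu>) (x i)))"
    by (rule emeasure_l1_law_up) (rule gen_inv_nonneg)
  also have "williamson n \<nu> (\<Sum>i<Suc n. gen_inv (williamson n \<nu>) (x i)) = arch (williamson n \<nu>) (Suc n) x"
  proof -
    have "\<not> (\<exists>i<Suc n. x i = 0)" using xpos by fastforce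
    then show ?thesis unfolding arch_def by (simp only: if_False)
  qed
  finally show ?thesis .
qed

lemma gen_inv_one: "gen_inv (williamson n \<nu>) 1 = 0"
  using gen_inv_eq[of 0] by (simp add: at_zero)

lemma arch_single:
  assumes "i < Suc n" "0 < u" "u \<le> 1"
  shows "arch (williamson n \<nu>) (Suc n) (\<lambda>j\<in>{..<Suc n}. if j = i then u else 1) = u"
proof -
  have "(\<Sum>j<Suc n. gen_inv (williamson n \<nu>) ((\<lambda>j\<in>{..<Suc n}. if j = i then u else 1) j)) =
      (\<Sum>j<Suc n. if j = i then gen_inv (williamson n \<nu>) u else 0)"
    by (rule sum.cong) (auto simp: gen_inv_one)
  also have "\<dots> = gen_inv (williamson n \<nu>) u" using assms by (subst sum.delta) auto
  finally have s: "(\<Sum>j<Suc n. gen_inv (williamson n \<nu>) ((\<lambda>j\<in>{..<Suc n}. if j = i then u else 1) j)) = gen_inv (williamson n \<nu>) u" .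
  have "\<not> (\<exists>j<Suc n. (\<lambda>j\<in>{..<Suc n}. if j = i then u else 1) j = (0::real))" using assms by auto
  then show ?thesis unfolding arch_def s using gen_inv(2)[of u] assms by (simp only: if_False)
qed

lemma single_cube: "0 \<le> u \<Longrightarrow> u \<le> 1 \<Longrightarrow> (\<lambda>j\<in>{..<Suc n}. if j = i then u else 1) \<in> cube (Suc n)"
  by (auto simp: cube_def)

text \<open>If a coordinate of \<open>x\<close> vanishes, its inverse under the generator may be
  infinite. The set is then enclosed in those with this coordinate replaced by a small
  \<open>u\<close> and all others by 1, which have mass \<open>u\<close>.\<close>

lemma emeasure_low:
  assumes x: "x \<in> cube (Suc n)"
  shows "emeasure (l1_law n \<nu>) (low x) = ennreal (arch (williamson n \<nu>) (Suc n) x)"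
proof (cases "\<exists>i<Suc n. x i = 0")
  case False
  then have "0 < x i" if "i < Suc n" for i using cubeD[OF x that] that by (metis order_le_less)
  then show ?thesis by (rule emeasure_low_pos[OF x])
next
  case True
  then obtain i where i: "i < Suc n" "x i = 0" by blast
  have "emeasure (l1_law n \<nu>) (low x) \<le> 0 + ennreal e" if e: "0 < e" for e
  proof -
    define u where "u = min e 1"
    have u: "0 < u" "u \<le> 1" "u \<le> e" using e by (auto simp: u_def)
    let ?y = "\<lambda>j\<in>{..<Suc n}. if j = i then u else 1"
    have "low x \<subseteq> low ?y"
    proof
      fix z assume z: "z \<in> low x"
      have "williamson n \<nu> (z j) \<le> ?y j" if "j < Suc n" for j
      proof (cases "j = i")
        case True
        have "williamson n \<nu> (z i) \<le> x i" using z i(1) unfolding low_def by blast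
        then show ?thesis using True i u by simp
      next
        case False
        then show ?thesis using that williamson_bounds(2)[of "z j"] by simp
      qed
      then show "z \<in> low ?y" using z unfolding low_def by blast
    qed
    then have "emeasure (l1_law n \<nu>) (low x) \<le> emeasure (l1_law n \<nu>) (low ?y)"
      by (rule emeasure_mono[OF _ sets_low])
    also have "\<dots> = ennreal u"
      using emeasure_low_pos[OF single_cube, of u i] u arch_single[OF i(1), of u] by simp
    also have "\<dots> \<le> ennreal e" using u by (intro ennreal_leI) auto
    finally show ?thesis by simp
  qed
  then have "emeasure (l1_law n \<nu>) (low x) \<le> 0" by (rule ennreal_le_epsilon)
  moreover have "arch (williamson n \<nu>) (Suc n) x = 0" using True unfolding arch_def by (simp only: if_True)
  ultimately show ?thesis by simp
qed

lemma has_distribution_function_radial_copula: "has_distribution_function (Suc n) (copula_law n \<nu>) (radial_copula n \<nu>)"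
  unfolding has_distribution_function_def
proof (intro conjI ballI)
  show "prob_space (copula_law n \<nu>)" by (rule prob_space_copula_law)
  show "sets (copula_law n \<nu>) = sets (cube_borel (Suc n))" by (rule sets_copula_law)
  fix x assume x: "x \<in> cube (Suc n)"
  have "0 \<le> arch (williamson n \<nu>) (Suc n) x" unfolding arch_def using williamson_bounds by (simp split: if_split)
  moreover have "radial_copula n \<nu> x = arch (williamson n \<nu>) (Suc n) x"
    unfolding radial_copula_def using x by (simp only: restrict_apply if_True)
  ultimately show "radial_copula n \<nu> x = measure (copula_law n \<nu>) {y \<in> cube (Suc n). \<forall>i<Suc n. y i \<le> x i}"
    unfolding measure_def emeasure_copula_law_down emeasure_low[OF x] by (simp only: enn2real_ennreal)
qed

lemma margin_copula_law:
  assumes i: "i < Suc n"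
  shows "distr (copula_law n \<nu>) unit_borel (\<lambda>y. y i) = unit_lebesgue"
proof (rule unit_borel_eqI)
  interpret U: prob_space "copula_law n \<nu>" by (rule prob_space_copula_law)
  have m: "(\<lambda>y. y i) \<in> copula_law n \<nu> \<rightarrow>\<^sub>M unit_borel"
    using coord_measurable_unit[OF i] by (simp only: measurable_cong_sets[OF sets_copula_law refl])
  have sp: "space (copula_law n \<nu>) = cube (Suc n)"
    using sets_eq_imp_space_eq[OF sets_copula_law] by (simp add: space_cube_borel)
  show "sets (distr (copula_law n \<nu>) unit_borel (\<lambda>y. y i)) = sets unit_borel" by simp
  show "sets unit_lebesgue = sets unit_borel" by (rule restrict_space_sets_cong) auto
  interpret D: prob_space "distr (copula_law n \<nu>) unit_borel (\<lambda>y. y i)" by (rule U.prob_space_distr[OF m])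
  show "emeasure (distr (copula_law n \<nu>) unit_borel (\<lambda>y. y i)) {0..1} \<noteq> \<infinity>" by simp
  fix a :: real assume a: "0 \<le> a" "a \<le> 1"
  let ?x = "\<lambda>j\<in>{..<Suc n}. if j = i then a else 1"
  have S: "{0..a} \<in> sets unit_borel" using a by (subst sets_restrict_space_iff) auto
  have "(\<lambda>y. y i) -` {0..a} \<inter> space (copula_law n \<nu>) = {y \<in> cube (Suc n). \<forall>j<Suc n. y j \<le> ?x j}"
    unfolding sp
  proof (intro set_eqI iffI)
    fix y assume "y \<in> (\<lambda>y. y i) -` {0..a} \<inter> cube (Suc n)"
    then have y: "y \<in> cube (Suc n)" "y i \<le> a" by auto
    have "y j \<le> ?x j" if "j < Suc n" for j using cubeD[OF y(1) that] y(2) that by simp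
    then show "y \<in> {y \<in> cube (Suc n). \<forall>j<Suc n. y j \<le> ?x j}" using y(1) by blast
  next
    fix y assume "y \<in> {y \<in> cube (Suc n). \<forall>j<Suc n. y j \<le> ?x j}"
    then have y: "y \<in> cube (Suc n)" "y i \<le> ?x i" using i by blast+
    then show "y \<in> (\<lambda>y. y i) -` {0..a} \<inter> cube (Suc n)" using cubeD[OF y(1) i] i by simp
  qed
  then have "emeasure (distr (copula_law n \<nu>) unit_borel (\<lambda>y. y i)) {0..a} = ennreal (arch (williamson n \<nu>) (Suc n) ?x)"
    by (simp only: emeasure_distr[OF m S] emeasure_copula_law_down emeasure_low[OF single_cube[OF a]])
  also have "arch (williamson n \<nu>) (Suc n) ?x = a"
  proof (cases "a = 0")
    case True
    then show ?thesis using i by (auto simp: arch_def)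
  qed (use arch_single[OF i, of a] a in auto)
  also have "ennreal a = emeasure unit_lebesgue {0..a}"
    using a by (subst emeasure_restrict_space) auto
  finally show "emeasure (distr (copula_law n \<nu>) unit_borel (\<lambda>y. y i)) {0..a} = emeasure unit_lebesgue {0..a}" .
qed

lemma copula_radial_copula: "copula (Suc n) (radial_copula n \<nu>)"
  unfolding copula_def
  using has_distribution_function_radial_copula margin_copula_law by (auto simp: radial_copula_def)

lemma radial_copula_archimedean: "radial_copula n \<nu> \<in> archimedean_copulas (Suc n)"
  unfolding archimedean_copulas_iff using copula_radial_copula generator_williamson by (auto simp: radial_copula_def)

lemma copula_measure_radial_copula: "copula_measure (Suc n) (radial_copula n \<nu>) = copula_law n \<nu>"
  by (rule copula_measure_eq[OF has_distribution_function_radial_copula])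

end

section \<open>Williamson representation\<close>

text \<open>
  If \<open>P (\<forall>i. c\<^sub>i \<le> X\<^sub>i) = \<psi> (\<Sum>i. c\<^sub>i)\<close>, then the point masses of the rounded vector \<open>\<lfloor>m X\<rfloor>\<close> depend
  only on the sum of the coordinates, so given its sum this vector is uniform on a set of
  compositions. Counting compositions and letting \<open>m\<close> tend to infinity exhibits \<open>\<psi>\<close> as the Williamson
  transform of the law of \<open>\<Sum>i. X\<^sub>i\<close>, without differentiating \<open>\<psi>\<close>.
\<close>

definition compositions :: "nat \<Rightarrow> nat \<Rightarrow> (nat \<Rightarrow> nat) set" where
  "compositions d k = {c \<in> extensional {..<d}. (\<Sum>i<d. c i) = k}"

text \<open>Carries the stars-and-bars count over from lists to functions.\<close>

lemma bij_betw_compositions: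
  "bij_betw (\<lambda>l. \<lambda>i\<in>{..<d}. l ! i) {l. length l = d \<and> sum_list l = k} (compositions d k)"
proof (rule bij_betw_byWitness[where f' = "\<lambda>c. map c [0..<d]"])
  show "\<forall>l\<in>{l. length l = d \<and> sum_list l = k}. map (\<lambda>i\<in>{..<d}. l ! i) [0..<d] = l"
    by (auto intro!: nth_equalityI)
  show "\<forall>c\<in>compositions d k. (\<lambda>i\<in>{..<d}. map c [0..<d] ! i) = c"
    by (auto simp: compositions_def fun_eq_iff extensional_def)
  show "(\<lambda>l. \<lambda>i\<in>{..<d}. l ! i) ` {l. length l = d \<and> sum_list l = k} \<subseteq> compositions d k"
    by (auto simp: compositions_def sum_list_sum_nth atLeast0LessThan)
  show "(\<lambda>c. map c [0..<d]) ` compositions d k \<subseteq> {l. length l = d \<and> sum_list l = k}"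
    by (auto simp: compositions_def sum_list_sum_nth atLeast0LessThan)
qed

lemma card_compositions: "card (compositions (Suc n) k) = (k + n) choose n"
proof -
  have "card (compositions (Suc n) k) = card {l::nat list. length l = Suc n \<and> sum_list l = k}"
    by (rule bij_betw_same_card[symmetric, OF bij_betw_compositions])
  also have "\<dots> = (k + n) choose k" by (simp add: card_length_sum_list)
  also have "\<dots> = (k + n) choose n" by (subst binomial_symmetric) auto
  finally show ?thesis .
qed

lemma finite_compositions: "finite (compositions d k)"
proof (rule finite_subset)
  show "compositions d k \<subseteq> {..<d} \<rightarrow>\<^sub>E {..k}"
  proof
    fix c assume c: "c \<in> compositions d k"
    have "c i \<le> k" if "i < d" for i
      using c member_le_sum[of i "{..<d}" c] that by (auto simp: compositions_def)
    then show "c \<in> {..<d} \<rightarrow>\<^sub>E {..k}" using c by (auto simp: compositions_def PiE_iff)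
  qed
  show "finite ({..<d} \<rightarrow>\<^sub>E {..k})" by (intro finite_PiE) auto
qed

text \<open>Subtracting \<open>m\<close> from entry 0 is a bijection onto the compositions of
  \<open>k - m\<close>.\<close>

lemma card_compositions_ge:
  "card {c \<in> compositions (Suc n) k. m \<le> c 0} = (if m \<le> k then card (compositions (Suc n) (k - m)) else 0)"
proof (cases "m \<le> k")
  case True
  have "bij_betw (\<lambda>c. c(0 := c 0 + m)) (compositions (Suc n) (k - m)) {c \<in> compositions (Suc n) k. m \<le> c 0}"
  proof (rule bij_betw_byWitness[where f' = "\<lambda>c. c(0 := c 0 - m)"])
    show "\<forall>c\<in>compositions (Suc n) (k - m). (c(0 := c 0 + m))(0 := (c(0 := c 0 + m)) 0 - m) = c"
      by simp
    show "\<forall>c\<in>{c \<in> compositions (Suc n) k. m \<le> c 0}. (c(0 := c 0 - m))(0 := (c(0 := c 0 - m)) 0 + m) = c"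
      by simp
    show "(\<lambda>c. c(0 := c 0 + m)) ` compositions (Suc n) (k - m) \<subseteq> {c \<in> compositions (Suc n) k. m \<le> c 0}"
      using True by (auto simp: compositions_def sum.lessThan_Suc_shift extensional_def simp del: sum.lessThan_Suc)
    show "(\<lambda>c. c(0 := c 0 - m)) ` {c \<in> compositions (Suc n) k. m \<le> c 0} \<subseteq> compositions (Suc n) (k - m)"
      by (auto simp: compositions_def sum.lessThan_Suc_shift extensional_def simp del: sum.lessThan_Suc)
  qed
  then show ?thesis using True bij_betw_same_card by force
next
  case False
  have "\<not> m \<le> c 0" if "c \<in> compositions (Suc n) k" for c
    using that False member_le_sum[of 0 "{..<Suc n}" c] by (auto simp: compositions_def)
  then have "{c \<in> compositions (Suc n) k. m \<le> c 0} = {}" by blast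
  then show ?thesis using False by (simp only: if_False card.empty)
qed

lemma binomial_prod: "real ((k + n) choose n) = (\<Prod>j=1..n. real (k + j)) / fact n"
proof (induction n)
  case (Suc n)
  have "real (Suc (k + n)) * real ((k + n) choose n) = real (Suc (k + n) choose Suc n) * real (Suc n)"
    using Suc_times_binomial_eq[of "k + n" n] by (simp only: of_nat_mult[symmetric])
  then have b: "real (Suc (k + n) choose Suc n) = real (Suc (k + n)) * real ((k + n) choose n) / real (Suc n)"
    by (simp only: nonzero_eq_divide_eq of_nat_neq_0 not_False_eq_True)
  have p: "(\<Prod>j=1..Suc n. real (k + j)) = (\<Prod>j=1..n. real (k + j)) * real (Suc (k + n))" by simp
  show ?case unfolding add_Suc_right b Suc p fact_Suc of_nat_mult by (simp add: ac_simps)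
qed simp

text \<open>The probability that entry 0 of a uniform composition of \<open>k\<close> into
  \<open>n + 1\<close> parts is at least \<open>m\<close>, a discrete counterpart of
  \<open>tail n (m / k)\<close>. The quotient of binomials is written as a product of
  \<open>n\<close> factors so that limits can be taken factor by factor.\<close>

definition ratio :: "nat \<Rightarrow> nat \<Rightarrow> nat \<Rightarrow> real" where
  "ratio n m k = (if m \<le> k then \<Prod>j=1..n. (real k - real m + real j) / (real k + real j) else 0)"

lemma ratio_bounds: "0 \<le> ratio n m k" "ratio n m k \<le> 1"
  unfolding ratio_def by (auto intro!: prod_nonneg prod_le_1)

lemma card_compositions_ratio:
  "real (card {c \<in> compositions (Suc n) k. m \<le> c 0}) = ratio n m k * real (card (compositions (Suc n) k))"
proof (cases "m \<le> k")
  case True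
  have pos: "(\<Prod>j=1..n. real (k + j)) > 0" by (rule prod_pos) auto
  have e: "(\<Prod>j=1..n. real k - real m + real j) = (\<Prod>j=1..n. real (k - m + j))"
    by (rule prod.cong) (use True in auto)
  have "ratio n m k = (\<Prod>j=1..n. real (k - m + j)) / (\<Prod>j=1..n. real (k + j))"
    unfolding ratio_def prod_dividef e of_nat_add[symmetric] using True by (simp only: if_True)
  then have "ratio n m k * ((\<Prod>j=1..n. real (k + j)) / fact n) = (\<Prod>j=1..n. real (k - m + j)) / fact n"
    using pos by simp
  then show ?thesis using True
    by (simp only: card_compositions_ge card_compositions binomial_prod if_True)
next
  case False
  then show ?thesis by (simp only: card_compositions_ge ratio_def if_False)
qed

text \<open>The \<open>j\<close>-th difference with alternating sign: it plays the role of the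
  \<open>j\<close>-th derivative times its sign in the definition of monotonicity of higher
  order.\<close>

fun back_diff :: "(nat \<Rightarrow> real) \<Rightarrow> nat \<Rightarrow> nat \<Rightarrow> real" where
  "back_diff a 0 k = a k"
| "back_diff a (Suc j) k = back_diff a j k - back_diff a j (Suc k)"

text \<open>Schur-constant vectors of natural numbers: the joint survival function depends on the
  corner only through its sum.\<close>

locale schur_lattice = prob_space M for M :: "'a measure" +
  fixes d :: nat and K :: "nat \<Rightarrow> 'a \<Rightarrow> nat" and a :: "nat \<Rightarrow> real"
  assumes K[measurable]: "\<And>i. K i \<in> M \<rightarrow>\<^sub>M count_space UNIV"
    and surv: "\<And>c. prob {w \<in> space M. \<forall>i<d. c i \<le> K i w} = a (\<Sum>i<d. c i)"
begin

lemma sets_all: "(\<And>i. {w \<in> space M. P i w} \<in> sets M) \<Longrightarrow> {w \<in> space M. \<forall>i<d. P i w} \<in> sets M"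
proof -
  assume "\<And>i. {w \<in> space M. P i w} \<in> sets M"
  then have "{w \<in> space M. \<forall>i\<in>{..<d}. P i w} \<in> sets M"
    by (intro sets.sets_Collect_finite_All) auto
  then show ?thesis by (simp only: Ball_def lessThan_iff)
qed

text \<open>As for grid cells, an equality in coordinate \<open>j\<close> is obtained by removing
  the set with \<open>c j\<close> raised by one. This raises the sum by one and thus takes one more
  difference of \<open>a\<close>.\<close>

lemma prob_mixed:
  "j \<le> d \<Longrightarrow> prob {w \<in> space M. \<forall>i<d. c i \<le> K i w \<and> (i < j \<longrightarrow> K i w = c i)} = back_diff a j (\<Sum>i<d. c i)"
proof (induction j arbitrary: c)
  case 0
  then show ?case using surv by simp
next
  case (Suc j)
  let ?S = "\<lambda>j c. {w \<in> space M. \<forall>i<d. c i \<le> K i w \<and> (i < j \<longrightarrow> K i w = c i)}"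
  let ?c = "c(j := Suc (c j))"
  have jd: "j < d" using Suc.prems by simp
  have meas: "?S j c \<in> sets M" for j c
    by (rule sets_all) measurable
  have eq: "?S (Suc j) c = ?S j c - ?S j ?c"
  proof -
    have S1: "w \<in> ?S j b \<longleftrightarrow> w \<in> space M \<and> b j \<le> K j w \<and> (\<forall>i<d. i \<noteq> j \<longrightarrow> b i \<le> K i w \<and> (i < j \<longrightarrow> K i w = b i))" for w b
      using jd by auto
    have S2: "w \<in> ?S (Suc j) c \<longleftrightarrow> w \<in> space M \<and> K j w = c j \<and> (\<forall>i<d. i \<noteq> j \<longrightarrow> c i \<le> K i w \<and> (i < j \<longrightarrow> K i w = c i))" for w
      using jd by (auto simp: less_Suc_eq)
    have "w \<in> ?S (Suc j) c \<longleftrightarrow> w \<in> ?S j c \<and> w \<notin> ?S j ?c" for w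
      unfolding S1 S2 by (cases "K j w = c j") auto
    then show ?thesis by blast
  qed
  have sub: "?S j ?c \<subseteq> ?S j c"
  proof
    fix w assume w: "w \<in> ?S j ?c"
    have "c i \<le> K i w \<and> (i < j \<longrightarrow> K i w = c i)" if "i < d" for i
    proof -
      have "?c i \<le> K i w \<and> (i < j \<longrightarrow> K i w = ?c i)" using w that by blast
      then show ?thesis by (auto split: if_splits)
    qed
    then show "w \<in> ?S j c" using w by blast
  qed
  have "(\<Sum>i<d. ?c i) = Suc (\<Sum>i<d. c i)"
  proof -
    have "(\<Sum>i<d. ?c i) = ?c j + (\<Sum>i\<in>{..<d} - {j}. ?c i)" using jd by (intro sum.remove) auto
    also have "(\<Sum>i\<in>{..<d} - {j}. ?c i) = (\<Sum>i\<in>{..<d} - {j}. c i)" by (rule sum.cong) auto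
    also have "?c j + \<dots> = Suc (c j + (\<Sum>i\<in>{..<d} - {j}. c i))" by simp
    also have "c j + (\<Sum>i\<in>{..<d} - {j}. c i) = (\<Sum>i<d. c i)" using jd by (intro sum.remove[symmetric]) auto
    finally show ?thesis .
  qed
  moreover have "prob (?S (Suc j) c) = prob (?S j c) - prob (?S j ?c)"
    unfolding eq by (rule finite_measure_Diff[OF meas meas sub])
  ultimately show ?case using Suc.IH[of c] Suc.IH[of ?c] jd by (simp del: fun_upd_apply)
qed

lemma prob_eq: "prob {w \<in> space M. \<forall>i<d. K i w = c i} = back_diff a d (\<Sum>i<d. c i)"
proof -
  have "{w \<in> space M. \<forall>i<d. K i w = c i} = {w \<in> space M. \<forall>i<d. c i \<le> K i w \<and> (i < d \<longrightarrow> K i w = c i)}"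
    by auto
  then show ?thesis using prob_mixed[of d c] by (simp only: order_refl simp_thms)
qed

lemma prob_compositions:
  assumes "T \<subseteq> compositions d k"
  shows "prob {w \<in> space M. (\<lambda>i\<in>{..<d}. K i w) \<in> T} = real (card T) * back_diff a d k"
proof -
  let ?S = "\<lambda>c. {w \<in> space M. \<forall>i<d. K i w = c i}"
  have fin: "finite T" using assms finite_compositions finite_subset by blast
  have iff: "(\<lambda>i\<in>{..<d}. K i w) = c \<longleftrightarrow> (\<forall>i<d. K i w = c i)" if "c \<in> T" for w c
    using that assms by (auto simp: compositions_def fun_eq_iff extensional_def)
  have "{w \<in> space M. (\<lambda>i\<in>{..<d}. K i w) \<in> T} = (\<Union>c\<in>T. ?S c)"
  proof (intro set_eqI iffI)
    fix w assume w: "w \<in> {w \<in> space M. (\<lambda>i\<in>{..<d}. K i w) \<in> T}"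
    then have T: "(\<lambda>i\<in>{..<d}. K i w) \<in> T" by blast
    then have "\<forall>i<d. K i w = (\<lambda>i\<in>{..<d}. K i w) i" using iff by blast
    then show "w \<in> (\<Union>c\<in>T. ?S c)" using T w by blast
  next
    fix w assume "w \<in> (\<Union>c\<in>T. ?S c)"
    then obtain c where c: "c \<in> T" "w \<in> space M" "\<forall>i<d. K i w = c i" by blast
    then have "(\<lambda>i\<in>{..<d}. K i w) = c" using iff[OF c(1), of w] by blast
    then show "w \<in> {w \<in> space M. (\<lambda>i\<in>{..<d}. K i w) \<in> T}" using c by blast
  qed
  also have "prob \<dots> = (\<Sum>c\<in>T. prob (?S c))"
  proof (rule finite_measure_finite_Union[OF fin])
    show "?S ` T \<subseteq> sets M" by (auto intro!: sets_all)
    show "disjoint_family_on ?S T"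
    proof (unfold disjoint_family_on_def, intro ballI impI)
      fix c c' assume c: "c \<in> T" "c' \<in> T" "c \<noteq> c'"
      show "?S c \<inter> ?S c' = {}"
      proof (rule ccontr)
        assume "?S c \<inter> ?S c' \<noteq> {}"
        then obtain w where "\<forall>i<d. K i w = c i" "\<forall>i<d. K i w = c' i" by blast
        then show False using iff[OF c(1), of w] iff[OF c(2), of w] c(3) by simp
      qed
    qed
  qed
  also have "\<dots> = (\<Sum>c\<in>T. back_diff a d k)"
  proof (rule sum.cong[OF refl])
    fix c assume "c \<in> T"
    then have "(\<Sum>i<d. c i) = k" using assms by (auto simp: compositions_def)
    then show "prob (?S c) = back_diff a d k" using prob_eq[of c] by simp
  qed
  finally show ?thesis by simp
qed

text \<open>All compositions of \<open>k\<close> have the same probability, so given that the sum is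
  \<open>k\<close>, entry 0 reaches \<open>m\<close> with probability \<open>ratio n m k\<close>.
  Summing over \<open>k\<close> gives the survival probability of entry 0, which is
  \<open>a m\<close> by the corner with \<open>m\<close> in entry 0 and zeros elsewhere.\<close>

lemma first_ge:
  assumes d: "d = Suc n"
  shows "a m = (\<integral>w. ratio n m (\<Sum>i<d. K i w) \<partial>M)"
proof -
  let ?S = "\<lambda>w. \<Sum>i<d. K i w"
  let ?A = "\<lambda>k. {w \<in> space M. ?S w = k \<and> m \<le> K 0 w}"
  let ?B = "\<lambda>k. {w \<in> space M. ?S w = k}"
  have A: "?A k \<in> sets M" and B: "?B k \<in> sets M" for k by measurable
  have r: "restrict (\<lambda>i. K i w) {..<d} \<in> compositions d (?S w)" for w
    by (simp add: compositions_def)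
  have pB: "prob (?B k) = real (card (compositions d k)) * back_diff a d k" for k
  proof -
    have "?B k = {w \<in> space M. (\<lambda>i\<in>{..<d}. K i w) \<in> compositions d k}"
      using r by (auto simp: compositions_def)
    then show ?thesis using prob_compositions[of "compositions d k" k] by simp
  qed
  have pA: "prob (?A k) = real (card {c \<in> compositions d k. m \<le> c 0}) * back_diff a d k" for k
  proof -
    have "?A k = {w \<in> space M. (\<lambda>i\<in>{..<d}. K i w) \<in> {c \<in> compositions d k. m \<le> c 0}}"
      using d by (auto simp: compositions_def)
    then show ?thesis using prob_compositions[of "{c \<in> compositions d k. m \<le> c 0}" k] by simp
  qed
  have AB: "prob (?A k) = ratio n m k * prob (?B k)" for k
    by (subst pA, subst pB) (simp only: d card_compositions_ratio mult.assoc)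
  have "(\<Sum>i<d. (if i = 0 then m else 0)) = m" using d by (subst sum.delta) auto
  moreover have "{w \<in> space M. \<forall>i<d. (if i = 0 then m else 0) \<le> K i w} = {w \<in> space M. m \<le> K 0 w}"
    using d by auto
  ultimately have "a m = prob {w \<in> space M. m \<le> K 0 w}"
    using surv[of "\<lambda>i. if i = 0 then m else 0"] by simp
  then have "ennreal (a m) = emeasure M {w \<in> space M. m \<le> K 0 w}" by (simp add: emeasure_eq_measure)
  also have "{w \<in> space M. m \<le> K 0 w} = (\<Union>k. ?A k)" by auto
  also have "emeasure M \<dots> = (\<Sum>k. emeasure M (?A k))"
    by (rule suminf_emeasure[symmetric]) (use A in \<open>auto simp: disjoint_family_on_def\<close>)
  also have "\<dots> = (\<Sum>k. \<integral>\<^sup>+w. ennreal (ratio n m k) * indicator (?B k) w \<partial>M)"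
  proof (rule suminf_cong)
    fix k
    have "emeasure M (?A k) = ennreal (ratio n m k) * emeasure M (?B k)"
      unfolding emeasure_eq_measure AB by (simp add: ennreal_mult ratio_bounds)
    then show "emeasure M (?A k) = (\<integral>\<^sup>+w. ennreal (ratio n m k) * indicator (?B k) w \<partial>M)"
      using B[of k] by (simp add: nn_integral_cmult_indicator)
  qed
  also have "\<dots> = (\<integral>\<^sup>+w. (\<Sum>k. ennreal (ratio n m k) * indicator (?B k) w) \<partial>M)"
    by (rule nn_integral_suminf[symmetric]) (use B in measurable)
  also have "\<dots> = (\<integral>\<^sup>+w. ennreal (ratio n m (?S w)) \<partial>M)"
  proof (rule nn_integral_cong)
    fix w assume "w \<in> space M"
    then have "(\<Sum>k. ennreal (ratio n m k) * indicator (?B k) w) =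
        (\<Sum>k\<in>{?S w}. ennreal (ratio n m k) * indicator (?B k) w)"
      by (intro suminf_finite) auto
    also have "\<dots> = ennreal (ratio n m (?S w))" using \<open>w \<in> space M\<close> by simp
    finally show "(\<Sum>k. ennreal (ratio n m k) * indicator (?B k) w) = ennreal (ratio n m (?S w))" .
  qed
  also have "\<dots> = ennreal (\<integral>w. ratio n m (?S w) \<partial>M)"
    by (intro nn_integral_eq_integral integrable_const_bound[of _ 1])
       (auto simp: ratio_bounds abs_of_nonneg)
  finally have *: "ennreal (a m) = ennreal (\<integral>w. ratio n m (?S w) \<partial>M)" .
  have "0 \<le> a m" using surv[of "\<lambda>i. if i = 0 then m else 0"] \<open>a m = prob _\<close> by simp
  moreover have "0 \<le> (\<integral>w. ratio n m (?S w) \<partial>M)" by (intro integral_nonneg_AE) (simp add: ratio_bounds)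
  ultimately show ?thesis using * by simp
qed

end

lemma floor_scaled_LIMSEQ:
  assumes "0 \<le> x"
  shows "(\<lambda>m. real (nat \<lfloor>x * real m\<rfloor>) / real m) \<longlonglongrightarrow> x"
proof (rule tendsto_sandwich)
  show "eventually (\<lambda>m. x - 1 / real m \<le> real (nat \<lfloor>x * real m\<rfloor>) / real m) sequentially"
    using eventually_gt_at_top[of 0]
  proof eventually_elim
    case (elim m)
    have "x * real m - 1 \<le> real (nat \<lfloor>x * real m\<rfloor>)" using assms by linarith
    then have "(x * real m - 1) / real m \<le> real (nat \<lfloor>x * real m\<rfloor>) / real m"
      by (rule divide_right_mono) simp
    then show ?case using elim by (simp add: diff_divide_distrib)
  qed
  show "eventually (\<lambda>m. real (nat \<lfloor>x * real m\<rfloor>) / real m \<le> x) sequentially"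
    using eventually_gt_at_top[of 0]
  proof eventually_elim
    case (elim m)
    have "0 \<le> x * real m" using assms by simp
    then have "real (nat \<lfloor>x * real m\<rfloor>) \<le> x * real m" by linarith
    then show ?case using elim by (simp add: field_simps)
  qed
  show "(\<lambda>m. x - 1 / real m) \<longlonglongrightarrow> x"
    using tendsto_diff[OF tendsto_const lim_1_over_n, of x] by simp
qed simp

lemma ratio_LIMSEQ:
  assumes n: "n \<ge> 1" and rho: "\<rho> > 0" and lim: "(\<lambda>m. real (S m) / real m) \<longlonglongrightarrow> \<rho>"
  shows "(\<lambda>m. ratio n m (S m)) \<longlonglongrightarrow> tail n (1 / \<rho>)"
proof -
  \<comment> \<open>The product of truncated factors dominates \<open>ratio\<close> and equals it
    when \<open>m \<le> S m\<close>. It therefore also covers limits \<open>\<rho> \<le> 1\<close>,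
    where this inequality may fail infinitely often.\<close>
  define f where "f m = (\<Prod>j=1..n. max 0 ((real (S m) - real m + real j) / (real (S m) + real j)))" for m
  have fact: "(\<lambda>m. (real (S m) - real m + real j) / (real (S m) + real j)) \<longlonglongrightarrow> 1 - 1 / \<rho>" for j
  proof (rule Lim_transform_eventually)
    have jm: "(\<lambda>m. real j / real m) \<longlonglongrightarrow> 0" by (rule lim_const_over_n)
    have "(\<lambda>m. (real (S m) / real m - 1 + real j / real m) / (real (S m) / real m + real j / real m))
        \<longlonglongrightarrow> (\<rho> - 1 + 0) / (\<rho> + 0)"
      using rho by (intro tendsto_intros lim jm) auto
    moreover have "(\<rho> - 1 + 0) / (\<rho> + 0) = 1 - 1 / \<rho>" using rho by (simp add: field_simps)
    ultimately show "(\<lambda>m. (real (S m) / real m - 1 + real j / real m) / (real (S m) / real m + real j / real m))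
        \<longlonglongrightarrow> 1 - 1 / \<rho>" by simp
    show "eventually (\<lambda>m. (real (S m) / real m - 1 + real j / real m) / (real (S m) / real m + real j / real m)
        = (real (S m) - real m + real j) / (real (S m) + real j)) sequentially"
      using eventually_gt_at_top[of 0]
    proof eventually_elim
      case (elim m)
      have "real (S m) / real m - 1 + real j / real m = (real (S m) - real m + real j) / real m"
        "real (S m) / real m + real j / real m = (real (S m) + real j) / real m"
        using elim by (simp_all add: field_simps)
      then show ?case using elim by simp
    qed
  qed
  have "f \<longlonglongrightarrow> (\<Prod>j=1..n. max 0 (1 - 1 / \<rho>))"
    unfolding f_def by (intro tendsto_prod tendsto_max tendsto_const fact)
  moreover have "(\<Prod>j=1..n. max 0 (1 - 1 / \<rho>)) = tail n (1 / \<rho>)"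
    using rho by (simp add: tail_eq_max[OF n] max_def)
  ultimately have f: "f \<longlonglongrightarrow> tail n (1 / \<rho>)" by simp
  have ratio_f: "ratio n m (S m) = f m" if "m \<le> S m" for m
    unfolding ratio_def f_def using that by (auto intro!: prod.cong simp: max_def)
  have f0: "0 \<le> f m" for m unfolding f_def by (rule prod_nonneg) simp
  show ?thesis
  proof (cases "\<rho> > 1")
    case True
    have "eventually (\<lambda>m. 1 < real (S m) / real m) sequentially" using order_tendstoD(1)[OF lim True] .
    then have "eventually (\<lambda>m. f m = ratio n m (S m)) sequentially"
      using eventually_gt_at_top[of 0]
    proof eventually_elim
      case (elim m)
      then have "m \<le> S m" by (simp add: field_simps)
      then show ?case using ratio_f by simp
    qed
    then show ?thesis by (rule Lim_transform_eventually[OF f])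
  next
    case False
    then have z: "tail n (1 / \<rho>) = 0" using rho n by (simp add: tail_eq_max[OF n] max_def)
    show ?thesis
    proof (rule tendsto_sandwich[where f="\<lambda>_. 0" and h=f])
      show "f \<longlonglongrightarrow> tail n (1 / \<rho>)" by (rule f)
      show "(\<lambda>_. 0) \<longlonglongrightarrow> tail n (1 / \<rho>)" unfolding z by simp
      show "eventually (\<lambda>m. ratio n m (S m) \<le> f m) sequentially"
        using ratio_f f0 by (intro always_eventually allI) (metis order_refl ratio_def)
    qed (simp add: ratio_bounds)
  qed
qed

text \<open>Rounding the vector to a lattice keeps it Schur-constant. The lattice identity expresses
  \<open>\<psi> z\<close> exactly for every mesh, and only its right-hand side has to converge,
  which dominated convergence provides.\<close>

lemma schur_representation:
  assumes M: "prob_space M" and psi: "generator \<psi>" and n: "n \<ge> 1"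
    and X[measurable]: "\<And>i. X i \<in> borel_measurable M" and X0: "\<And>i w. 0 \<le> X i w"
    and surv: "\<And>c. (\<And>i. i < Suc n \<Longrightarrow> 0 \<le> c i) \<Longrightarrow>
      measure M {w \<in> space M. \<forall>i<Suc n. c i \<le> X i w} = \<psi> (\<Sum>i<Suc n. c i)"
    and pos: "AE w in M. 0 < (\<Sum>i<Suc n. X i w)"
    and z: "0 < z"
  shows "\<psi> z = (\<integral>w. tail n (z / (\<Sum>i<Suc n. X i w)) \<partial>M)"
proof -
  interpret prob_space M by fact
  \<comment> \<open>The mesh \<open>z / m\<close> places the level \<open>z\<close> at the lattice
    point \<open>m\<close>, whatever \<open>m\<close> is.\<close>
  define K where "K m i w = nat \<lfloor>X i w / z * real m\<rfloor>" for m i w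
  have K[measurable]: "K m i \<in> M \<rightarrow>\<^sub>M count_space UNIV" for m i
    unfolding K_def by measurable
  have lat: "schur_lattice M (Suc n) (K m) (\<lambda>k. \<psi> (z / real m * real k))" if m: "m > 0" for m
  proof unfold_locales
    fix c :: "nat \<Rightarrow> nat"
    have "c i \<le> K m i w \<longleftrightarrow> z / real m * real (c i) \<le> X i w" for i w
    proof -
      have "c i \<le> K m i w \<longleftrightarrow> real (c i) \<le> X i w / z * real m"
        using X0[of i w] z by (simp add: K_def le_nat_iff le_floor_iff)
      also have "\<dots> \<longleftrightarrow> z / real m * real (c i) \<le> X i w"
        using m z by (simp add: field_simps)
      finally show ?thesis .
    qed
    then show "prob {w \<in> space M. \<forall>i<Suc n. c i \<le> K m i w} = \<psi> (z / real m * real (\<Sum>i<Suc n. c i))"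
      using surv[of "\<lambda>i. z / real m * real (c i)"] z
      by (simp add: sum_distrib_left of_nat_sum del: sum.lessThan_Suc)
  qed (rule K)
  have eq: "\<psi> z = (\<integral>w. ratio n m (\<Sum>i<Suc n. K m i w) \<partial>M)" if m: "m > 0" for m
    using schur_lattice.first_ge[OF lat[OF m] refl, of m] m by simp
  have "(\<lambda>m. \<integral>w. ratio n m (\<Sum>i<Suc n. K m i w) \<partial>M) \<longlonglongrightarrow> (\<integral>w. tail n (z / (\<Sum>i<Suc n. X i w)) \<partial>M)"
  proof (rule integral_dominated_convergence[where w="\<lambda>_. 1"])
    show "AE w in M. (\<lambda>m. ratio n m (\<Sum>i<Suc n. K m i w)) \<longlonglongrightarrow> tail n (z / (\<Sum>i<Suc n. X i w))"
      using pos
    proof eventually_elim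
      case (elim w)
      have "(\<lambda>m. real (\<Sum>i<Suc n. K m i w) / real m) \<longlonglongrightarrow> (\<Sum>i<Suc n. X i w / z)"
        unfolding of_nat_sum sum_divide_distrib K_def
        using X0 z by (intro tendsto_sum floor_scaled_LIMSEQ) simp
      then have "(\<lambda>m. real (\<Sum>i<Suc n. K m i w) / real m) \<longlonglongrightarrow> (\<Sum>i<Suc n. X i w) / z"
        by (simp only: sum_divide_distrib)
      from ratio_LIMSEQ[OF n _ this] show ?case using elim z by simp
    qed
  qed (auto simp: ratio_bounds abs_of_nonneg simp del: sum.lessThan_Suc)
  moreover have "eventually (\<lambda>m. \<psi> z = (\<integral>w. ratio n m (\<Sum>i<Suc n. K m i w) \<partial>M)) sequentially"
    using eventually_gt_at_top[of 0] by eventually_elim (rule eq)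
  then have "(\<lambda>m. \<integral>w. ratio n m (\<Sum>i<Suc n. K m i w) \<partial>M) \<longlonglongrightarrow> \<psi> z"
    by (rule Lim_transform_eventually[OF tendsto_const])
  ultimately show ?thesis using LIMSEQ_unique by blast
qed

lemma arch_zero: "\<exists>i<d. x i = 0 \<Longrightarrow> arch \<psi> d x = 0"
  unfolding arch_def by (simp only: if_True)

lemma arch_nonzero: "\<not> (\<exists>i<d. x i = 0) \<Longrightarrow> arch \<psi> d x = \<psi> (\<Sum>i<d. gen_inv \<psi> (x i))"
  unfolding arch_def by (simp only: if_False)

lemma radial_copula_eq: "x \<in> cube (Suc n) \<Longrightarrow> radial_copula n \<nu> x = arch (williamson n \<nu>) (Suc n) x"
  unfolding radial_copula_def by (simp only: restrict_apply if_True)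

lemma (in generator_fun) arch_psi:
  assumes c: "\<And>i. i < d \<Longrightarrow> 0 \<le> c i"
  shows "arch \<psi> d (\<lambda>i\<in>{..<d}. \<psi> (c i)) = \<psi> (\<Sum>i<d. c i)"
proof (cases "\<exists>i<d. \<psi> (c i) = 0")
  case True
  then obtain i where i: "i < d" "\<psi> (c i) = 0" by blast
  have "c i \<le> (\<Sum>i<d. c i)" using i c by (intro member_le_sum) auto
  then have "\<psi> (\<Sum>i<d. c i) \<le> 0" using mono[of "c i"] c i by force
  moreover have "0 \<le> (\<Sum>i<d. c i)" using c by (intro sum_nonneg) auto
  then have "0 \<le> \<psi> (\<Sum>i<d. c i)" using bounds by blast
  moreover have "arch \<psi> d (\<lambda>i\<in>{..<d}. \<psi> (c i)) = 0" using i by (auto simp: arch_def)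
  ultimately show ?thesis by simp
next
  case False
  have "gen_inv \<psi> (\<psi> (c i)) = c i" if "i < d" for i
    using False that bounds[OF c[OF that]] c[OF that] by (intro gen_inv_eq) (auto simp: less_le)
  then have "(\<Sum>i<d. gen_inv \<psi> ((\<lambda>i\<in>{..<d}. \<psi> (c i)) i)) = (\<Sum>i<d. c i)"
    by (intro sum.cong) auto
  then show ?thesis using False by (auto simp: arch_def)
qed

lemma (in generator_fun) psi_cube: "(\<And>i. i < d \<Longrightarrow> 0 \<le> c i) \<Longrightarrow> (\<lambda>i\<in>{..<d}. \<psi> (c i)) \<in> cube d"
  using bounds by (auto simp: cube_def)

text \<open>A generator is unconstrained on negative arguments whereas \<open>williamson\<close> is
  1 there, so the two can be compared on the half-line only.\<close>

lemma arch_cong: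
  assumes "generator \<psi>" and eq: "\<And>z. 0 \<le> z \<Longrightarrow> \<psi> z = \<phi> z"
  shows "arch \<psi> d x = arch \<phi> d x"
proof -
  interpret generator_fun \<psi> by unfold_locales fact
  have "{z. 0 \<le> z \<and> \<psi> z = y} = {z. 0 \<le> z \<and> \<phi> z = y}" for y using eq by auto
  then have g: "gen_inv \<psi> = gen_inv \<phi>" by (simp only: gen_inv_def[abs_def])
  have "\<psi> (\<Sum>i<d. gen_inv \<psi> (x i)) = \<phi> (\<Sum>i<d. gen_inv \<psi> (x i))"
    by (rule eq) (simp add: sum_nonneg gen_inv_nonneg)
  then show ?thesis by (simp only: arch_def g)
qed

text \<open>Applying the inverse generator to the coordinates of a random vector with law
  \<open>copula_measure\<close> turns the orthant probabilities of the copula into a survival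
  function \<open>\<psi>\<close> of the sum of the corner. The radius is the sum of the transformed
  coordinates, positive because almost surely no coordinate equals 1.\<close>

lemma archimedean_representation:
  assumes n: "n \<ge> 1" and C: "C \<in> archimedean_copulas (Suc n)"
  obtains \<nu> where "radial n \<nu>" "C = radial_copula n \<nu>"
proof -
  obtain \<psi> where radial_copula: "copula (Suc n) C" and gen: "generator \<psi>"
    and eq: "\<And>x. x \<in> cube (Suc n) \<Longrightarrow> C x = arch \<psi> (Suc n) x"
    using C unfolding archimedean_copulas_iff by blast
  interpret generator_fun \<psi> by (rule generator_fun.intro) fact
  let ?M = "copula_measure (Suc n) C"
  note hd = has_distribution_functionD[OF copula_measureD(1)[OF radial_copula]]
  interpret M: prob_space ?M by (rule hd(1))
  \<comment> \<open>\<open>schur_representation\<close> asks for measurability and nonnegativity at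
    every index; the value 0 settles the indices outside the cube.\<close>
  define X where "X i u = (if i < Suc n then gen_inv \<psi> (u i) else 0)" for i and u :: "nat \<Rightarrow> real"
  have X: "X i \<in> borel_measurable ?M" for i
  proof (cases "i < Suc n")
    case True
    have "(\<lambda>u. gen_inv \<psi> (u i)) \<in> borel_measurable (cube_borel (Suc n))"
      by (rule measurable_compose[OF coord_measurable[OF True] gen_inv_measurable])
    then have "(\<lambda>u. gen_inv \<psi> (u i)) \<in> borel_measurable ?M"
      by (simp only: measurable_cong_sets[OF hd(2) refl])
    then show ?thesis using True by (simp add: X_def[abs_def])
  qed (simp add: X_def[abs_def])
  have X0: "0 \<le> X i u" for i u by (simp add: X_def gen_inv_nonneg)
  note int = copula_AE_interior[OF radial_copula]
  have surv: "measure ?M {u \<in> space ?M. \<forall>i<Suc n. c i \<le> X i u} = \<psi> (\<Sum>i<Suc n. c i)"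
    if c: "\<And>i. i < Suc n \<Longrightarrow> 0 \<le> c i" for c
  proof -
    let ?x = "\<lambda>i\<in>{..<Suc n}. \<psi> (c i)"
    have "{u \<in> space ?M. \<forall>i\<in>{..<Suc n}. c i \<le> X i u} \<in> sets ?M"
    proof (rule sets.sets_Collect_finite_All)
      fix i
      have "X i -` {c i..} \<inter> space ?M \<in> sets ?M" by (rule measurable_sets[OF X]) simp
      then show "{u \<in> space ?M. c i \<le> X i u} \<in> sets ?M"
        by (simp only: vimage_def Int_def mem_Collect_eq atLeast_iff conj_commute)
    qed simp
    then have S: "{u \<in> space ?M. \<forall>i<Suc n. c i \<le> X i u} \<in> sets ?M"
      by (simp only: Ball_def lessThan_iff)
    have "measure ?M {u \<in> space ?M. \<forall>i<Suc n. c i \<le> X i u} =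
        measure ?M {u \<in> cube (Suc n). \<forall>i<Suc n. u i \<le> ?x i}"
    proof (rule measure_eq_AE)
      show "AE u in ?M. u \<in> {u \<in> space ?M. \<forall>i<Suc n. c i \<le> X i u} \<longleftrightarrow>
          u \<in> {u \<in> cube (Suc n). \<forall>i<Suc n. u i \<le> ?x i}"
        using int
      proof eventually_elim
        case (elim u)
        have "c i \<le> X i u \<longleftrightarrow> u i \<le> ?x i" if "i < Suc n" for i
        proof -
          have "0 < u i" "u i \<le> 1" using elim that by (auto intro: less_imp_le)
          from le_gen_inv_iff[OF this c[OF that]] show ?thesis using that by (simp add: X_def)
        qed
        then show ?case using hd(3) by blast
      qed
      show "{u \<in> cube (Suc n). \<forall>i<Suc n. u i \<le> ?x i} \<in> sets ?M" unfolding hd(2) by (rule sets_down)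
    qed (rule S)
    also have "\<dots> = C ?x" by (rule hd(4)[OF psi_cube[OF c]])
    also have "\<dots> = \<psi> (\<Sum>i<Suc n. c i)" using eq[OF psi_cube[OF c]] arch_psi[OF c] by simp
    finally show ?thesis .
  qed
  have pos: "AE u in ?M. 0 < (\<Sum>i<Suc n. X i u)"
    using int
  proof eventually_elim
    case (elim u)
    then have u: "0 < u 0" "u 0 < 1" by auto
    then have "gen_inv \<psi> (u 0) \<noteq> 0" using gen_inv(2)[of "u 0"] at_zero by auto
    then have "0 < X 0 u" using gen_inv_nonneg[of "u 0"] by (simp add: X_def)
    also have "\<dots> \<le> (\<Sum>i<Suc n. X i u)" using X0 by (intro member_le_sum) auto
    finally show ?case .
  qed
  define R where "R u = (\<Sum>i<Suc n. X i u)" for u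
  have R[measurable]: "R \<in> borel_measurable ?M" unfolding R_def by (intro borel_measurable_sum X)
  define \<nu> where "\<nu> = distr ?M borel R"
  interpret r: radial n \<nu>
  proof (rule radial.intro)
    show "n \<ge> 1" by fact
    show "prob_space \<nu>" unfolding \<nu>_def by (rule M.prob_space_distr[OF R])
    show "sets \<nu> = sets borel" by (simp add: \<nu>_def)
    show "AE r in \<nu>. 0 < r"
      unfolding \<nu>_def by (subst AE_distr_iff[OF R]) (use pos in \<open>simp_all add: R_def\<close>)
  qed
  have "\<psi> z = williamson n \<nu> z" if z: "0 \<le> z" for z
  proof (cases "z = 0")
    case False
    have "\<psi> z = (\<integral>u. tail n (z / R u) \<partial>?M)"
      unfolding R_def using False z
      by (intro schur_representation[OF hd(1) gen n X X0 surv pos]) auto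
    also have "\<dots> = williamson n \<nu> z" unfolding williamson_def \<nu>_def by (rule integral_distr[symmetric]) measurable
    finally show ?thesis .
  qed (simp add: at_zero r.williamson_nonpos)
  then have arch: "arch \<psi> (Suc n) x = arch (williamson n \<nu>) (Suc n) x" for x
    by (rule arch_cong[OF gen])
  have "C x = radial_copula n \<nu> x" if "x \<in> cube (Suc n)" for x
    unfolding eq[OF that] radial_copula_eq[OF that] by (rule arch)
  moreover have "C \<in> extensional (cube (Suc n))" using radial_copula by (simp add: copula_def)
  ultimately have "C = radial_copula n \<nu>"
    by (intro extensionalityI[of C "cube (Suc n)"]) (auto simp: radial_copula_def)
  then show ?thesis using that r.radial_axioms by blast
qed

text \<open>Comparing the inverses of the two transforms is avoided. With \<open>z i\<close> the
  first inverse of \<open>x i\<close>, both copulas are evaluated at the same sum of the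
  \<open>z i\<close>, the second one at the shifted point with coordinates
  \<open>williamson n \<nu>' (z i)\<close>. This costs \<open>e\<close>, and moving back to
  \<open>x\<close> costs at most \<open>e\<close> per coordinate by the Lipschitz bound, hence the
  factor \<open>n + 2\<close>.\<close>

lemma radial_copula_dist_le:
  assumes "radial n \<nu>" "radial n \<nu>'"
    and e: "\<And>z. 0 \<le> z \<Longrightarrow> \<bar>williamson n \<nu> z - williamson n \<nu>' z\<bar> \<le> e"
  shows "uniform_dist (Suc n) (radial_copula n \<nu>) (radial_copula n \<nu>') \<le> real (n + 2) * e"
proof -
  interpret a: radial n \<nu> by fact
  interpret b: radial n \<nu>' by fact
  have e0: "0 \<le> e" using e[of 0] by simp
  have "\<bar>radial_copula n \<nu> x - radial_copula n \<nu>' x\<bar> \<le> real (n + 2) * e" if x: "x \<in> cube (Suc n)" for x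
  proof (cases "\<exists>i<Suc n. x i = 0")
    case True
    then have "radial_copula n \<nu> x = 0" "radial_copula n \<nu>' x = 0" unfolding radial_copula_eq[OF x] by (simp_all only: arch_zero)
    then show ?thesis using e0 by simp
  next
    case False
    have xpos: "0 < x i" "x i \<le> 1" if "i < Suc n" for i
      using cubeD[OF x that] False that by (metis order_le_less)+
    define z where "z i = gen_inv (williamson n \<nu>) (x i)" for i
    have z0: "0 \<le> z i" for i by (simp add: z_def a.gen_inv_nonneg)
    have zx: "williamson n \<nu> (z i) = x i" if "i < Suc n" for i
      using a.gen_inv(2)[OF xpos[OF that]] by (simp add: z_def)
    let ?y = "\<lambda>i\<in>{..<Suc n}. williamson n \<nu>' (z i)"
    have y: "?y \<in> cube (Suc n)" by (rule b.psi_cube) (rule z0)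
    have cx: "radial_copula n \<nu> x = williamson n \<nu> (\<Sum>i<Suc n. z i)"
      unfolding radial_copula_eq[OF x] z_def by (rule arch_nonzero[OF False])
    have "radial_copula n \<nu>' ?y = arch (williamson n \<nu>') (Suc n) ?y"
      by (rule radial_copula_eq[OF y])
    also have "\<dots> = williamson n \<nu>' (\<Sum>i<Suc n. z i)" by (rule b.arch_psi) (rule z0)
    finally have cy: "radial_copula n \<nu>' ?y = williamson n \<nu>' (\<Sum>i<Suc n. z i)" .
    have 1: "\<bar>radial_copula n \<nu> x - radial_copula n \<nu>' ?y\<bar> \<le> e"
      unfolding cx cy by (rule e) (simp add: sum_nonneg z0 del: sum.lessThan_Suc)
    have "\<bar>radial_copula n \<nu>' ?y - radial_copula n \<nu>' x\<bar> \<le> (\<Sum>i<Suc n. \<bar>?y i - x i\<bar>)"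
      by (rule copula_lipschitz[OF b.copula_radial_copula y x])
    also have "\<dots> \<le> (\<Sum>i<Suc n. e)"
    proof (rule sum_mono)
      fix i assume "i \<in> {..<Suc n}"
      then show "\<bar>?y i - x i\<bar> \<le> e" using e[OF z0, of i] zx[of i] by (simp add: abs_minus_commute)
    qed
    finally have "\<bar>radial_copula n \<nu>' ?y - radial_copula n \<nu>' x\<bar> \<le> real (Suc n) * e" by simp
    then show ?thesis using 1 by (simp add: algebra_simps)
  qed
  then show ?thesis
    unfolding uniform_dist_copula[OF a.copula_radial_copula b.copula_radial_copula]
    by (intro cSUP_least cube_nonempty)
qed

section \<open>Perturbations of the radial law\<close>

definition mix :: "real \<Rightarrow> real measure \<Rightarrow> real measure \<Rightarrow> real measure" where
  "mix e \<nu> \<nu>' = measure_pmf (bernoulli_pmf e) \<bind> (\<lambda>b. if b then \<nu>' else \<nu>)"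

locale two_radial = a: radial n \<nu> + b: radial n \<nu>' for n \<nu> \<nu>' +
  fixes e :: real
  assumes e: "0 \<le> e" "e \<le> 1"
begin

lemma kernel: "(\<lambda>b. if b then \<nu>' else \<nu>) \<in> measure_pmf (bernoulli_pmf e) \<rightarrow>\<^sub>M subprob_algebra borel"
  using a.nu.prob_space_axioms b.nu.prob_space_axioms
  by (simp add: Pi_iff space_subprob_algebra a.sets_nu b.sets_nu prob_space_imp_subprob_space)

lemma nn_integral_mix:
  assumes "f \<in> borel_measurable borel"
  shows "(\<integral>\<^sup>+x. f x \<partial>mix e \<nu> \<nu>') = ennreal (1 - e) * (\<integral>\<^sup>+x. f x \<partial>\<nu>) + ennreal e * (\<integral>\<^sup>+x. f x \<partial>\<nu>')"
proof -
  have "(\<integral>\<^sup>+x. f x \<partial>mix e \<nu> \<nu>') =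
      (\<integral>\<^sup>+b. (\<integral>\<^sup>+x. f x \<partial>(if b then \<nu>' else \<nu>)) \<partial>measure_pmf (bernoulli_pmf e))"
    unfolding mix_def by (rule nn_integral_bind[OF assms kernel])
  also have "\<dots> = ennreal (1 - e) * (\<integral>\<^sup>+x. f x \<partial>\<nu>) + ennreal e * (\<integral>\<^sup>+x. f x \<partial>\<nu>')"
    using e by (simp add: nn_integral_bernoulli_pmf ac_simps)
  finally show ?thesis .
qed

lemma sets_mix: "sets (mix e \<nu> \<nu>') = sets borel"
  unfolding mix_def by (rule sets_bind) (auto simp: a.sets_nu b.sets_nu)

lemma emeasure_mix:
  assumes "A \<in> sets borel"
  shows "emeasure (mix e \<nu> \<nu>') A = ennreal (1 - e) * emeasure \<nu> A + ennreal e * emeasure \<nu>' A"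
  using nn_integral_mix[of "indicator A"] assms by (simp add: sets_mix a.sets_nu b.sets_nu)

lemma radial_mix: "radial n (mix e \<nu> \<nu>')"
proof (rule radial.intro)
  show "n \<ge> 1" by (rule a.n)
  have sp: "space (mix e \<nu> \<nu>') = UNIV" using sets_eq_imp_space_eq[OF sets_mix] by simp
  have one: "emeasure \<nu> UNIV = 1" "emeasure \<nu>' UNIV = 1"
    using a.nu.emeasure_space_1 b.nu.emeasure_space_1 by (simp_all add: a.space_nu b.space_nu)
  have "emeasure (mix e \<nu> \<nu>') (space (mix e \<nu> \<nu>')) = 1"
    using e emeasure_mix[of UNIV] by (simp add: sp one flip: ennreal_plus)
  then show "prob_space (mix e \<nu> \<nu>')" by (rule prob_spaceI)
  show "sets (mix e \<nu> \<nu>') = sets borel" by (rule sets_mix)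
  have "AE r in \<nu>. r \<notin> {..0}" using a.pos by eventually_elim simp
  then have n1: "{..0} \<in> null_sets \<nu>" by (subst AE_iff_null_sets) (simp_all add: a.sets_nu)
  have "AE r in \<nu>'. r \<notin> {..0}" using b.pos by eventually_elim simp
  then have n2: "{..0} \<in> null_sets \<nu>'" by (subst AE_iff_null_sets) (simp_all add: b.sets_nu)
  have "emeasure (mix e \<nu> \<nu>') {..0} = 0"
    by (subst emeasure_mix) (simp_all add: null_setsD1[OF n1] null_setsD1[OF n2])
  then have "{..0} \<in> null_sets (mix e \<nu> \<nu>')" by (simp add: null_sets_def sets_mix)
  then have "AE r in mix e \<nu> \<nu>'. r \<notin> {..0}" by (rule AE_not_in)
  then show "AE r in mix e \<nu> \<nu>'. 0 < r" by eventually_elim simp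
qed

lemma williamson_mix: "williamson n (mix e \<nu> \<nu>') z = (1 - e) * williamson n \<nu> z + e * williamson n \<nu>' z"
proof -
  interpret c: radial n "mix e \<nu> \<nu>'" by (rule radial_mix)
  have "ennreal (williamson n (mix e \<nu> \<nu>') z) = ennreal (1 - e) * ennreal (williamson n \<nu> z) + ennreal e * ennreal (williamson n \<nu>' z)"
    unfolding c.williamson_ennreal a.williamson_ennreal b.williamson_ennreal by (rule nn_integral_mix) measurable
  also have "\<dots> = ennreal ((1 - e) * williamson n \<nu> z + e * williamson n \<nu>' z)"
    using e a.williamson_bounds b.williamson_bounds by (simp add: ennreal_mult ennreal_plus)
  finally show ?thesis
    using e a.williamson_bounds b.williamson_bounds c.williamson_bounds
    by (subst (asm) ennreal_inj) (auto intro!: add_nonneg_nonneg mult_nonneg_nonneg)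
qed

lemma williamson_mix_close: "\<bar>williamson n \<nu> z - williamson n (mix e \<nu> \<nu>') z\<bar> \<le> e"
proof -
  have "williamson n \<nu> z - williamson n (mix e \<nu> \<nu>') z = e * (williamson n \<nu> z - williamson n \<nu>' z)"
    by (simp add: williamson_mix algebra_simps)
  moreover have "\<bar>williamson n \<nu> z - williamson n \<nu>' z\<bar> \<le> 1" using a.williamson_bounds[of z] b.williamson_bounds[of z] by linarith
  ultimately show ?thesis using e by (simp add: abs_mult mult_left_le)
qed

end

text \<open>The density parameter \<open>n\<close> means shape \<open>n + 1\<close>. The radius is
  then the sum of \<open>n + 1\<close> independent standard exponentials, the scaled simplex vector
  has independent exponential coordinates, and the copula is the independence copula.\<close>

definition erlang :: "nat \<Rightarrow> real measure" where
  "erlang n = density lborel (erlang_density n 1)"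

lemma radial_erlang: "n \<ge> 1 \<Longrightarrow> radial n (erlang n)"
proof (rule radial.intro)
  show "prob_space (erlang n)" unfolding erlang_def by (rule prob_space_erlang_density) simp
  show "sets (erlang n) = sets borel" by (simp add: erlang_def)
  have "AE x in lborel. 0 < ennreal (erlang_density n 1 x) \<longrightarrow> 0 < x"
    using AE_lborel_singleton[of "0::real"]
    by eventually_elim (auto simp: erlang_density_def)
  then show "AE r in erlang n. 0 < r" unfolding erlang_def by (subst AE_density) auto
qed

text \<open>After the shift \<open>r = z + x\<close> the tail factor turns \<open>r ^ n\<close> into
  \<open>x ^ n\<close>, and what remains is \<open>exp (- z)\<close> times the same density.\<close>

lemma williamson_erlang:
  assumes n: "n \<ge> 1" and z: "0 \<le> z"
  shows "williamson n (erlang n) z = exp (- z)"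
proof -
  interpret radial n "erlang n" by (rule radial_erlang[OF n])
  let ?f = "\<lambda>r. ennreal (erlang_density n 1 r) * ennreal (tail n (z / r))"
  have "ennreal (williamson n (erlang n) z) = (\<integral>\<^sup>+r. ?f r \<partial>lborel)"
    unfolding williamson_ennreal by (subst (1) erlang_def) (subst nn_integral_density; simp)
  also have "\<dots> = (\<integral>\<^sup>+x. ?f (z + 1 * x) \<partial>lborel)"
    using nn_integral_real_affine[of ?f 1 z] by simp
  also have "\<dots> = (\<integral>\<^sup>+x. ennreal (exp (- z)) * ennreal (erlang_density n 1 x) \<partial>lborel)"
  proof (rule nn_integral_cong)
    fix x :: real
    have "erlang_density n 1 (z + x) * tail n (z / (z + x)) = exp (- z) * erlang_density n 1 x"
    proof (cases "x < 0")
      case True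
      then have "z + x \<le> 0 \<or> 1 < z / (z + x)" by (cases "z + x \<le> 0") (auto simp: less_divide_eq)
      then show ?thesis using True n by (auto simp: erlang_density_def tail_def le_less)
    next
      case False
      show ?thesis
      proof (cases "z + x = 0")
        case True
        then have "x = 0" "z = 0" using False z by auto
        then show ?thesis using n by (simp add: erlang_density_def)
      next
        case F: False
        then have r: "0 < z + x" "z \<le> z + x" using False z by auto
        have "(z + x) ^ n * tail n (z / (z + x)) = ((z + x) * (1 - z / (z + x))) ^ n"
          using r z by (simp add: tail_def power_mult_distrib)
        also have "(z + x) * (1 - z / (z + x)) = x" using r by (simp add: field_simps)
        finally have "(z + x) ^ n * tail n (z / (z + x)) = x ^ n" .
        then show ?thesis using r False by (simp add: erlang_density_def exp_add exp_diff field_simps exp_minus)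
      qed
    qed
    then show "?f (z + 1 * x) = ennreal (exp (- z)) * ennreal (erlang_density n 1 x)"
      by (simp add: tail_bounds flip: ennreal_mult)
  qed
  also have "\<dots> = ennreal (exp (- z)) * (\<integral>\<^sup>+x. ennreal (erlang_density n 1 x) \<partial>lborel)"
    by (rule nn_integral_cmult) measurable
  also have "(\<integral>\<^sup>+x. ennreal (erlang_density n 1 x) \<partial>lborel) = 1"
    using nu.emeasure_space_1 unfolding erlang_def by (simp add: emeasure_density)
  finally show ?thesis using williamson_bounds by simp
qed

lemma back_diff_exp:
  "back_diff (\<lambda>k. exp (- (h * real k))) j k = exp (- (h * real k)) * (1 - exp (- h)) ^ j"
proof (induction j arbitrary: k)
  case (Suc j)
  have "exp (- (h * real (Suc k))) = exp (- (h * real k)) * exp (- h)"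
    by (simp add: algebra_simps flip: exp_add)
  then show ?case by (simp add: Suc algebra_simps)
qed simp

definition rbox :: "nat \<Rightarrow> (nat \<Rightarrow> real) \<Rightarrow> (nat \<Rightarrow> real) \<Rightarrow> (nat \<Rightarrow> real) set" where
  "rbox d a b = {x \<in> space (rborel d). \<forall>i<d. x i \<in> {a i..<b i}}"

lemma sets_rbox: "rbox d a b \<in> sets (rborel d)"
proof -
  have "{x \<in> space (rborel d). \<forall>i\<in>{..<d}. x i \<in> {a i..<b i}} \<in> sets (rborel d)"
  proof (rule sets.sets_Collect_finite_All)
    fix i assume "i \<in> {..<d}"
    then have m: "(\<lambda>x. x i) \<in> rborel d \<rightarrow>\<^sub>M borel" by (intro measurable_component_singleton)
    have "(\<lambda>x. x i) -` {a i..<b i} \<inter> space (rborel d) \<in> sets (rborel d)"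
      by (rule measurable_sets[OF m]) simp
    then show "{x \<in> space (rborel d). x i \<in> {a i..<b i}} \<in> sets (rborel d)"
      by (simp only: vimage_def Int_def mem_Collect_eq conj_commute)
  qed simp
  then show ?thesis by (simp only: rbox_def Ball_def lessThan_iff)
qed

text \<open>Rounded to a lattice of mesh \<open>h\<close>, the vector is Schur-constant with
  exponential survival function, so every lattice cell has an explicit positive mass. It suffices to
  find a lattice cell inside the box.\<close>

lemma l1_law_erlang_box_pos:
  assumes n: "n \<ge> 1" and ab: "\<And>i. i < Suc n \<Longrightarrow> 0 \<le> a i \<and> a i < b i"
  shows "0 < emeasure (l1_law n (erlang n)) (rbox (Suc n) a b)"
proof -
  interpret radial n "erlang n" by (rule radial_erlang[OF n])
  define w where "w = Min ((\<lambda>i. b i - a i) ` {..<Suc n})"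
  have "0 < w" unfolding w_def by (subst Min_gr_iff) (use ab in auto)
  moreover have "w \<le> b i - a i" if "i < Suc n" for i
    unfolding w_def by (rule Min_le) (use that in auto)
  ultimately have w: "0 < w" "\<And>i. i < Suc n \<Longrightarrow> w \<le> b i - a i" by auto
  \<comment> \<open>The first lattice point at or above \<open>a i\<close> lies within
    \<open>h\<close> of it and its cell has length \<open>h\<close>, so two meshes must fit into the
    shortest side.\<close>
  define h where "h = w / 2"
  have h: "0 < h" using w by (simp add: h_def)
  define K where "K i x = nat \<lfloor>(if i < Suc n then max 0 (x i) else 0) / h\<rfloor>" for i and x :: "nat \<Rightarrow> real"
  have K: "K i \<in> l1_law n (erlang n) \<rightarrow>\<^sub>M count_space UNIV" for i
  proof (cases "i < Suc n")
    case True
    have [measurable]: "(\<lambda>x. x i) \<in> rborel (Suc n) \<rightarrow>\<^sub>M borel"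
      by (rule measurable_component_singleton) (use True in simp)
    have "(\<lambda>x. nat \<lfloor>max 0 (x i) / h\<rfloor>) \<in> rborel (Suc n) \<rightarrow>\<^sub>M count_space UNIV" by measurable
    then have "(\<lambda>x. nat \<lfloor>max 0 (x i) / h\<rfloor>) \<in> l1_law n (erlang n) \<rightarrow>\<^sub>M count_space UNIV"
      by (simp only: measurable_cong_sets[OF sets_l1_law refl])
    then show ?thesis using True by (simp add: K_def[abs_def])
  qed (simp add: K_def[abs_def])
  have le_K: "k \<le> K i x \<longleftrightarrow> h * real k \<le> x i" if "i < Suc n" "0 \<le> x i" for k i x
  proof -
    have "k \<le> K i x \<longleftrightarrow> real k \<le> x i / h" using that h by (simp add: K_def le_nat_iff le_floor_iff)
    then show ?thesis using h by (simp add: pos_le_divide_eq mult.commute)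
  qed
  interpret L: schur_lattice "l1_law n (erlang n)" "Suc n" K "\<lambda>k. exp (- (h * real k))"
  proof (intro schur_lattice.intro schur_lattice_axioms.intro)
    show "prob_space (l1_law n (erlang n))" by (rule prob_space_l1_law)
    show "K i \<in> l1_law n (erlang n) \<rightarrow>\<^sub>M count_space UNIV" for i by (rule K)
    fix c :: "nat \<Rightarrow> nat"
    have "measure (l1_law n (erlang n)) {x \<in> space (l1_law n (erlang n)). \<forall>i<Suc n. c i \<le> K i x} =
        measure (l1_law n (erlang n)) (up (Suc n) (\<lambda>i. h * real (c i)))"
    proof (rule measure_eq_AE)
      show "AE x in l1_law n (erlang n). x \<in> {x \<in> space (l1_law n (erlang n)). \<forall>i<Suc n. c i \<le> K i x} \<longleftrightarrow>
          x \<in> up (Suc n) (\<lambda>i. h * real (c i))"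
        using AE_l1_law_nonneg by eventually_elim (use le_K in \<open>auto simp: up_def\<close>)
      show "up (Suc n) (\<lambda>i. h * real (c i)) \<in> sets (l1_law n (erlang n))"
        unfolding up_def sets_l1_law by (rule sets_up)
      have "{x \<in> space (l1_law n (erlang n)). \<forall>i\<in>{..<Suc n}. c i \<le> K i x} \<in> sets (l1_law n (erlang n))"
      proof (rule sets.sets_Collect_finite_All)
        fix i
        have "K i -` {c i..} \<inter> space (l1_law n (erlang n)) \<in> sets (l1_law n (erlang n))"
          by (rule measurable_sets[OF K]) simp
        then show "{x \<in> space (l1_law n (erlang n)). c i \<le> K i x} \<in> sets (l1_law n (erlang n))"
          by (simp only: vimage_def Int_def mem_Collect_eq atLeast_iff conj_commute)
      qed simp
      then show "{x \<in> space (l1_law n (erlang n)). \<forall>i<Suc n. c i \<le> K i x} \<in> sets (l1_law n (erlang n))"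
        by (simp only: Ball_def lessThan_iff)
    qed
    also have "\<dots> = williamson n (erlang n) (\<Sum>i<Suc n. h * real (c i))"
      using emeasure_l1_law_up[of "\<lambda>i. h * real (c i)"] h williamson_bounds by (simp add: measure_def)
    also have "(\<Sum>i<Suc n. h * real (c i)) = h * real (\<Sum>i<Suc n. c i)"
      by (simp only: of_nat_sum sum_distrib_left)
    also have "williamson n (erlang n) \<dots> = exp (- (h * real (\<Sum>i<Suc n. c i)))"
      using h by (intro williamson_erlang[OF n] mult_nonneg_nonneg of_nat_0_le_iff) simp
    finally show "measure (l1_law n (erlang n)) {x \<in> space (l1_law n (erlang n)). \<forall>i<Suc n. c i \<le> K i x} =
        exp (- (h * real (\<Sum>i<Suc n. c i)))" .
  qed
  define c where "c i = nat \<lceil>a i / h\<rceil>" for i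
  have c: "a i \<le> h * real (c i)" "h * real (c i) + h \<le> b i" if "i < Suc n" for i
  proof -
    have "0 \<le> a i / h" using ab[OF that] h by simp
    then have r: "a i / h \<le> real (c i)" "real (c i) < a i / h + 1"
      unfolding c_def by (simp_all add: of_nat_nat) linarith
    show "a i \<le> h * real (c i)" using r(1) h by (simp add: pos_divide_le_eq mult.commute)
    have "h * real (c i) \<le> h * (a i / h + 1)" using r(2) h by (intro mult_left_mono) auto
    also have "\<dots> = a i + h" using h by (simp add: field_simps)
    finally show "h * real (c i) + h \<le> b i" using w(2)[OF that] by (simp add: h_def)
  qed
  have "0 < exp (- (h * real (\<Sum>i<Suc n. c i))) * (1 - exp (- h)) ^ Suc n"
    using h by (intro mult_pos_pos zero_less_power) auto
  also have "\<dots> = measure (l1_law n (erlang n)) {x \<in> space (l1_law n (erlang n)). \<forall>i<Suc n. K i x = c i}"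
    unfolding L.prob_eq back_diff_exp ..
  also have "\<dots> \<le> measure (l1_law n (erlang n)) (rbox (Suc n) a b)"
  proof (rule el.finite_measure_mono_AE)
    show "AE x in l1_law n (erlang n). x \<in> {x \<in> space (l1_law n (erlang n)). \<forall>i<Suc n. K i x = c i} \<longrightarrow> x \<in> rbox (Suc n) a b"
      using AE_l1_law_nonneg
    proof eventually_elim
      case (elim x)
      note x0 = elim
      show ?case
      proof
      assume x: "x \<in> {x \<in> space (l1_law n (erlang n)). \<forall>i<Suc n. K i x = c i}"
      have "x i \<in> {a i..<b i}" if i: "i < Suc n" for i
      proof -
        have Ki: "K i x = c i" using x i by blast
        have xi: "0 \<le> x i" using x0 i by blast
        have "h * real (c i) \<le> x i" using le_K[of i x "c i", OF i xi] Ki by simp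
        moreover have "x i < h * real (Suc (c i))" using le_K[of i x "Suc (c i)", OF i xi] Ki by simp
        ultimately show ?thesis using c[OF i] by (simp add: algebra_simps)
      qed
      then show "x \<in> rbox (Suc n) a b" using x unfolding rbox_def by simp
      qed
    qed
    show "rbox (Suc n) a b \<in> sets (l1_law n (erlang n))" unfolding sets_l1_law by (rule sets_rbox)
  qed
  finally show ?thesis by (simp add: el.emeasure_eq_measure)
qed

section \<open>Positive mass of grid cells after mixing\<close>

context two_radial
begin

lemma emeasure_l1_law_mix:
  assumes A: "A \<in> sets (rborel (Suc n))"
  shows "ennreal e * emeasure (l1_law n \<nu>') A \<le> emeasure (l1_law n (mix e \<nu> \<nu>')) A"
proof -
  interpret c: radial n "mix e \<nu> \<nu>'" by (rule radial_mix)
  let ?f = "\<lambda>(r, s). \<lambda>i\<in>{..<Suc n}. r * s i :: real"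
  let ?A = "?f -` A \<inter> space (borel \<Otimes>\<^sub>M simplex_law n)"
  have mf: "?f \<in> borel \<Otimes>\<^sub>M simplex_law n \<rightarrow>\<^sub>M rborel (Suc n)"
    using scale_measurable[of "Suc n"]
    by (simp only: measurable_cong_sets[OF sets_pair_measure_cong[OF refl simplex_sets] refl])
  have sA: "?A \<in> sets (borel \<Otimes>\<^sub>M simplex_law n)" by (rule measurable_sets[OF mf A])
  have eq: "emeasure (l1_law n \<mu>) A = (\<integral>\<^sup>+r. emeasure (simplex_law n) (Pair r -` ?A) \<partial>\<mu>)" if "radial n \<mu>" for \<mu>
  proof -
    interpret m: radial n \<mu> by fact
    have s: "space (\<mu> \<Otimes>\<^sub>M simplex_law n) = space (borel \<Otimes>\<^sub>M simplex_law n)"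
      by (rule sets_eq_imp_space_eq[OF sets_pair_measure_cong[OF m.sets_nu refl]])
    have "emeasure (l1_law n \<mu>) A = emeasure (\<mu> \<Otimes>\<^sub>M simplex_law n) ?A"
      unfolding l1_law_def emeasure_distr[OF m.scale_measurable' A] s ..
    also have "\<dots> = (\<integral>\<^sup>+r. emeasure (simplex_law n) (Pair r -` ?A) \<partial>\<mu>)"
      by (rule a.sx.emeasure_pair_measure_alt)
         (use sA in \<open>simp only: sets_pair_measure_cong[OF m.sets_nu refl]\<close>)
    finally show ?thesis .
  qed
  have "(\<lambda>r. emeasure (simplex_law n) (Pair r -` ?A)) \<in> borel_measurable borel"
    by (rule a.sx.measurable_emeasure_Pair[OF sA])
  then show ?thesis
    unfolding eq[OF radial_mix] eq[OF b.radial_axioms] by (simp add: nn_integral_mix)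
qed

end

context radial
begin

text \<open>The coordinatewise transform maps a suitable box into the cell. Positivity of the
  transform makes it strictly decreasing on the half-line, so the strict lower bounds of the cell
  are met.\<close>

lemma copula_law_cell_pos:
  assumes box: "\<And>a b. (\<And>i. i < Suc n \<Longrightarrow> 0 \<le> a i \<and> a i < b i) \<Longrightarrow> 0 < emeasure (l1_law n \<nu>) (rbox (Suc n) a b)"
    and wpos: "\<And>z. 0 < williamson n \<nu> z" and N: "N > 0"
    and k: "k \<in> {..<Suc n} \<rightarrow>\<^sub>E {1..int N}"
  shows "0 < measure (copula_law n \<nu>) {y \<in> cube (Suc n). grid (Suc n) N y = k}"
proof -
  have ki: "1 \<le> k i" "k i \<le> int N" if "i < Suc n" for i using k that by (auto simp: PiE_iff)
  define a where "a i = gen_inv (williamson n \<nu>) (real_of_int (k i) / N)" for i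
  have u: "0 < real_of_int (k i) / N" "real_of_int (k i) / N \<le> 1" if "i < Suc n" for i
    using ki[OF that] N by (simp_all add: divide_le_eq_1)
  have a: "0 \<le> a i" "williamson n \<nu> (a i) = real_of_int (k i) / N" if "i < Suc n" for i
    using gen_inv[OF u[OF that]] by (simp_all add: a_def)
  have "\<exists>b. a i < b \<and> (real_of_int (k i) - 1) / N \<le> williamson n \<nu> b" if i: "i < Suc n" for i
  proof (cases "k i = 1")
    \<comment> \<open>The lower side of the cell is 0, which the transform never reaches: any right
      endpoint beyond \<open>a i\<close> will do.\<close>
    case True
    then show ?thesis using wpos[of "a i + 1"] by (intro exI[of _ "a i + 1"]) simp
  next
    case False
    let ?v = "(real_of_int (k i) - 1) / N"
    have v: "0 < ?v" "?v \<le> 1" "?v < real_of_int (k i) / N"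
      using False ki[OF i] N by (simp_all add: divide_le_eq_1 divide_strict_right_mono)
    have "a i < gen_inv (williamson n \<nu>) ?v"
    proof (rule ccontr)
      assume "\<not> a i < gen_inv (williamson n \<nu>) ?v"
      then have "williamson n \<nu> (a i) \<le> williamson n \<nu> (gen_inv (williamson n \<nu>) ?v)" by (intro williamson_antimono) simp
      then show False using a(2)[OF i] gen_inv(2)[OF v(1,2)] v(3) by simp
    qed
    then show ?thesis using gen_inv(2)[OF v(1,2)] by (intro exI[of _ "gen_inv (williamson n \<nu>) ?v"]) simp
  qed
  then have "\<exists>b. \<forall>i\<in>{..<Suc n}. a i < b i \<and> (real_of_int (k i) - 1) / N \<le> williamson n \<nu> (b i)"
    by (intro bchoice) auto
  then obtain b where b: "\<And>i. i < Suc n \<Longrightarrow> a i < b i \<and> (real_of_int (k i) - 1) / N \<le> williamson n \<nu> (b i)"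
    by (metis lessThan_iff)
  let ?f = "\<lambda>x. \<lambda>i\<in>{..<Suc n}. williamson n \<nu> (x i)"
  let ?S = "{y \<in> cube (Suc n). grid (Suc n) N y = k}"
  have S: "?S \<in> sets (cube_borel (Suc n))" using sets_grid[of "Suc n" N "{k}"] by (simp only: singleton_iff)
  have f_cube: "?f x \<in> cube (Suc n)" for x using williamson_bounds by (simp add: cube_def)
  have kc: "k \<in> cells (Suc n) N" unfolding cells_def by (rule PiE_I) (use ki PiE_arb[OF k] in force)+
  have "0 < emeasure (l1_law n \<nu>) (rbox (Suc n) a b)" using a b by (intro box) auto
  also have "\<dots> \<le> emeasure (l1_law n \<nu>) (?f -` ?S \<inter> space (l1_law n \<nu>))"
  proof (rule emeasure_mono)
    show "rbox (Suc n) a b \<subseteq> ?f -` ?S \<inter> space (l1_law n \<nu>)"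
    proof
      fix x assume x: "x \<in> rbox (Suc n) a b"
      have "\<lceil>real N * ?f x i\<rceil> \<in> {k i}" if i: "i < Suc n" for i
      proof -
        have xi: "a i \<le> x i" "x i < b i" using x i unfolding rbox_def by auto
        have "williamson n \<nu> (x i) \<le> real_of_int (k i) / N" using williamson_antimono[OF xi(1)] a(2)[OF i] by simp
        then have 1: "real N * williamson n \<nu> (x i) \<le> real_of_int (k i)" using N by (simp add: pos_le_divide_eq mult.commute)
        have "williamson n \<nu> (b i) < williamson n \<nu> (x i)" using xi a(1)[OF i] wpos by (intro strict) auto
        then have "(real_of_int (k i) - 1) / N < williamson n \<nu> (x i)" using b[OF i] by linarith
        then have "real_of_int (k i) - 1 < real N * williamson n \<nu> (x i)" using N by (simp add: pos_divide_less_eq mult.commute)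
        then show ?thesis using 1 i by (simp add: ceiling_eq_iff)
      qed
      then have "grid (Suc n) N (?f x) = k" using grid_eq_iff[OF kc, of "?f x"] by blast
      then show "x \<in> ?f -` ?S \<inter> space (l1_law n \<nu>)" using x f_cube unfolding rbox_def by simp
    qed
    show "?f -` ?S \<inter> space (l1_law n \<nu>) \<in> sets (l1_law n \<nu>)"
      by (rule measurable_sets[OF copula_law_measurable S])
  qed
  also have "\<dots> = emeasure (copula_law n \<nu>) ?S"
    unfolding copula_law_def by (rule emeasure_distr[OF copula_law_measurable S, symmetric])
  finally have pos: "0 < emeasure (copula_law n \<nu>) ?S" .
  interpret U: prob_space "copula_law n \<nu>" by (rule prob_space_copula_law)
  show ?thesis using pos by (simp add: U.emeasure_eq_measure)
qed

end

text \<open>Both radii live on one probability space, so the ordering of the radii passes through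
  the monotone tails to the transforms. Together with \<open>scale_close\<close> this bounds the
  uniform distance of the transforms.\<close>

lemma williamson_scaled:
  assumes "radial n \<nu>" "radial n \<nu>'" "prob_space Q"
    and R[measurable]: "R \<in> borel_measurable Q" and R'[measurable]: "R' \<in> borel_measurable Q"
    and "distr Q borel R = \<nu>" "distr Q borel R' = \<nu>'"
    and ae: "AE x in Q. 0 < R x \<and> R x \<le> R' x \<and> R' x \<le> (1 + h) * R x" and h: "0 < h" and z: "0 \<le> z"
  shows "williamson n \<nu> z \<le> williamson n \<nu>' z" "williamson n \<nu>' z \<le> williamson n \<nu> (z / (1 + h))"
proof -
  interpret Q: prob_space Q by fact
  have w: "williamson n \<nu> z = (\<integral>x. tail n (z / R x) \<partial>Q)" "williamson n \<nu>' z = (\<integral>x. tail n (z / R' x) \<partial>Q)" for z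
    unfolding williamson_def assms(6,7)[symmetric] by (rule integral_distr; measurable)+
  have int: "integrable Q (\<lambda>x. tail n (z / R x))" "integrable Q (\<lambda>x. tail n (z / R' x))" for z
    by (rule Q.integrable_const_bound[of _ 1]; auto simp: tail_bounds abs_of_nonneg)+
  show "williamson n \<nu> z \<le> williamson n \<nu>' z"
    unfolding w
  proof (rule integral_mono_AE[OF int])
    show "AE x in Q. tail n (z / R x) \<le> tail n (z / R' x)"
      using ae by eventually_elim (use z in \<open>auto intro!: tail_antimono divide_left_mono mult_pos_pos\<close>)
  qed
  show "williamson n \<nu>' z \<le> williamson n \<nu> (z / (1 + h))"
    unfolding w
  proof (rule integral_mono_AE[OF int(2) int(1)])
    show "AE x in Q. tail n (z / R' x) \<le> tail n (z / (1 + h) / R x)"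
      using ae
    proof eventually_elim
      case (elim x)
      have "z / ((1 + h) * R x) \<le> z / R' x"
        using elim z h by (intro divide_left_mono mult_pos_pos) auto
      then show ?case by (intro tail_antimono) (simp add: divide_divide_eq_left)
    qed
  qed
qed

text \<open>The radius is multiplied by an independent uniform factor between 1 and
  \<open>1 + h\<close>; for each fixed positive radius the product has no atoms.\<close>

lemma smoothing:
  assumes "radial n \<nu>" and h: "0 < h"
  obtains \<nu>' where "radial n \<nu>'" "\<And>c. emeasure \<nu>' {c} = 0"
    "\<And>z. 0 \<le> z \<Longrightarrow> williamson n \<nu> z \<le> williamson n \<nu>' z" "\<And>z. 0 \<le> z \<Longrightarrow> williamson n \<nu>' z \<le> williamson n \<nu> (z / (1 + h))"
proof -
  interpret radial n \<nu> by fact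
  define V where "V = uniform_measure lborel {1..1 + h}"
  have sV[measurable_cong]: "sets V = sets borel" by (simp add: V_def)
  interpret V: prob_space V unfolding V_def by (rule prob_space_uniform_measure) (use h in auto)
  interpret P: pair_prob_space \<nu> V ..
  define R' where "R' = (\<lambda>(r, v). r * v :: real)"
  have R'[measurable]: "R' \<in> borel_measurable (\<nu> \<Otimes>\<^sub>M V)" unfolding R'_def by measurable
  have V_ae: "AE v in V. 1 \<le> v \<and> v \<le> 1 + h"
    unfolding V_def by (rule AE_uniform_measureI) auto
  have ae: "AE x in \<nu> \<Otimes>\<^sub>M V. 0 < fst x \<and> fst x \<le> R' x \<and> R' x \<le> (1 + h) * fst x"
  proof (rule P.AE_pair_measure)
    show "{x \<in> space (\<nu> \<Otimes>\<^sub>M V). 0 < fst x \<and> fst x \<le> R' x \<and> R' x \<le> (1 + h) * fst x} \<in> sets (\<nu> \<Otimes>\<^sub>M V)"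
      by measurable
    show "AE r in \<nu>. AE v in V. 0 < fst (r, v) \<and> fst (r, v) \<le> R' (r, v) \<and> R' (r, v) \<le> (1 + h) * fst (r, v)"
      using pos
    proof eventually_elim
      case (elim r)
      show ?case using V_ae
      proof eventually_elim
        case (elim v)
        have "r * 1 \<le> r * v" "r * v \<le> r * (1 + h)" using elim \<open>0 < r\<close> by (intro mult_left_mono; simp)+
        then show ?case using \<open>0 < r\<close> by (simp add: R'_def mult.commute)
      qed
    qed
  qed
  define \<nu>' where "\<nu>' = distr (\<nu> \<Otimes>\<^sub>M V) borel R'"
  have rad: "radial n \<nu>'"
  proof (rule radial.intro)
    show "n \<ge> 1" by (rule n)
    show "prob_space \<nu>'" unfolding \<nu>'_def by (rule P.P.prob_space_distr[OF R'])
    show "sets \<nu>' = sets borel" by (simp add: \<nu>'_def)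
    have "AE x in \<nu> \<Otimes>\<^sub>M V. 0 < R' x" using ae by eventually_elim linarith
    then show "AE r in \<nu>'. 0 < r" unfolding \<nu>'_def by (subst AE_distr_iff[OF R']) simp_all
  qed
  have d1: "distr (\<nu> \<Otimes>\<^sub>M V) borel fst = \<nu>"
  proof (rule measure_eqI)
    fix A assume "A \<in> sets (distr (\<nu> \<Otimes>\<^sub>M V) borel fst)"
    then have A: "A \<in> sets \<nu>" by (simp add: sets_nu)
    have "fst -` A \<inter> space (\<nu> \<Otimes>\<^sub>M V) = A \<times> space V"
      using sets.sets_into_space[OF A] by (auto simp: space_pair_measure)
    then show "emeasure (distr (\<nu> \<Otimes>\<^sub>M V) borel fst) A = emeasure \<nu> A"
      using A V.emeasure_pair_measure_Times[OF A sets.top]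
      by (simp add: emeasure_distr sets_nu V.emeasure_space_1)
  qed (simp add: sets_nu)
  have atom: "emeasure \<nu>' {c} = 0" for c
  proof -
    have S: "R' -` {c} \<inter> space (\<nu> \<Otimes>\<^sub>M V) \<in> sets (\<nu> \<Otimes>\<^sub>M V)" by (rule measurable_sets[OF R']) simp
    have "emeasure \<nu>' {c} = emeasure (\<nu> \<Otimes>\<^sub>M V) (R' -` {c} \<inter> space (\<nu> \<Otimes>\<^sub>M V))"
      unfolding \<nu>'_def by (rule emeasure_distr[OF R']) simp
    also have "\<dots> = (\<integral>\<^sup>+r. emeasure V (Pair r -` (R' -` {c} \<inter> space (\<nu> \<Otimes>\<^sub>M V))) \<partial>\<nu>)"
      by (rule V.emeasure_pair_measure_alt[OF S])
    also have "\<dots> = (\<integral>\<^sup>+r. 0 \<partial>\<nu>)"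
    proof (rule nn_integral_cong_AE, use pos in eventually_elim)
      case (elim r)
      have "Pair r -` (R' -` {c} \<inter> space (\<nu> \<Otimes>\<^sub>M V)) \<subseteq> {c / r}"
        using elim by (auto simp: R'_def field_simps)
      then have "emeasure V (Pair r -` (R' -` {c} \<inter> space (\<nu> \<Otimes>\<^sub>M V))) \<le> emeasure V {c / r}"
        by (rule emeasure_mono) (simp add: sV)
      also have "emeasure V {c / r} = emeasure lborel ({1..1 + h} \<inter> {c / r}) / emeasure lborel {1..1 + h}"
        unfolding V_def by (rule emeasure_uniform_measure) auto
      also have "emeasure lborel ({1..1 + h} \<inter> {c / r}) = 0"
        by (rule emeasure_lborel_countable) (auto intro: countable_subset[of _ "{c / r}"])
      finally show ?case by simp
    qed
    finally show ?thesis by simp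
  qed
  have "williamson n \<nu> z \<le> williamson n \<nu>' z" "williamson n \<nu>' z \<le> williamson n \<nu> (z / (1 + h))" if "0 \<le> z" for z
    by (rule williamson_scaled[OF assms(1) rad P.P.prob_space_axioms _ R' d1 \<nu>'_def[symmetric] ae h that]; measurable)+
  then show ?thesis using that[OF rad atom] by blast
qed

text \<open>The radius is rounded up to a power of \<open>1 + h\<close>. The error has to be
  relative, and a geometric grid achieves this on all positive reals with countably many
  values.\<close>

lemma discretizing:
  assumes "radial n \<nu>" and h: "0 < h"
  obtains \<nu>' S where "radial n \<nu>'" "countable S" "S \<subseteq> {0<..}" "emeasure \<nu>' S = 1"
    "\<And>z. 0 \<le> z \<Longrightarrow> williamson n \<nu> z \<le> williamson n \<nu>' z" "\<And>z. 0 \<le> z \<Longrightarrow> williamson n \<nu>' z \<le> williamson n \<nu> (z / (1 + h))"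
proof -
  interpret radial n \<nu> by fact
  define g where "g r = (1 + h) powr real_of_int \<lceil>log (1 + h) r\<rceil>" for r :: real
  have g[measurable]: "g \<in> borel_measurable borel" unfolding g_def by measurable
  have g\<nu>: "g \<in> borel_measurable \<nu>" by measurable
  have g_bounds: "r \<le> g r \<and> g r \<le> (1 + h) * r" if r: "0 < r" for r
  proof -
    have lr: "(1 + h) powr log (1 + h) r = r" using r h by simp
    have "(1 + h) powr log (1 + h) r \<le> g r" unfolding g_def using h by (intro powr_mono) auto
    moreover have "g r \<le> (1 + h) powr (log (1 + h) r + 1)"
      unfolding g_def using h by (intro powr_mono) linarith+
    ultimately show ?thesis using h by (simp add: lr powr_add mult.commute)
  qed
  define \<nu>' where "\<nu>' = distr \<nu> borel g"
  define S where "S = range (\<lambda>k::int. (1 + h) powr real_of_int k)"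
  have rad: "radial n \<nu>'"
  proof (rule radial.intro)
    show "n \<ge> 1" by (rule n)
    show "prob_space \<nu>'" unfolding \<nu>'_def by (rule nu.prob_space_distr[OF g\<nu>])
    show "sets \<nu>' = sets borel" by (simp add: \<nu>'_def)
    show "AE r in \<nu>'. 0 < r"
      unfolding \<nu>'_def by (subst AE_distr_iff[OF g\<nu>]) (use h in \<open>simp_all add: g_def\<close>)
  qed
  have S: "countable S" "S \<subseteq> {0<..}" using h by (auto simp: S_def)
  have "S \<in> sets borel" using S(1) by (rule sets.countable[rotated]) simp
  then have "emeasure \<nu>' S = emeasure \<nu> (g -` S \<inter> space \<nu>)"
    unfolding \<nu>'_def by (rule emeasure_distr[OF g\<nu>])
  also have "g -` S \<inter> space \<nu> = space \<nu>" by (auto simp: S_def g_def)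
  finally have SS: "emeasure \<nu>' S = 1" using nu.emeasure_space_1 by simp
  have d: "distr \<nu> borel (\<lambda>r. r) = \<nu>" by (rule distr_id2) (simp add: sets_nu)
  have ae: "AE r in \<nu>. 0 < r \<and> r \<le> g r \<and> g r \<le> (1 + h) * r"
    using pos by eventually_elim (use g_bounds in blast)
  have "williamson n \<nu> z \<le> williamson n \<nu>' z" "williamson n \<nu>' z \<le> williamson n \<nu> (z / (1 + h))" if "0 \<le> z" for z
    by (rule williamson_scaled[OF assms(1) rad nu.prob_space_axioms _ g\<nu> d \<nu>'_def[symmetric] ae h that]; measurable)+
  then show ?thesis using that[OF rad S SS] by blast
qed

section \<open>Conditional kernels\<close>

definition slice :: "nat \<Rightarrow> (nat \<Rightarrow> real) set \<Rightarrow> (nat \<Rightarrow> real) \<Rightarrow> real set" where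
  "slice n A x = {y \<in> {0..1}. x(n := y) \<in> A}"

text \<open>A point of the \<open>n\<close>-dimensional cube has the value \<open>undefined\<close>
  at index \<open>n\<close>; the update fills this place with the last coordinate.\<close>

definition kernel_prod :: "nat \<Rightarrow> (nat \<Rightarrow> real) measure \<Rightarrow> ((nat \<Rightarrow> real) \<Rightarrow> real measure) \<Rightarrow> (nat \<Rightarrow> real) measure" where
  "kernel_prod n M K = M \<bind> (\<lambda>x. distr (K x) (cube_borel (Suc n)) (\<lambda>y. x(n := y)))"

lemma extend_measurable: "(\<lambda>(x, y). x(n := y)) \<in> cube_borel n \<Otimes>\<^sub>M unit_borel \<rightarrow>\<^sub>M cube_borel (Suc n)"
  using measurable_add_dim[of n "{..<n}" "\<lambda>_. unit_borel"] by (simp only: lessThan_Suc)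

lemma extend_measurable1:
  assumes "x \<in> cube n"
  shows "(\<lambda>y. x(n := y)) \<in> unit_borel \<rightarrow>\<^sub>M cube_borel (Suc n)"
proof -
  have "(\<lambda>y. (x, y)) \<in> unit_borel \<rightarrow>\<^sub>M cube_borel n \<Otimes>\<^sub>M unit_borel"
    by (rule measurable_Pair1') (simp add: space_cube_borel assms)
  from measurable_compose[OF this extend_measurable] show ?thesis by simp
qed

lemma space_unit_borel: "space unit_borel = {0..1}"
  by (simp add: space_restrict_space)

locale kernel_over =
  fixes n :: nat and M :: "(nat \<Rightarrow> real) measure" and K :: "(nat \<Rightarrow> real) \<Rightarrow> real measure"
  assumes M: "prob_space M" and sets_M: "sets M = sets (cube_borel n)"
    and K: "K \<in> cube_borel n \<rightarrow>\<^sub>M prob_algebra unit_borel"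
begin

sublocale prob_space M by (rule M)

lemma space_M: "space M = cube n"
  using sets_eq_imp_space_eq[OF sets_M] by (simp add: space_cube_borel)

lemma KD: "x \<in> cube n \<Longrightarrow> prob_space (K x)" "x \<in> cube n \<Longrightarrow> sets (K x) = sets unit_borel"
  "x \<in> cube n \<Longrightarrow> space (K x) = {0..1}"
proof -
  assume x: "x \<in> cube n"
  then have "K x \<in> space (prob_algebra unit_borel)"
    using measurable_space[OF K] by (simp add: space_cube_borel)
  then show "prob_space (K x)" "sets (K x) = sets unit_borel" by (simp_all add: space_prob_algebra)
  then show "space (K x) = {0..1}" using sets_eq_imp_space_eq space_unit_borel by metis
qed

lemma K_sub: "K \<in> M \<rightarrow>\<^sub>M subprob_algebra unit_borel"
  using measurable_prob_algebraD[OF K] by (simp only: measurable_cong_sets[OF sets_M refl])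

lemma kernel_prod_kernel: "(\<lambda>x. distr (K x) (cube_borel (Suc n)) (\<lambda>y. x(n := y))) \<in> M \<rightarrow>\<^sub>M subprob_algebra (cube_borel (Suc n))"
  using extend_measurable[of n]
  by (intro measurable_distr2[OF _ K_sub])
     (simp only: measurable_cong_sets[OF sets_pair_measure_cong[OF sets_M refl] refl])

lemma sets_kernel_prod: "sets (kernel_prod n M K) = sets (cube_borel (Suc n))"
  unfolding kernel_prod_def by (rule sets_bind) (use KD space_M not_empty in auto)

lemma emeasure_kernel_prod:
  assumes A: "A \<in> sets (cube_borel (Suc n))"
  shows "emeasure (kernel_prod n M K) A = (\<integral>\<^sup>+x. emeasure (K x) (slice n A x) \<partial>M)"
proof -
  have "emeasure (kernel_prod n M K) A = (\<integral>\<^sup>+x. emeasure (distr (K x) (cube_borel (Suc n)) (\<lambda>y. x(n := y))) A \<partial>M)"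
    unfolding kernel_prod_def by (rule emeasure_bind[OF not_empty kernel_prod_kernel A])
  also have "\<dots> = (\<integral>\<^sup>+x. emeasure (K x) (slice n A x) \<partial>M)"
  proof (rule nn_integral_cong)
    fix x assume "x \<in> space M"
    then have x: "x \<in> cube n" by (simp only: space_M)
    have "(\<lambda>y. x(n := y)) \<in> K x \<rightarrow>\<^sub>M cube_borel (Suc n)"
      using extend_measurable1[OF x] by (simp only: measurable_cong_sets[OF KD(2)[OF x] refl])
    from emeasure_distr[OF this A]
    have "emeasure (distr (K x) (cube_borel (Suc n)) (\<lambda>y. x(n := y))) A = emeasure (K x) ((\<lambda>y. x(n := y)) -` A \<inter> space (K x))" .
    also have "(\<lambda>y. x(n := y)) -` A \<inter> space (K x) = slice n A x"
      unfolding slice_def KD(3)[OF x] by blast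
    finally show "emeasure (distr (K x) (cube_borel (Suc n)) (\<lambda>y. x(n := y))) A = emeasure (K x) (slice n A x)" .
  qed
  finally show ?thesis .
qed

lemma slice_measurable:
  assumes A: "A \<in> sets (cube_borel (Suc n))" and x: "x \<in> cube n"
  shows "slice n A x \<in> sets unit_borel"
proof -
  have "(\<lambda>y. x(n := y)) -` A \<inter> space unit_borel \<in> sets unit_borel"
    by (rule measurable_sets[OF extend_measurable1[OF x] A])
  moreover have "(\<lambda>y. x(n := y)) -` A \<inter> space unit_borel = slice n A x"
    unfolding slice_def space_unit_borel by blast
  ultimately show ?thesis by (simp only:)
qed

lemma emeasure_slice_measurable:
  assumes A: "A \<in> sets (cube_borel (Suc n))"
  shows "(\<lambda>x. emeasure (K x) (slice n A x)) \<in> borel_measurable M"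
proof -
  have "(\<lambda>x. emeasure (distr (K x) (cube_borel (Suc n)) (\<lambda>y. x(n := y))) A) \<in> borel_measurable M"
    by (rule measurable_emeasure_kernel[OF kernel_prod_kernel A])
  moreover have "emeasure (distr (K x) (cube_borel (Suc n)) (\<lambda>y. x(n := y))) A = emeasure (K x) (slice n A x)"
    if "x \<in> space M" for x
  proof -
    have x: "x \<in> cube n" using that by (simp only: space_M)
    have "(\<lambda>y. x(n := y)) \<in> K x \<rightarrow>\<^sub>M cube_borel (Suc n)"
      using extend_measurable1[OF x] by (simp only: measurable_cong_sets[OF KD(2)[OF x] refl])
    from emeasure_distr[OF this A] show ?thesis
      unfolding slice_def KD(3)[OF x] by (simp only: vimage_def Int_def mem_Collect_eq conj_commute)
  qed
  ultimately show ?thesis by (subst measurable_cong[symmetric]) auto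
qed

lemma emeasure_K_measurable: "F \<in> sets unit_borel \<Longrightarrow> (\<lambda>x. emeasure (K x) F) \<in> borel_measurable M"
  by (rule measurable_emeasure_kernel[OF K_sub])

lemma slice_rectangle:
  assumes "x \<in> cube n" "F \<subseteq> {0..1}"
  shows "slice n (rectangle (Suc n) E F) x = (if x \<in> E then F else {})"
proof -
  have "restrict (x(n := y)) {..<n} = x" for y
    using assms(1) by (auto simp: cube_def PiE_iff extensional_def fun_eq_iff)
  moreover have "x(n := y) \<in> cube (Suc n)" if "y \<in> {0..1}" for y
    using assms(1) that by (auto simp: cube_def PiE_iff extensional_def less_Suc_eq)
  ultimately show ?thesis using assms(2) by (auto simp: slice_def rectangle_def)
qed

lemma sets_rectangle:
  assumes E: "E \<in> sets (cube_borel n)" and F: "F \<in> sets unit_borel"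
  shows "rectangle (Suc n) E F \<in> sets (cube_borel (Suc n))"
proof -
  have r: "(\<lambda>y. restrict y {..<n}) \<in> cube_borel (Suc n) \<rightarrow>\<^sub>M cube_borel n"
    by (rule measurable_restrict_subset) simp
  have "(\<lambda>y. restrict y {..<n}) -` E \<inter> space (cube_borel (Suc n)) \<in> sets (cube_borel (Suc n))"
    by (rule measurable_sets[OF r E])
  moreover have "(\<lambda>y. y n) -` F \<inter> space (cube_borel (Suc n)) \<in> sets (cube_borel (Suc n))"
    by (rule measurable_sets[OF coord_measurable_unit F]) simp
  ultimately have "((\<lambda>y. restrict y {..<n}) -` E \<inter> space (cube_borel (Suc n))) \<inter>
      ((\<lambda>y. y n) -` F \<inter> space (cube_borel (Suc n))) \<in> sets (cube_borel (Suc n))" by (rule sets.Int)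
  moreover have "rectangle (Suc n) E F = ((\<lambda>y. restrict y {..<n}) -` E \<inter> space (cube_borel (Suc n))) \<inter>
      ((\<lambda>y. y n) -` F \<inter> space (cube_borel (Suc n)))"
    unfolding rectangle_def space_cube_borel by auto
  ultimately show ?thesis by (simp only:)
qed

lemma emeasure_kernel_prod_rectangle:
  assumes E: "E \<in> sets (cube_borel n)" and F: "F \<in> sets unit_borel"
  shows "emeasure (kernel_prod n M K) (rectangle (Suc n) E F) = (\<integral>\<^sup>+x\<in>E. emeasure (K x) F \<partial>M)"
proof -
  have F1: "F \<subseteq> {0..1}" using sets.sets_into_space[OF F] by (simp only: space_unit_borel)
  show ?thesis
    unfolding emeasure_kernel_prod[OF sets_rectangle[OF E F]]
  proof (rule nn_integral_cong)
    fix x assume "x \<in> space M"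
    then have x: "x \<in> cube n" by (simp only: space_M)
    show "emeasure (K x) (slice n (rectangle (Suc n) E F) x) = emeasure (K x) F * indicator E x"
      unfolding slice_rectangle[OF x F1] by (simp add: indicator_def)
  qed
qed

end

lemma down_rectangle:
  assumes "x \<in> cube (Suc n)"
  shows "{y \<in> cube (Suc n). \<forall>i<Suc n. y i \<le> x i} = rectangle (Suc n) {y \<in> cube n. \<forall>i<n. y i \<le> x i} {0..x n}"
proof -
  have "restrict y {..<n} \<in> cube n" if "y \<in> cube (Suc n)" for y
    using that by (auto simp: cube_def PiE_iff)
  moreover have "0 \<le> y n" if "y \<in> cube (Suc n)" for y using cubeD[OF that] by simp
  ultimately show ?thesis by (auto simp: rectangle_def less_Suc_eq)
qed

lemma Icc_unit_borel: "0 \<le> a \<Longrightarrow> a \<le> 1 \<Longrightarrow> {0..a::real} \<in> sets unit_borel"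
  by (subst sets_restrict_space_iff) auto

text \<open>Lower orthants are rectangles, so agreement on rectangles suffices. This is what makes
  the descriptions with \<open>THE\<close> and the kernel identity determine measures on all Borel
  sets.\<close>

lemma rectangle_eqI:
  assumes "sets P = sets (cube_borel (Suc n))" "sets Q = sets (cube_borel (Suc n))"
    and fin: "emeasure P (cube (Suc n)) \<noteq> \<infinity>"
    and eq: "\<And>E F. E \<in> sets (cube_borel n) \<Longrightarrow> F \<in> sets unit_borel \<Longrightarrow>
      emeasure P (rectangle (Suc n) E F) = emeasure Q (rectangle (Suc n) E F)"
  shows "P = Q"
proof (rule cube_borel_eqI[OF assms(1-3)])
  fix x assume x: "x \<in> cube (Suc n)"
  show "emeasure P {y \<in> cube (Suc n). \<forall>i<Suc n. y i \<le> x i} = emeasure Q {y \<in> cube (Suc n). \<forall>i<Suc n. y i \<le> x i}"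
    unfolding down_rectangle[OF x]
  proof (rule eq[OF sets_down Icc_unit_borel])
    show "0 \<le> x n" "x n \<le> 1" using cubeD[OF x, of n] by blast+
  qed
qed

lemma first_margin_distribution:
  assumes C: "has_distribution_function (Suc n) P C" and top: "\<And>y. y \<in> cube (Suc n) \<Longrightarrow> y n \<le> 1"
  shows "has_distribution_function n (distr P (cube_borel n) (\<lambda>y. restrict y {..<n})) (first_margin (Suc n) C)"
  unfolding has_distribution_function_def
proof (intro conjI ballI)
  note hd = has_distribution_functionD[OF C]
  interpret P: prob_space P by (rule hd(1))
  have "(\<lambda>y. restrict y {..<n}) \<in> cube_borel (Suc n) \<rightarrow>\<^sub>M cube_borel n"
    by (rule measurable_restrict_subset) simp
  then have r: "(\<lambda>y. restrict y {..<n}) \<in> P \<rightarrow>\<^sub>M cube_borel n"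
    by (simp only: measurable_cong_sets[OF hd(2) refl])
  show "prob_space (distr P (cube_borel n) (\<lambda>y. restrict y {..<n}))" by (rule P.prob_space_distr[OF r])
  show "sets (distr P (cube_borel n) (\<lambda>y. restrict y {..<n})) = sets (cube_borel n)" by (rule sets_distr)
  fix x assume x: "x \<in> cube n"
  then have x1: "x(n := 1) \<in> cube (Suc n)"
    by (auto simp: cube_def PiE_iff extensional_def less_Suc_eq)
  have r_cube: "restrict y {..<n} \<in> cube n" if "y \<in> cube (Suc n)" for y
    using that by (auto simp: cube_def PiE_iff)
  have "(\<lambda>y. restrict y {..<n}) -` {y \<in> cube n. \<forall>i<n. y i \<le> x i} \<inter> space P =
      {y \<in> cube (Suc n). \<forall>i<Suc n. y i \<le> (x(n := 1)) i}"
  proof (intro set_eqI iffI)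
    fix y assume y: "y \<in> (\<lambda>y. restrict y {..<n}) -` {y \<in> cube n. \<forall>i<n. y i \<le> x i} \<inter> space P"
    then have yc: "y \<in> cube (Suc n)" unfolding hd(3) by blast
    have "\<forall>i<n. restrict y {..<n} i \<le> x i" using y by blast
    then have "y i \<le> (x(n := 1)) i" if "i < Suc n" for i
      using top[OF yc] that by (cases "i = n") auto
    then show "y \<in> {y \<in> cube (Suc n). \<forall>i<Suc n. y i \<le> (x(n := 1)) i}" using yc by blast
  next
    fix y assume "y \<in> {y \<in> cube (Suc n). \<forall>i<Suc n. y i \<le> (x(n := 1)) i}"
    then have yc: "y \<in> cube (Suc n)" and le: "\<forall>i<Suc n. y i \<le> (x(n := 1)) i" by blast+
    have "restrict y {..<n} i \<le> x i" if "i < n" for i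
      using spec[OF le, of i] that by simp
    then show "y \<in> (\<lambda>y. restrict y {..<n}) -` {y \<in> cube n. \<forall>i<n. y i \<le> x i} \<inter> space P"
      unfolding hd(3) using yc r_cube[OF yc] by blast
  qed
  then have "measure (distr P (cube_borel n) (\<lambda>y. restrict y {..<n})) {y \<in> cube n. \<forall>i<n. y i \<le> x i} = C (x(n := 1))"
    by (simp only: measure_distr[OF r sets_down] hd(4)[OF x1])
  then show "first_margin (Suc n) C x = measure (distr P (cube_borel n) (\<lambda>y. restrict y {..<n})) {y \<in> cube n. \<forall>i<n. y i \<le> x i}"
    using x by (simp add: first_margin_def)
qed

abbreviation margin_measure :: "nat \<Rightarrow> ((nat \<Rightarrow> real) \<Rightarrow> real) \<Rightarrow> (nat \<Rightarrow> real) measure" where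
  "margin_measure n C \<equiv> copula_measure n (first_margin (Suc n) C)"

lemma margin_measure_distribution:
  assumes "copula (Suc n) C"
  shows "has_distribution_function n (margin_measure n C) (first_margin (Suc n) C)"
    "margin_measure n C = distr (copula_measure (Suc n) C) (cube_borel n) (\<lambda>y. restrict y {..<n})"
proof -
  have "has_distribution_function n (distr (copula_measure (Suc n) C) (cube_borel n) (\<lambda>y. restrict y {..<n}))
      (first_margin (Suc n) C)"
    by (rule first_margin_distribution[OF copula_measureD(1)[OF assms]]) (use cubeD in blast)
  then show "has_distribution_function n (margin_measure n C) (first_margin (Suc n) C)"
    "margin_measure n C = distr (copula_measure (Suc n) C) (cube_borel n) (\<lambda>y. restrict y {..<n})"
    using copula_measure_eq by metis+
qed

lemma unit_lebesgue_prob: "unit_lebesgue \<in> space (prob_algebra unit_borel)"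
proof -
  have "sets unit_lebesgue = sets unit_borel" by (rule restrict_space_sets_cong) auto
  moreover have "prob_space unit_lebesgue"
    by (rule prob_spaceI) (simp add: space_restrict_space emeasure_restrict_space)
  ultimately show ?thesis by (simp add: space_prob_algebra)
qed

text \<open>The kernel identity, given for rectangles, extends to the whole Borel algebra. Null sets
  that are not rectangles can then be sliced.\<close>

lemma conditional_kernelD:
  assumes C: "copula (Suc n) C" and ck: "is_conditional_kernel (Suc n) C K"
  shows "kernel_over n (margin_measure n C) K" "kernel_prod n (margin_measure n C) K = copula_measure (Suc n) C"
proof -
  note hm = has_distribution_functionD[OF margin_measure_distribution(1)[OF C]]
  note hd = has_distribution_functionD[OF copula_measureD(1)[OF C]]
  interpret P: prob_space "copula_measure (Suc n) C" by (rule hd(1))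
  show ko: "kernel_over n (margin_measure n C) K"
    by (intro kernel_over.intro hm(1,2)) (use ck in \<open>simp add: is_conditional_kernel_def\<close>)
  interpret kernel_over n "margin_measure n C" K by (rule ko)
  show "kernel_prod n (margin_measure n C) K = copula_measure (Suc n) C"
  proof (rule rectangle_eqI[symmetric])
    show "emeasure (copula_measure (Suc n) C) (cube (Suc n)) \<noteq> \<infinity>" by simp
    fix E F assume EF: "E \<in> sets (cube_borel n)" "F \<in> sets unit_borel"
    have "\<forall>E\<in>sets (cube_borel n). \<forall>F\<in>sets unit_borel. emeasure (copula_measure (Suc n) C) (rectangle (Suc n) E F) =
        (\<integral>\<^sup>+x\<in>E. emeasure (K x) F \<partial>margin_measure n C)"
      using ck unfolding is_conditional_kernel_def diff_Suc_1 by blast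
    then show "emeasure (copula_measure (Suc n) C) (rectangle (Suc n) E F) = emeasure (kernel_prod n (margin_measure n C) K) (rectangle (Suc n) E F)"
      unfolding emeasure_kernel_prod_rectangle[OF EF] using EF by blast
  qed (rule hd(2), rule sets_kernel_prod)
qed

text \<open>Applied twice to complementary sets, once with the constant Lebesgue kernel and once
  with the conditional kernel, this carries mutual singularity on the cube to almost every
  fibre.\<close>

lemma kernel_AE_null:
  assumes "kernel_over n M K" and A: "A \<in> sets (cube_borel (Suc n))" and z: "emeasure (kernel_prod n M K) A = 0"
  shows "AE x in M. emeasure (K x) (slice n A x) = 0"
proof -
  interpret kernel_over n M K by fact
  show ?thesis
    using z unfolding emeasure_kernel_prod[OF A] by (subst (asm) nn_integral_0_iff_AE[OF emeasure_slice_measurable[OF A]])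
qed

text \<open>Both parts are defined with \<open>THE\<close>, so existence and uniqueness have to be
  shown. In any decomposition the absolutely continuous part vanishes on \<open>N\<close>, being
  dominated by Lebesgue measure, and off \<open>N\<close>, being below \<open>M\<close>; the
  discrete part has no atoms because \<open>M\<close> has none.\<close>

lemma null_parts:
  assumes M: "prob_space M" "sets M = sets unit_borel"
    and atomless: "\<And>y. emeasure M {y} = 0"
    and N: "N \<in> sets unit_borel" "emeasure lborel N = 0" "emeasure M ({0..1} - N) = 0"
  shows "abs_part M = null_measure unit_borel" "dis_part M = null_measure unit_borel"
proof -
  have N1: "N \<subseteq> {0..1}" using sets.sets_into_space[OF N(1)] by (simp only: space_unit_borel)
  have sp: "space M = {0..1}" using sets_eq_imp_space_eq[OF M(2)] by (simp only: space_unit_borel)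
  have Nb: "N \<in> sets borel" using N(1) by (subst (asm) sets_restrict_space_iff) auto
  have co: "{0..1} - N \<in> sets unit_borel" using N(1) sets.compl_sets[OF N(1)] by (simp only: space_unit_borel)
  have null: "A = null_measure unit_borel \<and> D = null_measure unit_borel"
    if dec: "lebesgue_decomposition M A D S" for A D S
  proof -
    have sets: "sets A = sets unit_borel" "sets D = sets unit_borel"
      and ac: "absolutely_continuous unit_lebesgue A" and dis: "discrete_measure D"
      and sum: "\<And>F. F \<in> sets unit_borel \<Longrightarrow> emeasure M F = emeasure A F + emeasure D F + emeasure S F"
      using dec by (auto simp: lebesgue_decomposition_def)
    have "N \<in> null_sets unit_lebesgue"
      using N N1 by (auto simp: null_sets_def emeasure_restrict_space sets_restrict_space_iff Nb)
    then have "emeasure A N = 0" using ac by (auto simp: absolutely_continuous_def)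
    moreover have "emeasure A ({0..1} - N) = 0" using sum[OF co] N(3) by simp
    ultimately have "emeasure A (N \<union> ({0..1} - N)) = 0"
      using N(1) co by (subst emeasure_Un_null_set) (auto simp: null_sets_def sets)
    moreover have "N \<union> ({0..1} - N) = {0..1}" using N1 by blast
    ultimately have A0: "emeasure A {0..1} = 0" by simp
    have A: "A = null_measure unit_borel"
    proof (rule measure_eqI)
      fix F assume "F \<in> sets A"
      then have "F \<subseteq> {0..1}" using sets.sets_into_space[of F unit_borel] sets by (simp only: space_unit_borel)
      then have "emeasure A F \<le> emeasure A {0..1}" by (rule emeasure_mono) (use Icc_unit_borel[of 1] sets in simp)
      then show "emeasure A F = emeasure (null_measure unit_borel) F" using A0 by simp
    qed (simp add: sets)
    obtain T where T: "countable T" "AE x in D. x \<in> T" using dis by (auto simp: discrete_measure_def)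
    have sg: "{y} \<in> sets unit_borel" if "y \<in> {0..1}" for y :: real
      using that by (subst sets_restrict_space_iff) auto
    \<comment> \<open>For \<open>y\<close> outside the unit interval the singleton is not
      measurable, and \<open>emeasure\<close> is 0 by default.\<close>
    have Dy: "emeasure D {y} = 0" for y
    proof (cases "y \<in> {0..1}")
      case True
      then show ?thesis using sum[OF sg[OF True]] atomless[of y] by simp
    next
      case False
      then have "{y} \<notin> sets D" using sets sets.sets_into_space[of "{y}" unit_borel] by (auto simp: space_unit_borel)
      then show ?thesis by (rule emeasure_notin_sets)
    qed
    have TD: "(\<Union>y\<in>T \<inter> {0..1}. {y}) \<in> null_sets D"
    proof (rule null_sets_UN')
      show "countable (T \<inter> {0..1})" using T(1) by (rule countable_subset[rotated]) blast
      fix y assume "y \<in> T \<inter> {0..1}"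
      then have "{y} \<in> sets D" unfolding sets(2) by (intro sg) blast
      then show "{y} \<in> null_sets D" by (intro null_setsI Dy)
    qed
    have "AE x in D. x \<notin> (\<Union>y\<in>T \<inter> {0..1}. {y})" by (rule AE_not_in[OF TD])
    moreover have "AE x in D. x \<in> {0..1}"
      by (rule AE_I2) (use sets_eq_imp_space_eq[OF sets(2)] in \<open>simp add: space_unit_borel\<close>)
    ultimately have "AE x in D. False" using T(2) by eventually_elim blast
    then have D0: "emeasure D (space D) = 0"
      by (subst (asm) AE_iff_measurable[of "space D"]) auto
    have D: "D = null_measure unit_borel"
    proof (rule measure_eqI)
      fix F assume "F \<in> sets D"
      then have "emeasure D F \<le> emeasure D (space D)" by (intro emeasure_mono sets.sets_into_space) auto
      then show "emeasure D F = emeasure (null_measure unit_borel) F" using D0 by simp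
    qed (simp add: sets)
    show ?thesis using A D by blast
  qed
  \<comment> \<open>Existence: \<open>M\<close> itself is the singular part.\<close>
  have dec: "lebesgue_decomposition M (null_measure unit_borel) (null_measure unit_borel) M"
  proof -
    have "AE x in M. x \<notin> {0..1} - N" by (rule AE_not_in) (use co N(3) M(2) in \<open>simp add: null_sets_def\<close>)
    moreover have "AE x in M. x \<in> {0..1}" by (rule AE_I2) (simp add: sp)
    ultimately have "AE x in M. x \<in> N" by eventually_elim blast
    moreover have "N \<in> null_sets lborel" using N(2) Nb by (auto simp: null_sets_def)
    ultimately have "singular_measure M" using atomless by (auto simp: singular_measure_def)
    moreover have "discrete_measure (null_measure unit_borel)"
      unfolding discrete_measure_def by (intro exI[of _ "{}"]) (auto intro!: AE_I'[of "{0..1}"] simp: null_sets_def space_unit_borel Icc_unit_borel)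
    moreover have "sets unit_lebesgue = sets unit_borel" by (rule restrict_space_sets_cong) auto
    ultimately show ?thesis
      using M(2) by (auto simp: lebesgue_decomposition_def absolutely_continuous_def null_sets_def)
  qed
  show "abs_part M = null_measure unit_borel"
    unfolding abs_part_def by (rule the_equality) (use dec null in blast)+
  show "dis_part M = null_measure unit_borel"
    unfolding dis_part_def by (rule the_equality) (use dec null in blast)+
qed

text \<open>Vanishing of the kernel is asked for almost everywhere only, since a conditional kernel
  is determined only up to a null set of the margin.\<close>

lemma kernel_measure_null:
  assumes C: "copula (Suc n) C" and ae: "AE x in margin_measure n C. K x = null_measure unit_borel"
  shows "emeasure (kernel_measure (Suc n) C K) (cube (Suc n)) = 0"
proof -
  note hm = has_distribution_functionD[OF margin_measure_distribution(1)[OF C]]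
  have int: "(\<integral>\<^sup>+x\<in>E. emeasure (K x) F \<partial>margin_measure n C) = 0" for E F
  proof -
    have "(\<integral>\<^sup>+x\<in>E. emeasure (K x) F \<partial>margin_measure n C) = (\<integral>\<^sup>+x. 0 \<partial>margin_measure n C)"
      by (rule nn_integral_cong_AE, use ae in eventually_elim) simp
    then show ?thesis by simp
  qed
  have "kernel_measure (Suc n) C K = null_measure (cube_borel (Suc n))"
    unfolding kernel_measure_def diff_Suc_1 int
  proof (rule the_equality)
    fix M assume M: "sets M = sets (cube_borel (Suc n)) \<and>
      (\<forall>E\<in>sets (cube_borel n). \<forall>F\<in>sets unit_borel. emeasure M (rectangle (Suc n) E F) = 0)"
    have cb: "cube n \<in> sets (cube_borel n)" using sets.top[of "cube_borel n"] by (simp only: space_cube_borel)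
    have "{0..1::real} \<in> sets unit_borel" by (rule Icc_unit_borel) auto
    with M cb have "emeasure M (rectangle (Suc n) (cube n) {0..1}) = 0" by blast
    moreover have "rectangle (Suc n) (cube n) {0..1} = cube (Suc n)"
    proof -
      have "restrict y {..<n} \<in> cube n \<and> y n \<in> {0..1}" if "y \<in> cube (Suc n)" for y
        using that by (auto simp: cube_def PiE_iff)
      then show ?thesis unfolding rectangle_def diff_Suc_1 by blast
    qed
    ultimately have fin: "emeasure M (cube (Suc n)) = 0" by (simp only:)
    show "M = null_measure (cube_borel (Suc n))"
    proof (rule rectangle_eqI)
      show "sets M = sets (cube_borel (Suc n))" using M by blast
      show "sets (null_measure (cube_borel (Suc n))) = sets (cube_borel (Suc n))" by (rule sets_null_measure)
      show "emeasure M (cube (Suc n)) \<noteq> \<infinity>" unfolding fin by simp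
      show "emeasure M (rectangle (Suc n) E F) = emeasure (null_measure (cube_borel (Suc n))) (rectangle (Suc n) E F)"
        if "E \<in> sets (cube_borel n)" "F \<in> sets unit_borel" for E F
        unfolding emeasure_null_measure using M that by blast
    qed
  qed (simp only: sets_null_measure emeasure_null_measure simp_thms Ball_def)
  then show ?thesis by simp
qed

text \<open>
  In the variables \<open>t = R (S\<^sub>0 + \<dots> + S\<^sub>n\<^sub>-\<^sub>1)\<close>, the direction of \<open>(S\<^sub>0, \<dots>, S\<^sub>n\<^sub>-\<^sub>1)\<close> and \<open>R\<close>, the density of \<open>t\<close>
  given \<open>R = r\<close> is \<open>n t\<^sup>n\<^sup>-\<^sup>1 / r\<^sup>n\<close> on \<open>t < r\<close>. Hence, given the first \<open>n\<close> coordinates, \<open>R\<close> has a density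
  proportional to \<open>gap_weight n t\<close> with respect to its own law, and the last coordinate
  is \<open>\<psi> (R - t)\<close>.
\<close>

definition gap_weight :: "nat \<Rightarrow> real \<Rightarrow> real \<Rightarrow> ennreal" where
  "gap_weight n t r = (if t < r then ennreal (1 / r ^ n) else 0)"

lemma gap_weight_measurable[measurable]:
  "(\<lambda>x. gap_weight n (fst x) (snd x)) \<in> borel_measurable (borel \<Otimes>\<^sub>M borel)"
  unfolding gap_weight_def by measurable

lemma gap_weight_measurable1[measurable]: "gap_weight n t \<in> borel_measurable borel"
  unfolding gap_weight_def[abs_def] by measurable

section \<open>Disintegration of radial copulas in polar coordinates\<close>

context radial
begin

text \<open>Polar coordinates for the first \<open>n\<close> coordinates: \<open>s\<close> is a
  direction in the simplex with \<open>n\<close> vertices and \<open>t\<close> the sum of the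
  untransformed coordinates.\<close>

definition margin_param :: "(nat \<Rightarrow> real) \<Rightarrow> real \<Rightarrow> nat \<Rightarrow> real" where
  "margin_param s t = (\<lambda>i\<in>{..<n}. williamson n \<nu> (t * s i))"

lemma margin_param_measurable: "(\<lambda>(s, t). margin_param s t) \<in> rborel n \<Otimes>\<^sub>M borel \<rightarrow>\<^sub>M cube_borel n"
  unfolding split_beta margin_param_def
proof (rule measurable_restrict)
  fix i assume "i \<in> {..<n}"
  then have [measurable]: "(\<lambda>s. s i) \<in> rborel n \<rightarrow>\<^sub>M borel"
    by (intro measurable_component_singleton)
  have "(\<lambda>x. williamson n \<nu> (snd x * fst x i)) \<in> borel_measurable (rborel n \<Otimes>\<^sub>M borel)" by measurable
  then show "(\<lambda>x. williamson n \<nu> (snd x * fst x i)) \<in> rborel n \<Otimes>\<^sub>M borel \<rightarrow>\<^sub>M unit_borel"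
    using williamson_bounds by (intro measurable_restrict_space2) auto
qed

text \<open>Substitution \<open>t = r * w\<close>. The factor \<open>1 / r ^ n\<close> and the
  condition \<open>t < r\<close> are collected in \<open>gap_weight\<close>, which leaves
  \<open>r\<close> free to be integrated last.\<close>

lemma nn_integral_beta_scaled:
  assumes r: "0 < r" and nm: "n = Suc m" and H: "H \<in> borel_measurable borel"
  shows "(\<integral>\<^sup>+w. H (r * w) \<partial>beta_top m) =
    (\<integral>\<^sup>+t. ennreal (real n * t ^ m) * indicator {0<..} t * gap_weight n t r * H t \<partial>lborel)"
proof -
  note [measurable] = H
  have "(\<integral>\<^sup>+w. H (r * w) \<partial>beta_top m) =
      (\<integral>\<^sup>+w. ennreal (real n * w ^ m) * indicator {0..1} w * H (r * w) \<partial>lborel)"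
    unfolding nm by (rule nn_integral_beta_top) measurable
  also have "\<dots> = ennreal \<bar>1 / r\<bar> * (\<integral>\<^sup>+t. ennreal (real n * (0 + 1 / r * t) ^ m) * indicator {0..1} (0 + 1 / r * t) * H (r * (0 + 1 / r * t)) \<partial>lborel)"
    by (rule nn_integral_real_affine) (measurable, use r in simp)
  also have "\<dots> = (\<integral>\<^sup>+t. ennreal \<bar>1 / r\<bar> * (ennreal (real n * (0 + 1 / r * t) ^ m) * indicator {0..1} (0 + 1 / r * t) * H (r * (0 + 1 / r * t))) \<partial>lborel)"
    by (rule nn_integral_cmult[symmetric]) measurable
  also have "\<dots> = (\<integral>\<^sup>+t. ennreal (real n * t ^ m) * indicator {0<..} t * gap_weight n t r * H t \<partial>lborel)"
  proof (rule nn_integral_cong_AE)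
    have "AE t in lborel. t \<noteq> 0 \<and> t \<noteq> r"
      using AE_lborel_singleton[of "0::real"] AE_lborel_singleton[of r] by eventually_elim simp
    then show "AE t in lborel. ennreal \<bar>1 / r\<bar> * (ennreal (real n * (0 + 1 / r * t) ^ m) * indicator {0..1} (0 + 1 / r * t) * H (r * (0 + 1 / r * t)))
        = ennreal (real n * t ^ m) * indicator {0<..} t * gap_weight n t r * H t"
    proof eventually_elim
      case (elim t)
      have rt: "r * (0 + 1 / r * t) = t" "0 + 1 / r * t = t / r" using r by simp_all
      show ?case
      proof (cases "0 < t \<and> t < r")
        case True
        have "\<bar>1 / r\<bar> * (real n * (t / r) ^ m) = real n * t ^ m * (1 / r ^ n)"
          using r by (simp add: nm power_divide)
        then have "ennreal \<bar>1 / r\<bar> * ennreal (real n * (t / r) ^ m) = ennreal (real n * t ^ m) * ennreal (1 / r ^ n)"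
          using r True by (simp only: ennreal_mult[symmetric] abs_ge_zero zero_le_mult_iff of_nat_0_le_iff zero_le_power
              zero_le_divide_iff less_imp_le simp_thms zero_le_one)
        then show ?thesis
          unfolding rt gap_weight_def using True r by (simp add: indicator_def mult.assoc[symmetric])
      next
        case False
        then have "\<not> (0 \<le> t / r \<and> t / r \<le> 1)" using elim r by (auto simp: zero_le_divide_iff divide_le_eq_1)
        then show ?thesis unfolding rt using False by (auto simp: indicator_def gap_weight_def)
      qed
    qed
  qed
  finally show ?thesis .
qed

text \<open>Undoing the last stick-breaking step, the scaled simplex vector is \<open>r * w\<close>
  times a direction \<open>s\<close>, followed by \<open>r - r * w\<close>. With
  \<open>t = r * w\<close> the first \<open>n\<close> coordinates depend on \<open>s\<close> and
  \<open>t\<close> only, while the last is \<open>williamson n \<nu> (r - t)\<close>.\<close>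

lemma nn_integral_copula_law_split:
  assumes G: "G \<in> borel_measurable (cube_borel n \<Otimes>\<^sub>M unit_borel)"
  shows "(\<integral>\<^sup>+y. G (restrict y {..<n}, y n) \<partial>copula_law n \<nu>) =
    (\<integral>\<^sup>+s. \<integral>\<^sup>+t. \<integral>\<^sup>+r. ennreal (real n * t ^ (n - 1)) * indicator {0<..} t * gap_weight n t r *
        G (margin_param s t, williamson n \<nu> (r - t)) \<partial>\<nu> \<partial>lborel \<partial>simplex_law (n - 1))"
proof -
  obtain m where nm: "n = Suc m" using n by (cases n) auto
  have m: "n - 1 = m" by (simp add: nm)
  let ?S = "simplex_law m"
  interpret S: prob_space ?S by (rule prob_space_simplex)
  interpret W: prob_space "beta_top m" by (rule prob_space_beta_top)
  have sS: "sets ?S = sets (rborel n)" by (simp add: nm)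
  note [measurable] = G
  define H where "H = (\<lambda>(r, s, t). G (margin_param s t, williamson n \<nu> (r - t)))"
  have psi: "(\<lambda>x. williamson n \<nu> x) \<in> borel \<rightarrow>\<^sub>M unit_borel"
    using williamson_bounds by (intro measurable_restrict_space2 williamson_measurable) auto
  have H[measurable]: "H \<in> borel_measurable (borel \<Otimes>\<^sub>M (rborel n \<Otimes>\<^sub>M borel))"
  proof -
    have 1: "(\<lambda>x. margin_param (fst (snd x)) (snd (snd x))) \<in> borel \<Otimes>\<^sub>M (rborel n \<Otimes>\<^sub>M borel) \<rightarrow>\<^sub>M cube_borel n"
      using measurable_compose[OF measurable_snd margin_param_measurable] by (simp only: split_beta)
    have 2: "(\<lambda>x. williamson n \<nu> (fst x - snd (snd x))) \<in> borel \<Otimes>\<^sub>M (rborel n \<Otimes>\<^sub>M borel) \<rightarrow>\<^sub>M unit_borel"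
      by (rule measurable_compose[OF _ psi]) measurable
    show ?thesis
      unfolding H_def split_beta by (rule measurable_compose[OF measurable_Pair[OF 1 2] G])
  qed
  let ?F = "\<lambda>(r, s, t). ennreal (real n * t ^ m) * indicator {0<..} t * gap_weight n t r * H (r, s, t)"
  have gm: "(\<lambda>x. gap_weight n (snd (snd x)) (fst x)) \<in> borel_measurable (borel \<Otimes>\<^sub>M (rborel n \<Otimes>\<^sub>M borel))"
    unfolding gap_weight_def by measurable
  have F: "?F \<in> borel_measurable (borel \<Otimes>\<^sub>M (rborel n \<Otimes>\<^sub>M borel))"
  proof -
    have "(\<lambda>p. H (fst p, fst (snd p), snd (snd p))) \<in> borel_measurable (borel \<Otimes>\<^sub>M (rborel n \<Otimes>\<^sub>M borel))"
      using H by simp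
    then show ?thesis unfolding split_beta by (intro borel_measurable_times_ennreal gm) measurable
  qed
  have setsP: "sets (\<nu> \<Otimes>\<^sub>M (?S \<Otimes>\<^sub>M lborel)) = sets (borel \<Otimes>\<^sub>M (rborel n \<Otimes>\<^sub>M borel))"
    by (intro sets_pair_measure_cong sets_nu sS) simp
  interpret SL: pair_sigma_finite ?S lborel ..
  interpret Q: pair_sigma_finite \<nu> "?S \<Otimes>\<^sub>M lborel" ..
  have F': "?F \<in> borel_measurable (\<nu> \<Otimes>\<^sub>M (?S \<Otimes>\<^sub>M lborel))"
    using F by (simp only: measurable_cong_sets[OF setsP refl])
  have f1: "(\<lambda>y. (restrict y {..<n}, y n)) \<in> cube_borel (Suc n) \<rightarrow>\<^sub>M cube_borel n \<Otimes>\<^sub>M unit_borel"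
    by (intro measurable_Pair measurable_restrict_subset coord_measurable_unit) auto
  let ?g = "\<lambda>y. G (restrict y {..<n}, y n)"
  have g: "?g \<in> borel_measurable (cube_borel (Suc n))" by (rule measurable_compose[OF f1 G])
  let ?Phi = "\<lambda>x. \<lambda>i\<in>{..<Suc n}. williamson n \<nu> (x i)"
  have gP: "(\<lambda>x. ?g (?Phi x)) \<in> borel_measurable (l1_law n \<nu>)" by (rule measurable_compose[OF copula_law_measurable g])
  have gP': "(\<lambda>x. ?g (?Phi x)) \<in> borel_measurable (rborel (Suc n))"
    using gP by (simp only: measurable_cong_sets[OF sets_l1_law refl])
  have gs: "(\<lambda>p. ?g (?Phi ((\<lambda>(r, s). \<lambda>i\<in>{..<Suc n}. r * s i) p))) \<in> borel_measurable (\<nu> \<Otimes>\<^sub>M simplex_law n)"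
    by (rule measurable_compose[OF scale_measurable' gP'])
  let ?step = "\<lambda>(s, w). \<lambda>i\<in>{..<Suc n}. if i < n then w * s i else 1 - w :: real"
  have step: "?step \<in> ?S \<Otimes>\<^sub>M beta_top m \<rightarrow>\<^sub>M rborel (Suc n)"
    using simplex_step_measurable'[of m] by (simp only: nm)
  have simp_n: "simplex_law n = distr (?S \<Otimes>\<^sub>M beta_top m) (rborel (Suc n)) ?step"
    unfolding nm by (rule simplex_law.simps(2))
  have "(\<integral>\<^sup>+y. ?g y \<partial>copula_law n \<nu>) = (\<integral>\<^sup>+x. ?g (?Phi x) \<partial>l1_law n \<nu>)"
    unfolding copula_law_def by (rule nn_integral_distr[OF copula_law_measurable]) (simp only: measurable_distr_eq1 g)
  also have "\<dots> = (\<integral>\<^sup>+p. ?g (?Phi ((\<lambda>(r, s). \<lambda>i\<in>{..<Suc n}. r * s i) p)) \<partial>(\<nu> \<Otimes>\<^sub>M simplex_law n))"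
    unfolding l1_law_def by (rule nn_integral_distr[OF scale_measurable']) (simp only: measurable_distr_eq1 gP')
  also have "\<dots> = (\<integral>\<^sup>+r. \<integral>\<^sup>+x. ?g (?Phi ((\<lambda>(r, s). \<lambda>i\<in>{..<Suc n}. r * s i) (r, x))) \<partial>simplex_law n \<partial>\<nu>)"
    by (rule sx.nn_integral_fst[symmetric, OF gs])
  also have "\<dots> = (\<integral>\<^sup>+r. \<integral>\<^sup>+s. \<integral>\<^sup>+w. H (r, s, r * w) \<partial>beta_top m \<partial>?S \<partial>\<nu>)"
  proof (rule nn_integral_cong)
    fix r
    let ?k = "\<lambda>x. ?g (?Phi (\<lambda>i\<in>{..<Suc n}. r * x i))"
    have "(\<lambda>x. (r, x)) \<in> rborel (Suc n) \<rightarrow>\<^sub>M borel \<Otimes>\<^sub>M rborel (Suc n)" by (rule measurable_Pair1') simp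
    from measurable_compose[OF measurable_compose[OF this scale_measurable] gP']
    have k: "?k \<in> borel_measurable (rborel (Suc n))" by (simp only: split_conv)
    have ks: "(\<lambda>p. ?k (?step p)) \<in> borel_measurable (?S \<Otimes>\<^sub>M beta_top m)"
      by (rule measurable_compose[OF step k])
    have "(\<integral>\<^sup>+x. ?k x \<partial>simplex_law n) = (\<integral>\<^sup>+p. ?k (?step p) \<partial>(?S \<Otimes>\<^sub>M beta_top m))"
      unfolding simp_n by (rule nn_integral_distr[OF step]) (simp only: measurable_distr_eq1 k)
    also have "\<dots> = (\<integral>\<^sup>+s. \<integral>\<^sup>+w. ?k (?step (s, w)) \<partial>beta_top m \<partial>?S)"
      by (rule W.nn_integral_fst[symmetric, OF ks])
    also have "\<dots> = (\<integral>\<^sup>+s. \<integral>\<^sup>+w. H (r, s, r * w) \<partial>beta_top m \<partial>?S)"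
    proof (intro nn_integral_cong)
      fix s w
      have "restrict (?Phi (\<lambda>i\<in>{..<Suc n}. r * ?step (s, w) i)) {..<n} = margin_param s (r * w)"
        by (auto simp: margin_param_def fun_eq_iff mult.assoc)
      moreover have "?Phi (\<lambda>i\<in>{..<Suc n}. r * ?step (s, w) i) n = williamson n \<nu> (r - r * w)"
        by (simp add: algebra_simps)
      ultimately show "?k (?step (s, w)) = H (r, s, r * w)" by (simp only: H_def split_conv)
    qed
    finally show "(\<integral>\<^sup>+x. ?g (?Phi ((\<lambda>(r, s). \<lambda>i\<in>{..<Suc n}. r * s i) (r, x))) \<partial>simplex_law n)
        = (\<integral>\<^sup>+s. \<integral>\<^sup>+w. H (r, s, r * w) \<partial>beta_top m \<partial>?S)" by (simp only: split_conv)
  qed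
  also have "\<dots> = (\<integral>\<^sup>+r. \<integral>\<^sup>+s. \<integral>\<^sup>+t. ?F (r, s, t) \<partial>lborel \<partial>?S \<partial>\<nu>)"
  proof (rule nn_integral_cong_AE, use pos in eventually_elim)
    case (elim r)
    show ?case
    proof (rule nn_integral_cong)
      fix s assume "s \<in> space ?S"
      then have s: "s \<in> space (rborel n)" using sets_eq_imp_space_eq[OF sS] by simp
      have "(\<lambda>t. (r, s, t)) \<in> borel \<rightarrow>\<^sub>M borel \<Otimes>\<^sub>M (rborel n \<Otimes>\<^sub>M borel)" using s by measurable
      from measurable_compose[OF this H] have "(\<lambda>t. H (r, s, t)) \<in> borel_measurable borel" .
      from nn_integral_beta_scaled[OF elim nm this]
      show "(\<integral>\<^sup>+w. H (r, s, r * w) \<partial>beta_top m) = (\<integral>\<^sup>+t. ?F (r, s, t) \<partial>lborel)" by (simp only: split_conv)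
    qed
  qed
  also have "\<dots> = (\<integral>\<^sup>+r. \<integral>\<^sup>+p. ?F (r, p) \<partial>(?S \<Otimes>\<^sub>M lborel) \<partial>\<nu>)"
  proof (rule nn_integral_cong)
    fix r assume "r \<in> space \<nu>"
    have "(\<lambda>p. ?F (r, p)) \<in> borel_measurable (?S \<Otimes>\<^sub>M lborel)"
      by (rule measurable_compose[OF measurable_Pair1'[OF \<open>r \<in> space \<nu>\<close>] F'])
    from lborel.nn_integral_fst[OF this]
    show "(\<integral>\<^sup>+s. \<integral>\<^sup>+t. ?F (r, s, t) \<partial>lborel \<partial>?S) = (\<integral>\<^sup>+p. ?F (r, p) \<partial>(?S \<Otimes>\<^sub>M lborel))" .
  qed
  \<comment> \<open>Fubini makes \<open>r\<close> the innermost variable: for fixed \<open>s\<close>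
    and \<open>t\<close>, hence fixed first coordinates, the integral over \<open>r\<close> is the
    unnormalized kernel.\<close>
  also have "\<dots> = (\<integral>\<^sup>+p. \<integral>\<^sup>+r. ?F (r, p) \<partial>\<nu> \<partial>(?S \<Otimes>\<^sub>M lborel))"
    by (rule Q.Fubini[symmetric, OF F'])
  also have "\<dots> = (\<integral>\<^sup>+s. \<integral>\<^sup>+t. \<integral>\<^sup>+r. ?F (r, s, t) \<partial>\<nu> \<partial>lborel \<partial>?S)"
  proof (rule lborel.nn_integral_fst[symmetric])
    have "(\<lambda>x. ?F (snd x, fst x)) \<in> borel_measurable ((?S \<Otimes>\<^sub>M lborel) \<Otimes>\<^sub>M \<nu>)"
      by (rule measurable_compose[OF measurable_Pair[OF measurable_snd measurable_fst] F'])
    moreover have "(\<lambda>(p, r). ?F (r, p)) = (\<lambda>x. ?F (snd x, fst x))" by (rule ext) (simp add: split_beta)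
    ultimately have "(\<lambda>(p, r). ?F (r, p)) \<in> borel_measurable ((?S \<Otimes>\<^sub>M lborel) \<Otimes>\<^sub>M \<nu>)" by (simp only:)
    then show "(\<lambda>p. \<integral>\<^sup>+r. ?F (r, p) \<partial>\<nu>) \<in> borel_measurable (?S \<Otimes>\<^sub>M lborel)"
      by (rule nu.borel_measurable_nn_integral)
  qed
  finally show ?thesis unfolding m by (simp only: split_conv H_def)
qed

definition gap_mass :: "real \<Rightarrow> ennreal" where
  "gap_mass t = (\<integral>\<^sup>+r. gap_weight n t r \<partial>\<nu>)"

text \<open>The conditional law of the last coordinate given \<open>t\<close>. The point mass in the
  remaining cases is a default that keeps it a probability kernel; such \<open>t\<close> contribute
  nothing to the integral in \<open>nn_integral_copula_law_split\<close>.\<close>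

definition gap_kernel :: "real \<Rightarrow> real measure" where
  "gap_kernel t = (if 0 < t \<and> 0 < gap_mass t
     then distr (density \<nu> (\<lambda>r. gap_weight n t r / gap_mass t)) unit_borel (\<lambda>r. williamson n \<nu> (r - t))
     else return unit_borel 0)"

lemma gap_mass_finite:
  assumes "0 < t"
  shows "gap_mass t < \<top>"
proof -
  have "gap_mass t \<le> (\<integral>\<^sup>+r. ennreal (1 / t ^ n) \<partial>\<nu>)"
    unfolding gap_mass_def gap_weight_def
    by (intro nn_integral_mono) (use assms in \<open>auto intro!: ennreal_leI divide_left_mono power_mono mult_pos_pos\<close>)
  also have "\<dots> = ennreal (1 / t ^ n)" by (simp add: nu.emeasure_space_1)
  finally show ?thesis by (rule order.strict_trans1) simp
qed

lemma gap_mass_measurable[measurable]: "gap_mass \<in> borel_measurable borel"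
proof -
  have "(\<lambda>(t, r). gap_weight n t r) = (\<lambda>x. gap_weight n (fst x) (snd x))" by auto
  then have "(\<lambda>(t, r). gap_weight n t r) \<in> borel_measurable (borel \<Otimes>\<^sub>M \<nu>)"
    using gap_weight_measurable[of n]
    by (simp only: measurable_cong_sets[OF sets_pair_measure_cong[OF refl sets_nu] refl])
  then show ?thesis unfolding gap_mass_def[abs_def] by (rule nu.borel_measurable_nn_integral)
qed

lemma psi_unit: "(\<lambda>r. williamson n \<nu> (r - t)) \<in> borel \<rightarrow>\<^sub>M unit_borel"
  using williamson_bounds by (intro measurable_restrict_space2) auto

lemma gap_emeasure:
  assumes t: "0 < t" "0 < gap_mass t" and F: "F \<in> sets unit_borel"
  shows "emeasure (gap_kernel t) F = (\<integral>\<^sup>+r. gap_weight n t r * indicator F (williamson n \<nu> (r - t)) \<partial>\<nu>) / gap_mass t"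
proof -
  let ?D = "density \<nu> (\<lambda>r. gap_weight n t r / gap_mass t)"
  have m: "(\<lambda>r. williamson n \<nu> (r - t)) \<in> ?D \<rightarrow>\<^sub>M unit_borel"
    using psi_unit by (simp only: measurable_cong_sets[OF sets_density refl] measurable_cong_sets[OF sets_nu refl])
  have gw: "(\<lambda>r. gap_weight n t r) \<in> borel_measurable \<nu>"
    using gap_weight_measurable1[of n t] by (simp only: measurable_cong_sets[OF sets_nu refl])
  have S: "(\<lambda>r. williamson n \<nu> (r - t)) -` F \<inter> space ?D \<in> sets \<nu>"
    using measurable_sets[OF m F] by (simp only: sets_density)
  have ind: "(\<lambda>r. indicator F (williamson n \<nu> (r - t)) :: ennreal) \<in> borel_measurable \<nu>"
    using measurable_compose[OF psi_unit borel_measurable_indicator[OF F], of t]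
    by (simp only: measurable_cong_sets[OF sets_nu refl])
  have "emeasure (gap_kernel t) F = emeasure ?D ((\<lambda>r. williamson n \<nu> (r - t)) -` F \<inter> space ?D)"
    unfolding gap_kernel_def using t by (simp only: simp_thms if_True emeasure_distr[OF m F])
  also have "\<dots> = (\<integral>\<^sup>+r. gap_weight n t r / gap_mass t * indicator ((\<lambda>r. williamson n \<nu> (r - t)) -` F \<inter> space ?D) r \<partial>\<nu>)"
    by (rule emeasure_density[OF _ S]) (rule borel_measurable_divide_ennreal[OF gw], simp)
  also have "\<dots> = (\<integral>\<^sup>+r. gap_weight n t r * indicator F (williamson n \<nu> (r - t)) / gap_mass t \<partial>\<nu>)"
    by (rule nn_integral_cong) (simp add: indicator_def space_nu)
  also have "\<dots> = (\<integral>\<^sup>+r. gap_weight n t r * indicator F (williamson n \<nu> (r - t)) \<partial>\<nu>) / gap_mass t"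
    by (rule nn_integral_divide) (intro borel_measurable_times_ennreal gw ind)
  finally show ?thesis .
qed

lemma gap_kernel_mass:
  assumes t: "0 < t" and F: "F \<in> sets unit_borel"
  shows "(\<integral>\<^sup>+r. gap_weight n t r * indicator F (williamson n \<nu> (r - t)) \<partial>\<nu>) = gap_mass t * emeasure (gap_kernel t) F"
proof (cases "gap_mass t = 0")
  case True
  have gw: "(\<lambda>r. gap_weight n t r) \<in> borel_measurable \<nu>"
    using gap_weight_measurable1[of n t] by (simp only: measurable_cong_sets[OF sets_nu refl])
  have "AE r in \<nu>. gap_weight n t r = 0"
    using True unfolding gap_mass_def by (subst (asm) nn_integral_0_iff_AE[OF gw])
  then have "(\<integral>\<^sup>+r. gap_weight n t r * indicator F (williamson n \<nu> (r - t)) \<partial>\<nu>) = (\<integral>\<^sup>+r. 0 \<partial>\<nu>)"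
    by (intro nn_integral_cong_AE) (auto elim!: eventually_mono)
  then show ?thesis using True by simp
next
  case False
  then have c: "0 < gap_mass t" by (simp add: zero_less_iff_neq_zero)
  show ?thesis
    unfolding gap_emeasure[OF t c F] using False gap_mass_finite[OF t]
    by (subst ennreal_times_divide, subst mult.commute, subst mult_divide_eq_ennreal) auto
qed

lemma gap_kernel_prob: "prob_space (gap_kernel t)" "sets (gap_kernel t) = sets unit_borel"
proof -
  show s: "sets (gap_kernel t) = sets unit_borel" by (simp add: gap_kernel_def)
  show "prob_space (gap_kernel t)"
  proof (cases "0 < t \<and> 0 < gap_mass t")
    case True
    have one: "{0..1} \<in> sets unit_borel" by (rule Icc_unit_borel) auto
    have "emeasure (gap_kernel t) {0..1} = gap_mass t / gap_mass t"
      using gap_emeasure[OF _ _ one] True williamson_bounds by (simp add: gap_mass_def)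
    also have "\<dots> = 1" using True gap_mass_finite[of t] by (intro ennreal_divide_self) auto
    finally show ?thesis
      using sets_eq_imp_space_eq[OF s] by (intro prob_spaceI) (simp only: space_unit_borel)
  next
    case False
    then show ?thesis
      unfolding gap_kernel_def by (simp only: if_False) (rule prob_space_return, simp add: space_unit_borel)
  qed
qed

lemma gap_kernel_measurable: "gap_kernel \<in> borel \<rightarrow>\<^sub>M prob_algebra unit_borel"
proof (rule measurable_prob_algebraI)
  show "prob_space (gap_kernel t)" for t by (rule gap_kernel_prob)
  show "gap_kernel \<in> borel \<rightarrow>\<^sub>M subprob_algebra unit_borel"
  proof (rule measurable_subprob_algebra)
    show "subprob_space (gap_kernel t)" for t by (rule prob_space_imp_subprob_space[OF gap_kernel_prob(1)])
    show "sets (gap_kernel t) = sets unit_borel" for t by (rule gap_kernel_prob)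
    fix F assume F: "F \<in> sets unit_borel"
    have eq: "emeasure (gap_kernel t) F = (if 0 < t \<and> 0 < gap_mass t
      then (\<integral>\<^sup>+r. gap_weight n t r * indicator F (williamson n \<nu> (r - t)) \<partial>\<nu>) / gap_mass t else indicator F 0)" for t
    proof (cases "0 < t \<and> 0 < gap_mass t")
      case True
      then show ?thesis using gap_emeasure[OF _ _ F] by simp
    next
      case False
      then show ?thesis unfolding gap_kernel_def by (simp only: if_False emeasure_return[OF F])
    qed
    have "(\<lambda>p. williamson n \<nu> (snd p - fst p)) \<in> borel \<Otimes>\<^sub>M borel \<rightarrow>\<^sub>M unit_borel"
      using williamson_bounds by (intro measurable_restrict_space2) auto
    from measurable_compose[OF this borel_measurable_indicator[OF F]]
    have "(\<lambda>p. gap_weight n (fst p) (snd p) * indicator F (williamson n \<nu> (snd p - fst p))) \<in> borel_measurable (borel \<Otimes>\<^sub>M borel)"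
      by (intro borel_measurable_times_ennreal gap_weight_measurable)
    moreover have "(\<lambda>(t, r). gap_weight n t r * indicator F (williamson n \<nu> (r - t)) :: ennreal) =
        (\<lambda>p. gap_weight n (fst p) (snd p) * indicator F (williamson n \<nu> (snd p - fst p)))" by auto
    ultimately have "(\<lambda>(t, r). gap_weight n t r * indicator F (williamson n \<nu> (r - t))) \<in> borel_measurable (borel \<Otimes>\<^sub>M \<nu>)"
      by (simp only: measurable_cong_sets[OF sets_pair_measure_cong[OF refl sets_nu] refl])
    then have [measurable]: "(\<lambda>t. \<integral>\<^sup>+r. gap_weight n t r * indicator F (williamson n \<nu> (r - t)) \<partial>\<nu>) \<in> borel_measurable borel"
      by (rule nu.borel_measurable_nn_integral)
    show "(\<lambda>t. emeasure (gap_kernel t) F) \<in> borel_measurable borel"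
      unfolding eq by measurable
  qed
qed

definition level :: "(nat \<Rightarrow> real) \<Rightarrow> real" where
  "level x = (\<Sum>i<n. gen_inv (williamson n \<nu>) (x i))"

lemma level_measurable: "level \<in> borel_measurable (cube_borel n)"
  unfolding level_def[abs_def]
proof (rule borel_measurable_sum)
  fix i assume "i \<in> {..<n}"
  then show "(\<lambda>x. gen_inv (williamson n \<nu>) (x i)) \<in> borel_measurable (cube_borel n)"
    by (intro measurable_compose[OF coord_measurable gen_inv_measurable]) simp
qed

text \<open>Since \<open>t * s i \<le> t\<close>, the transform is positive at every
  \<open>t * s i\<close> and can be inverted there; the inverses sum to \<open>t\<close>. So
  \<open>t\<close> is a function of the first \<open>n\<close> coordinates.\<close>

lemma level_margin_param:
  assumes s: "s \<in> std_simplex n" and t: "0 < t" and pt: "0 < williamson n \<nu> t"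
  shows "level (margin_param s t) = t"
proof -
  have s0: "0 \<le> s i" if "i < n" for i using s that unfolding std_simplex_def by blast
  have s1: "(\<Sum>i<n. s i) = 1" using s unfolding std_simplex_def by blast
  have "gen_inv (williamson n \<nu>) (margin_param s t i) = t * s i" if i: "i < n" for i
  proof -
    have "s i \<le> (\<Sum>i<n. s i)" using s0 i by (intro member_le_sum) auto
    then have "t * s i \<le> t" using s1 t by simp
    then have "0 < williamson n \<nu> (t * s i)" using williamson_antimono pt by (meson less_le_trans)
    then show ?thesis using i s0[OF i] t by (simp add: margin_param_def gen_inv_eq)
  qed
  then have "level (margin_param s t) = (\<Sum>i<n. t * s i)" unfolding level_def by (intro sum.cong) auto
  also have "\<dots> = t" using s1 by (simp add: sum_distrib_left[symmetric])
  finally show ?thesis .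
qed

text \<open>Covers the case left out by \<open>level_margin_param\<close>: if the transform vanishes
  at \<open>t\<close>, the radius is almost surely at most \<open>t\<close>, and \<open>t\<close>
  cannot be recovered but also carries no mass.\<close>

lemma gap_mass_zero:
  assumes t: "0 < t" and z: "williamson n \<nu> t = 0"
  shows "gap_mass t = 0"
proof -
  have "AE r in \<nu>. tail n (t / r) = 0"
    using z unfolding williamson_def
    by (subst (asm) integral_nonneg_eq_0_iff_AE[OF tail_integrable]) (auto simp: tail_bounds)
  with pos have "AE r in \<nu>. gap_weight n t r = 0"
  proof eventually_elim
    case (elim r)
    have "\<not> t < r"
    proof
      assume "t < r"
      then have "0 < t / r" "t / r < 1" using t by auto
      then show False using elim(2) by (simp add: tail_def)
    qed
    then show ?case by (simp add: gap_weight_def)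
  qed
  then have "gap_mass t = (\<integral>\<^sup>+r. 0 \<partial>\<nu>)" unfolding gap_mass_def by (rule nn_integral_cong_AE)
  then show ?thesis by simp
qed

text \<open>Both sides of the kernel identity are integrals of the form treated in
  \<open>nn_integral_copula_law_split\<close>, and they agree already in the innermost integral over
  \<open>r\<close>. The result also shows that the choice in \<open>conditional_kernel\<close> is
  not vacuous.\<close>

lemma conditional_kernel_gap: "is_conditional_kernel (Suc n) (radial_copula n \<nu>) (\<lambda>x. gap_kernel (level x))"
  unfolding is_conditional_kernel_def diff_Suc_1
proof (intro conjI ballI)
  show "(\<lambda>x. gap_kernel (level x)) \<in> cube_borel n \<rightarrow>\<^sub>M prob_algebra unit_borel"
    by (rule measurable_compose[OF level_measurable gap_kernel_measurable])
  fix E F assume E: "E \<in> sets (cube_borel n)" and F: "F \<in> sets unit_borel"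
  let ?K = "\<lambda>x. emeasure (gap_kernel (level x)) F"
  have Km: "?K \<in> borel_measurable (cube_borel n)"
    by (rule measurable_compose[OF level_measurable
          measurable_emeasure_kernel[OF measurable_prob_algebraD[OF gap_kernel_measurable] F]])
  have Em: "(\<lambda>x. indicator E x :: ennreal) \<in> borel_measurable (cube_borel n)" by (rule borel_measurable_indicator[OF E])
  let ?G = "\<lambda>p. indicator E (fst p) * indicator F (snd p) :: ennreal"
  let ?G' = "\<lambda>p. indicator E (fst p) * ?K (fst p) :: ennreal"
  have G: "?G \<in> borel_measurable (cube_borel n \<Otimes>\<^sub>M unit_borel)"
    by (intro borel_measurable_times_ennreal measurable_compose[OF measurable_fst Em]
        measurable_compose[OF measurable_snd borel_measurable_indicator[OF F]])
  have G': "?G' \<in> borel_measurable (cube_borel n \<Otimes>\<^sub>M unit_borel)"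
    by (intro borel_measurable_times_ennreal measurable_compose[OF measurable_fst Em] measurable_compose[OF measurable_fst Km])
  have r: "(\<lambda>y. restrict y {..<n}) \<in> copula_law n \<nu> \<rightarrow>\<^sub>M cube_borel n"
    using measurable_restrict_subset[of "{..<n}" "{..<Suc n}" "\<lambda>_. unit_borel"]
    by (simp add: measurable_cong_sets[OF sets_copula_law refl])
  have ko: "kernel_over n (margin_measure n (radial_copula n \<nu>)) (\<lambda>x. gap_kernel (level x))"
    using has_distribution_functionD[OF margin_measure_distribution(1)[OF copula_radial_copula]]
      measurable_compose[OF level_measurable gap_kernel_measurable] by (intro kernel_over.intro)
  have spu: "space (copula_law n \<nu>) = cube (Suc n)"
    using sets_eq_imp_space_eq[OF sets_copula_law] by (simp only: space_cube_borel)
  have "emeasure (copula_law n \<nu>) (rectangle (Suc n) E F) = (\<integral>\<^sup>+y. indicator (rectangle (Suc n) E F) y \<partial>copula_law n \<nu>)"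
    by (rule nn_integral_indicator[symmetric]) (simp only: sets_copula_law kernel_over.sets_rectangle[OF ko E F])
  also have "\<dots> = (\<integral>\<^sup>+y. ?G (restrict y {..<n}, y n) \<partial>copula_law n \<nu>)"
    by (rule nn_integral_cong) (simp add: spu rectangle_def indicator_def)
  also have "\<dots> = (\<integral>\<^sup>+s. \<integral>\<^sup>+t. \<integral>\<^sup>+r. ennreal (real n * t ^ (n - 1)) * indicator {0<..} t * gap_weight n t r *
        ?G (margin_param s t, williamson n \<nu> (r - t)) \<partial>\<nu> \<partial>lborel \<partial>simplex_law (n - 1))"
    by (rule nn_integral_copula_law_split[OF G])
  also have "\<dots> = (\<integral>\<^sup>+s. \<integral>\<^sup>+t. \<integral>\<^sup>+r. ennreal (real n * t ^ (n - 1)) * indicator {0<..} t * gap_weight n t r *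
        ?G' (margin_param s t, williamson n \<nu> (r - t)) \<partial>\<nu> \<partial>lborel \<partial>simplex_law (n - 1))"
  proof (rule nn_integral_cong_AE)
    have "AE s in simplex_law (n - 1). s \<in> std_simplex n"
      using AE_simplex[of "n - 1"] n by simp
    then show "AE s in simplex_law (n - 1).
      (\<integral>\<^sup>+t. \<integral>\<^sup>+r. ennreal (real n * t ^ (n - 1)) * indicator {0<..} t * gap_weight n t r * ?G (margin_param s t, williamson n \<nu> (r - t)) \<partial>\<nu> \<partial>lborel) =
      (\<integral>\<^sup>+t. \<integral>\<^sup>+r. ennreal (real n * t ^ (n - 1)) * indicator {0<..} t * gap_weight n t r * ?G' (margin_param s t, williamson n \<nu> (r - t)) \<partial>\<nu> \<partial>lborel)"
    proof eventually_elim
      case (elim s)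
      show ?case
      proof (rule nn_integral_cong)
        fix t :: real
        let ?c = "ennreal (real n * t ^ (n - 1)) * indicator {0<..} t * indicator E (margin_param s t)"
        have gw: "(\<lambda>r. gap_weight n t r) \<in> borel_measurable \<nu>"
          using gap_weight_measurable1[of n t] by (simp only: measurable_cong_sets[OF sets_nu refl])
        have ind: "(\<lambda>r. indicator F (williamson n \<nu> (r - t)) :: ennreal) \<in> borel_measurable \<nu>"
          using measurable_compose[OF psi_unit borel_measurable_indicator[OF F], of t]
          by (simp only: measurable_cong_sets[OF sets_nu refl])
        have "(\<integral>\<^sup>+r. ennreal (real n * t ^ (n - 1)) * indicator {0<..} t * gap_weight n t r * ?G (margin_param s t, williamson n \<nu> (r - t)) \<partial>\<nu>)
            = (\<integral>\<^sup>+r. ?c * (gap_weight n t r * indicator F (williamson n \<nu> (r - t))) \<partial>\<nu>)"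
          by (rule nn_integral_cong) (simp add: ac_simps)
        also have "\<dots> = ?c * (\<integral>\<^sup>+r. gap_weight n t r * indicator F (williamson n \<nu> (r - t)) \<partial>\<nu>)"
          by (rule nn_integral_cmult) (intro borel_measurable_times_ennreal gw ind)
        also have "\<dots> = ?c * (gap_mass t * ?K (margin_param s t))"
        proof (cases "0 < t")
          case True
          show ?thesis
          proof (cases "0 < williamson n \<nu> t")
            case False
            then have "gap_mass t = 0" using gap_mass_zero[OF True] williamson_bounds(1)[of t] by auto
            then show ?thesis by (simp only: gap_kernel_mass[OF True F] mult_zero_left)
          next
            case pt: True
            show ?thesis by (simp only: gap_kernel_mass[OF True F] level_margin_param[OF elim True pt])
          qed
        qed simp
        also have "\<dots> = (\<integral>\<^sup>+r. (?c * ?K (margin_param s t)) * gap_weight n t r \<partial>\<nu>)"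
          unfolding nn_integral_cmult[OF gw] gap_mass_def by (simp add: ac_simps)
        also have "\<dots> = (\<integral>\<^sup>+r. ennreal (real n * t ^ (n - 1)) * indicator {0<..} t * gap_weight n t r * ?G' (margin_param s t, williamson n \<nu> (r - t)) \<partial>\<nu>)"
          by (rule nn_integral_cong) (simp add: ac_simps)
        finally show "(\<integral>\<^sup>+r. ennreal (real n * t ^ (n - 1)) * indicator {0<..} t * gap_weight n t r * ?G (margin_param s t, williamson n \<nu> (r - t)) \<partial>\<nu>)
            = (\<integral>\<^sup>+r. ennreal (real n * t ^ (n - 1)) * indicator {0<..} t * gap_weight n t r * ?G' (margin_param s t, williamson n \<nu> (r - t)) \<partial>\<nu>)" .
      qed
    qed
  qed
  also have "\<dots> = (\<integral>\<^sup>+y. ?G' (restrict y {..<n}, y n) \<partial>copula_law n \<nu>)"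
    by (rule nn_integral_copula_law_split[OF G', symmetric])
  also have "\<dots> = (\<integral>\<^sup>+y. ?K (restrict y {..<n}) * indicator E (restrict y {..<n}) \<partial>copula_law n \<nu>)"
    by (rule nn_integral_cong) (simp only: fst_conv mult.commute)
  also have "\<dots> = (\<integral>\<^sup>+x\<in>E. ?K x \<partial>margin_measure n (radial_copula n \<nu>))"
    unfolding margin_measure_distribution(2)[OF copula_radial_copula] copula_measure_radial_copula
    by (rule nn_integral_distr[symmetric, OF r]) (simp only: measurable_distr_eq1, intro borel_measurable_times_ennreal Km Em)
  finally show "emeasure (copula_measure (Suc n) (radial_copula n \<nu>)) (rectangle (Suc n) E F) =
      (\<integral>\<^sup>+x\<in>E. emeasure (gap_kernel (level x)) F \<partial>margin_measure n (radial_copula n \<nu>))"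
    by (simp only: copula_measure_radial_copula)
qed

text \<open>An interior \<open>y\<close> is attained for the single radius
  \<open>t + gen_inv (williamson n \<nu>) y\<close>. The point 0 is excluded: the transform may have
  a plateau there, and the default kernel has its atom there.\<close>

lemma gap_kernel_atomless:
  assumes atomless: "\<And>r. emeasure \<nu> {r} = 0" and y: "0 < y" "y < 1"
  shows "emeasure (gap_kernel t) {y} = 0"
proof -
  have Y: "{y} \<in> sets unit_borel" using y by (subst sets_restrict_space_iff) auto
  show ?thesis
  proof (cases "0 < t \<and> 0 < gap_mass t")
    case True
    have "{t + gen_inv (williamson n \<nu>) y} \<in> null_sets \<nu>" by (simp add: null_sets_def atomless sets_nu)
    from AE_not_in[OF this] have "AE r in \<nu>. gap_weight n t r * indicator {y} (williamson n \<nu> (r - t)) = 0"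
    proof eventually_elim
      case (elim r)
      have "\<not> (t < r \<and> williamson n \<nu> (r - t) = y)"
      proof
        assume "t < r \<and> williamson n \<nu> (r - t) = y"
        then have "gen_inv (williamson n \<nu>) y = r - t" using gen_inv_eq[of "r - t"] y by auto
        then show False using elim by simp
      qed
      then show ?case by (auto simp: gap_weight_def indicator_def)
    qed
    then have "(\<integral>\<^sup>+r. gap_weight n t r * indicator {y} (williamson n \<nu> (r - t)) \<partial>\<nu>) = (\<integral>\<^sup>+r. 0 \<partial>\<nu>)"
      by (rule nn_integral_cong_AE)
    then show ?thesis using gap_emeasure[OF _ _ Y] True by simp
  next
    case False
    then show ?thesis
      using y unfolding gap_kernel_def by (simp only: if_False emeasure_return[OF Y]) simp
  qed
qed

end

text \<open>For one set \<open>F\<close> the kernels agree almost everywhere by uniqueness of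
  densities. Rational endpoints leave a single exceptional null set, and right continuity of
  distribution functions extends the agreement to all endpoints.\<close>

lemma kernel_AE_unique:
  assumes C: "copula (Suc n) C" and ck: "is_conditional_kernel (Suc n) C K" "is_conditional_kernel (Suc n) C K'"
  shows "AE x in margin_measure n C. K x = K' x"
proof -
  let ?M = "margin_measure n C"
  interpret a: kernel_over n ?M K by (rule conditional_kernelD(1)[OF C ck(1)])
  interpret b: kernel_over n ?M K' by (rule conditional_kernelD(1)[OF C ck(2)])
  have eqF: "AE x in ?M. emeasure (K x) F = emeasure (K' x) F" if F: "F \<in> sets unit_borel" for F
  proof -
    have "density ?M (\<lambda>x. emeasure (K x) F) = density ?M (\<lambda>x. emeasure (K' x) F)"
    proof (rule measure_eqI)
      fix E assume "E \<in> sets (density ?M (\<lambda>x. emeasure (K x) F))"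
      then have E: "E \<in> sets ?M" "E \<in> sets (cube_borel n)" by (simp_all only: sets_density a.sets_M)
      have "(\<integral>\<^sup>+x\<in>E. emeasure (K x) F \<partial>?M) = (\<integral>\<^sup>+x\<in>E. emeasure (K' x) F \<partial>?M)"
        using a.emeasure_kernel_prod_rectangle[OF E(2) F] b.emeasure_kernel_prod_rectangle[OF E(2) F]
        by (simp only: conditional_kernelD(2)[OF C ck(1)] conditional_kernelD(2)[OF C ck(2)])
      then show "emeasure (density ?M (\<lambda>x. emeasure (K x) F)) E = emeasure (density ?M (\<lambda>x. emeasure (K' x) F)) E"
        by (simp only: emeasure_density[OF a.emeasure_K_measurable[OF F] E(1)]
            emeasure_density[OF b.emeasure_K_measurable[OF F] E(1)])
    qed simp
    then show ?thesis
      by (rule a.density_unique[OF a.emeasure_K_measurable[OF F] b.emeasure_K_measurable[OF F]])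
  qed
  have "AE x in ?M. \<forall>q\<in>\<rat> \<inter> {0..1}. emeasure (K x) {0..q} = emeasure (K' x) {0..q}"
  proof (subst AE_ball_countable)
    show "countable (\<rat> \<inter> {0..1::real})" using countable_rat by (rule countable_subset[rotated]) blast
    show "\<forall>q\<in>\<rat> \<inter> {0..1}. AE x in ?M. emeasure (K x) {0..q} = emeasure (K' x) {0..q}"
      by (intro ballI eqF Icc_unit_borel) auto
  qed
  moreover have "AE x in ?M. x \<in> cube n" by (rule AE_I2) (simp only: a.space_M)
  ultimately show ?thesis
  proof eventually_elim
    case (elim x)
    \<comment> \<open>One inequality is enough, as the assumptions are symmetric in the two
      measures.\<close>
    have le: "emeasure P {0..c} \<le> emeasure Q {0..c}"
      if P: "prob_space P" "sets P = sets unit_borel" and Q: "prob_space Q" "sets Q = sets unit_borel"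
        and eq: "\<And>q. q \<in> \<rat> \<inter> {0..1} \<Longrightarrow> emeasure P {0..q} = emeasure Q {0..q}" and c: "0 \<le> c" "c \<le> 1" for P Q c
    proof (cases "c = 1")
      case True
      then show ?thesis using eq[of 1] by simp
    next
      case False
      interpret P: prob_space P by fact
      interpret Q: prob_space Q by fact
      let ?A = "\<lambda>i::nat. {0..min 1 (c + 1 / real (Suc i))}"
      have A: "?A i \<in> sets Q" "?A i \<in> sets P" for i
        using c unfolding P(2) Q(2) by (intro Icc_unit_borel; simp)+
      have lim: "(\<lambda>i. emeasure Q (?A i)) \<longlonglongrightarrow> emeasure Q (\<Inter>i. ?A i)"
      proof (rule Lim_emeasure_decseq)
        show "range ?A \<subseteq> sets Q" using A by blast
        show "decseq ?A"
          unfolding decseq_def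
        proof (intro allI impI)
          fix i j :: nat assume "i \<le> j"
          then have "1 / real (Suc j) \<le> 1 / real (Suc i)" by (intro divide_left_mono) auto
          then have "min 1 (c + 1 / real (Suc j)) \<le> min 1 (c + 1 / real (Suc i))" by linarith
          then show "?A j \<subseteq> ?A i" unfolding atLeastatMost_subset_iff by blast
        qed
      qed simp
      have "(\<Inter>i. ?A i) = {0..c}"
      proof
        have "{0..c} \<subseteq> ?A i" for i
        proof -
          have "0 \<le> 1 / real (Suc i)" by simp
          then have "c \<le> min 1 (c + 1 / real (Suc i))" using c by linarith
          then show ?thesis unfolding atLeastatMost_subset_iff by blast
        qed
        then show "{0..c} \<subseteq> (\<Inter>i. ?A i)" by blast
        show "(\<Inter>i. ?A i) \<subseteq> {0..c}"
        proof
          fix y assume y: "y \<in> (\<Inter>i. ?A i)"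
          then have y2: "y \<le> c + 1 / real (Suc i)" for i by auto
          have "(\<lambda>i. c + 1 / real (Suc i)) \<longlonglongrightarrow> c + 0"
            by (intro tendsto_add tendsto_const LIMSEQ_Suc lim_1_over_n)
          then have "y \<le> c + 0" by (rule LIMSEQ_le_const) (use y2 in blast)
          then show "y \<in> {0..c}" using y by auto
        qed
      qed
      with lim have lim: "(\<lambda>i. emeasure Q (?A i)) \<longlonglongrightarrow> emeasure Q {0..c}" by (simp only:)
      have "emeasure P {0..c} \<le> emeasure Q (?A i)" for i
      proof -
        have "c < min 1 (c + 1 / real (Suc i))" using False c by simp
        then obtain q where q: "q \<in> \<rat>" "c < q" "q < min 1 (c + 1 / real (Suc i))" using Rats_dense_in_real by blast
        have "emeasure P {0..c} \<le> emeasure P {0..q}"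
        proof (rule emeasure_mono)
          show "{0..c} \<subseteq> {0..q}" using q by auto
          show "{0..q} \<in> sets P" unfolding P(2) using q c by (intro Icc_unit_borel) auto
        qed
        also have "\<dots> = emeasure Q {0..q}" using q c by (intro eq) auto
        also have "\<dots> \<le> emeasure Q (?A i)" by (rule emeasure_mono[OF _ A(1)]) (use q in auto)
        finally show ?thesis .
      qed
      then show ?thesis by (intro LIMSEQ_le_const[OF lim]) blast
    qed
    note k = a.KD[OF elim(2)] b.KD[OF elim(2)]
    show ?case
    proof (rule unit_borel_eqI)
      show "sets (K x) = sets unit_borel" "sets (K' x) = sets unit_borel" by (rule k)+
      show "emeasure (K x) {0..1} \<noteq> \<infinity>"
        using prob_space.emeasure_space_1[OF k(1)] by (simp add: k(3))
      fix c :: real assume c: "0 \<le> c" "c \<le> 1"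
      show "emeasure (K x) {0..c} = emeasure (K' x) {0..c}"
        using elim(1) by (intro antisym le[OF k(1,2) k(4,5) _ c] le[OF k(4,5) k(1,2) _ c]) auto
    qed
  qed
qed

section \<open>Atoms, level sets and fibres of radial copulas\<close>

context radial
begin

text \<open>The explicit kernel rules out atoms at interior points; the points 0 and 1 are handled
  by the uniform last margin, whatever version of the kernel is chosen.\<close>

lemma conditional_kernel_atomless:
  assumes atomless: "\<And>r. emeasure \<nu> {r} = 0"
  shows "AE x in margin_measure n (radial_copula n \<nu>). \<forall>y. emeasure (conditional_kernel (Suc n) (radial_copula n \<nu>) x) {y} = 0"
proof -
  let ?K = "conditional_kernel (Suc n) (radial_copula n \<nu>)"
  let ?M = "margin_measure n (radial_copula n \<nu>)"
  have ck: "is_conditional_kernel (Suc n) (radial_copula n \<nu>) ?K"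
    unfolding conditional_kernel_def by (rule someI[where P="is_conditional_kernel (Suc n) (radial_copula n \<nu>)", OF conditional_kernel_gap])
  interpret k: kernel_over n ?M ?K by (rule conditional_kernelD(1)[OF copula_radial_copula ck])
  have F: "{0, 1::real} \<in> sets unit_borel" by (subst sets_restrict_space_iff) auto
  have E: "cube n \<in> sets (cube_borel n)" using sets.top[of "cube_borel n"] by (simp only: space_cube_borel)
  have "rectangle (Suc n) (cube n) {0, 1} = {y \<in> cube (Suc n). y n \<in> {0, 1}}"
  proof -
    have "restrict y {..<n} \<in> cube n" if "y \<in> cube (Suc n)" for y
      using that by (auto simp: cube_def PiE_iff)
    then show ?thesis unfolding rectangle_def diff_Suc_1 by blast
  qed
  then have "emeasure (kernel_prod n ?M ?K) (rectangle (Suc n) (cube n) {0, 1}) = emeasure lborel {0, 1::real}"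
    unfolding conditional_kernelD(2)[OF copula_radial_copula ck] by (simp only: copula_margin[OF copula_radial_copula _ F] lessI)
  also have "\<dots> = 0" by (rule emeasure_lborel_countable) simp
  finally have "(\<integral>\<^sup>+x\<in>cube n. emeasure (?K x) {0, 1} \<partial>?M) = 0"
    by (simp only: k.emeasure_kernel_prod_rectangle[OF E F])
  moreover have "(\<integral>\<^sup>+x\<in>cube n. emeasure (?K x) {0, 1} \<partial>?M) = (\<integral>\<^sup>+x. emeasure (?K x) {0, 1} \<partial>?M)"
    by (rule nn_integral_cong) (simp add: k.space_M)
  ultimately have "AE x in ?M. emeasure (?K x) {0, 1} = 0"
    by (simp only: nn_integral_0_iff_AE[OF k.emeasure_K_measurable[OF F]])
  moreover have "AE x in ?M. ?K x = gap_kernel (level x)"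
    by (rule kernel_AE_unique[OF copula_radial_copula ck conditional_kernel_gap])
  moreover have "AE x in ?M. x \<in> cube n" by (rule AE_I2) (simp only: k.space_M)
  ultimately show ?thesis
  proof eventually_elim
    case (elim x)
    show ?case
    proof
      fix y :: real
      consider "y \<notin> {0..1}" | "y \<in> {0, 1}" | "0 < y" "y < 1" by fastforce
      then show "emeasure (?K x) {y} = 0"
      proof cases
        case 1
        then have "{y} \<notin> sets (?K x)"
          using sets.sets_into_space[of "{y}" "?K x"] unfolding k.KD(3)[OF elim(3)] by blast
        then show ?thesis by (rule emeasure_notin_sets)
      next
        case 2
        have "emeasure (?K x) {y} \<le> emeasure (?K x) {0, 1}"
          by (rule emeasure_mono) (use 2 in blast, simp only: k.KD(2)[OF elim(3)] F)
        then show ?thesis using elim(1) by simp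
      next
        case 3
        then show ?thesis unfolding elim(2) by (rule gap_kernel_atomless[OF atomless])
      qed
    qed
  qed
qed

lemma radial_copula_measurable: "radial_copula n \<nu> \<in> borel_measurable (cube_borel (Suc n))"
proof -
  have "{x \<in> space (cube_borel (Suc n)). \<exists>i\<in>{..<Suc n}. x i \<in> {0}} \<in> sets (cube_borel (Suc n))"
    by (rule sets.sets_Collect_finite_Ex) (unfold space_cube_borel, intro sets_coord_in, simp_all)
  then have S: "{x \<in> space (cube_borel (Suc n)). \<exists>i<Suc n. x i = 0} \<in> sets (cube_borel (Suc n))"
    by (simp only: Bex_def lessThan_iff singleton_iff)
  have "(\<lambda>x. \<Sum>i\<in>{..<Suc n}. gen_inv (williamson n \<nu>) (x i)) \<in> borel_measurable (cube_borel (Suc n))"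
    by (intro borel_measurable_sum measurable_compose[OF coord_measurable gen_inv_measurable]) simp
  then have "(\<lambda>x. williamson n \<nu> (\<Sum>i<Suc n. gen_inv (williamson n \<nu>) (x i))) \<in> borel_measurable (cube_borel (Suc n))"
    by (rule measurable_compose[OF _ williamson_measurable])
  then have "(\<lambda>x. if \<exists>i<Suc n. x i = 0 then 0 else williamson n \<nu> (\<Sum>i<Suc n. gen_inv (williamson n \<nu>) (x i)))
      \<in> borel_measurable (cube_borel (Suc n))"
    by (intro measurable_If S measurable_const) simp_all
  then have "arch (williamson n \<nu>) (Suc n) \<in> borel_measurable (cube_borel (Suc n))" by (simp only: arch_def[abs_def])
  moreover have "radial_copula n \<nu> x = arch (williamson n \<nu>) (Suc n) x" if "x \<in> space (cube_borel (Suc n))" for x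
    using that by (intro radial_copula_eq) (simp only: space_cube_borel)
  ultimately show ?thesis by (subst measurable_cong) auto
qed

lemma sets_radial_copula: "F \<in> sets borel \<Longrightarrow> {u \<in> cube (Suc n). radial_copula n \<nu> u \<in> F} \<in> sets (cube_borel (Suc n))"
  using measurable_sets[OF radial_copula_measurable, of F]
  by (simp only: space_cube_borel vimage_def Int_def mem_Collect_eq conj_commute)

text \<open>At a random point with the copula as distribution function, the copula takes the value
  \<open>williamson n \<nu> R\<close>: applying \<open>arch\<close> to the transformed coordinates
  gives the transform of their sum, which is \<open>R\<close>.\<close>

lemma measure_level:
  assumes F: "F \<in> sets borel"
  shows "measure (copula_law n \<nu>) {u \<in> cube (Suc n). radial_copula n \<nu> u \<in> F} = measure \<nu> {r. williamson n \<nu> r \<in> F}"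
proof -
  let ?f = "\<lambda>x. \<lambda>i\<in>{..<Suc n}. williamson n \<nu> (x i)"
  let ?A = "{u \<in> cube (Suc n). radial_copula n \<nu> u \<in> F}"
  let ?R = "\<lambda>x. \<Sum>i<Suc n. x i :: real"
  have R: "?R \<in> borel_measurable (l1_law n \<nu>)"
  proof -
    have "(\<lambda>x. \<Sum>i\<in>{..<Suc n}. x i) \<in> rborel (Suc n) \<rightarrow>\<^sub>M borel"
      by (intro borel_measurable_sum measurable_component_singleton)
    then show ?thesis by (simp only: measurable_cong_sets[OF sets_l1_law refl])
  qed
  have G: "{r. williamson n \<nu> r \<in> F} \<in> sets borel"
    using measurable_sets[OF williamson_measurable F] by (simp add: vimage_def)
  have "measure (copula_law n \<nu>) ?A = measure (l1_law n \<nu>) (?f -` ?A \<inter> space (l1_law n \<nu>))"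
    unfolding copula_law_def by (rule measure_distr[OF copula_law_measurable sets_radial_copula[OF F]])
  also have "\<dots> = measure (l1_law n \<nu>) (?R -` {r. williamson n \<nu> r \<in> F} \<inter> space (l1_law n \<nu>))"
  proof (rule measure_eq_AE)
    show "AE x in l1_law n \<nu>. x \<in> ?f -` ?A \<inter> space (l1_law n \<nu>) \<longleftrightarrow> x \<in> ?R -` {r. williamson n \<nu> r \<in> F} \<inter> space (l1_law n \<nu>)"
      using AE_l1_law_nonneg
    proof eventually_elim
      case (elim x)
      have c: "?f x \<in> cube (Suc n)" by (rule psi_cube) (use elim in blast)
      have "radial_copula n \<nu> (?f x) = arch (williamson n \<nu>) (Suc n) (?f x)" by (rule radial_copula_eq[OF c])
      also have "\<dots> = williamson n \<nu> (?R x)" by (rule arch_psi) (use elim in blast)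
      finally show ?case using c by simp
    qed
    show "?f -` ?A \<inter> space (l1_law n \<nu>) \<in> sets (l1_law n \<nu>)"
      by (rule measurable_sets[OF copula_law_measurable sets_radial_copula[OF F]])
    show "?R -` {r. williamson n \<nu> r \<in> F} \<inter> space (l1_law n \<nu>) \<in> sets (l1_law n \<nu>)" by (rule measurable_sets[OF R G])
  qed
  also have "\<dots> = measure (distr (l1_law n \<nu>) borel ?R) {r. williamson n \<nu> r \<in> F}"
    by (rule measure_distr[OF R G, symmetric])
  finally show ?thesis by (simp only: distr_l1_law_sum)
qed

text \<open>A positive value of the copula determines the sum of inverses, and the first
  \<open>n\<close> coordinates then determine the last. Each positive level set thus meets a fibre
  in at most one point and is a Lebesgue null set there.\<close>

lemma section_unique:
  assumes x: "x \<in> cube n" and y: "y \<in> {0..1}" "y' \<in> {0..1}"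
    and eq: "radial_copula n \<nu> (x(n := y)) = radial_copula n \<nu> (x(n := y'))" and pos: "0 < radial_copula n \<nu> (x(n := y))"
  shows "y = y'"
proof -
  have c: "x(n := v) \<in> cube (Suc n)" if "v \<in> {0..1}" for v
    using x that by (auto simp: cube_def PiE_iff extensional_def less_Suc_eq)
  note cc = radial_copula_eq[OF c[OF y(1)]] radial_copula_eq[OF c[OF y(2)]]
  have p: "0 < arch (williamson n \<nu>) (Suc n) (x(n := y))" "0 < arch (williamson n \<nu>) (Suc n) (x(n := y'))"
    using pos eq unfolding cc by simp_all
  have pos_y: "0 < y" "0 < y'"
    using arch_positive(1)[OF c[OF y(1)] p(1), of n] arch_positive(1)[OF c[OF y(2)] p(2), of n] by simp_all
  have sum: "(\<Sum>i<Suc n. gen_inv (williamson n \<nu>) ((x(n := v)) i)) = (\<Sum>i<n. gen_inv (williamson n \<nu>) (x i)) + gen_inv (williamson n \<nu>) v" for v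
    by (simp add: lessThan_Suc)
  have "(\<Sum>i<Suc n. gen_inv (williamson n \<nu>) ((x(n := y)) i)) = (\<Sum>i<Suc n. gen_inv (williamson n \<nu>) ((x(n := y')) i))"
    using arch_positive(3)[OF c[OF y(1)] p(1)] arch_positive(3)[OF c[OF y(2)] p(2)] eq unfolding cc by simp
  then have "gen_inv (williamson n \<nu>) y = gen_inv (williamson n \<nu>) y'" unfolding sum by simp
  moreover have "williamson n \<nu> (gen_inv (williamson n \<nu>) y) = y" "williamson n \<nu> (gen_inv (williamson n \<nu>) y') = y'"
    using y pos_y by (auto intro!: gen_inv(2))
  ultimately show "y = y'" by metis
qed

end

section \<open>The product of the margin with Lebesgue measure\<close>

lemma down_top: "{y \<in> cube d. \<forall>i<d. y i \<le> (\<lambda>i\<in>{..<d}. 1) i} = cube d"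
proof -
  have "y i \<le> (\<lambda>i\<in>{..<d}. 1) i" if "y \<in> cube d" "i < d" for y i
    using cubeD[OF that] that(2) by simp
  then show ?thesis by blast
qed

definition margin_lebesgue :: "nat \<Rightarrow> ((nat \<Rightarrow> real) \<Rightarrow> real) \<Rightarrow> (nat \<Rightarrow> real) measure" where
  "margin_lebesgue n C = kernel_prod n (margin_measure n C) (\<lambda>_. unit_lebesgue)"

lemma margin_lebesgue_kernel:
  assumes "copula (Suc n) C"
  shows "kernel_over n (margin_measure n C) (\<lambda>_. unit_lebesgue)"
proof (rule kernel_over.intro)
  note hm = has_distribution_functionD[OF margin_measure_distribution(1)[OF assms]]
  show "prob_space (margin_measure n C)" "sets (margin_measure n C) = sets (cube_borel n)"
    by (rule hm)+
  show "(\<lambda>_. unit_lebesgue) \<in> cube_borel n \<rightarrow>\<^sub>M prob_algebra unit_borel"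
    by (rule measurable_const[OF unit_lebesgue_prob])
qed

text \<open>The explicit distribution function shows that the reference measure, although it varies
  with the copula, varies continuously, so the cell estimates apply to it as well.\<close>

lemma margin_lebesgue_distribution:
  assumes C: "copula (Suc n) C"
  shows "has_distribution_function (Suc n) (margin_lebesgue n C) (\<lambda>x. C (x(n := 1)) * x n)"
  unfolding has_distribution_function_def
proof (intro conjI ballI)
  interpret k: kernel_over n "margin_measure n C" "\<lambda>_. unit_lebesgue" by (rule margin_lebesgue_kernel[OF C])
  note hm = has_distribution_functionD[OF margin_measure_distribution(1)[OF C]]
  show s: "sets (margin_lebesgue n C) = sets (cube_borel (Suc n))" unfolding margin_lebesgue_def by (rule k.sets_kernel_prod)
  have val: "emeasure (margin_lebesgue n C) {y \<in> cube (Suc n). \<forall>i<Suc n. y i \<le> x i} = ennreal (C (x(n := 1)) * x n)"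
    if x: "x \<in> cube (Suc n)" for x
  proof -
    let ?E = "{y \<in> cube n. \<forall>i<n. y i \<le> x i}"
    let ?x = "restrict x {..<n}"
    have xn: "0 \<le> x n" "x n \<le> 1" using cubeD[OF x, of n] by simp_all
    have x': "?x \<in> cube n" using x by (auto simp: cube_def PiE_iff)
    have upd: "?x(n := 1) = x(n := 1)" using x by (auto simp: cube_def PiE_iff extensional_def fun_eq_iff)
    have F: "{0..x n} \<in> sets unit_borel" using xn by (rule Icc_unit_borel)
    have lF: "emeasure unit_lebesgue {0..x n} = ennreal (x n)"
      using xn by (subst emeasure_restrict_space) auto
    have "?x i = x i" if "i < n" for i using that by simp
    then have E: "{y \<in> cube n. \<forall>i<n. y i \<le> ?x i} = ?E" by (intro Collect_cong) metis
    have "first_margin (Suc n) C ?x = C (x(n := 1))"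
      by (simp only: first_margin_def diff_Suc_1 restrict_apply'[OF x'] upd)
    then have "measure (margin_measure n C) ?E = C (x(n := 1))"
      using hm(4)[OF x'] by (simp only: E)
    then have mE: "emeasure (margin_measure n C) ?E = ennreal (C (x(n := 1)))"
      by (simp only: k.emeasure_eq_measure)
    have ES: "?E \<in> sets (margin_measure n C)" unfolding hm(2) by (rule sets_down)
    have "emeasure (margin_lebesgue n C) {y \<in> cube (Suc n). \<forall>i<Suc n. y i \<le> x i} =
        (\<integral>\<^sup>+x'\<in>?E. ennreal (x n) \<partial>margin_measure n C)"
      unfolding down_rectangle[OF x] margin_lebesgue_def k.emeasure_kernel_prod_rectangle[OF sets_down F] lF ..
    also have "\<dots> = ennreal (x n) * ennreal (C (x(n := 1)))"
      by (subst nn_integral_cmult_indicator[OF ES]) (simp only: mE)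
    also have "\<dots> = ennreal (C (x(n := 1)) * x n)"
      using xn by (simp add: ennreal_mult' mult.commute)
    finally show ?thesis .
  qed
  have one: "(\<lambda>i\<in>{..<Suc n}. 1::real) \<in> cube (Suc n)" by (simp add: cube_def)
  have C1: "C (\<lambda>i\<in>{..<Suc n}. 1) = 1"
  proof -
    note hd = has_distribution_functionD[OF copula_measureD(1)[OF C]]
    show ?thesis using hd(4)[OF one] prob_space.prob_space[OF hd(1)] by (simp only: down_top hd(3))
  qed
  show "prob_space (margin_lebesgue n C)"
  proof (rule prob_spaceI)
    have "space (margin_lebesgue n C) = {y \<in> cube (Suc n). \<forall>i<Suc n. y i \<le> (\<lambda>i\<in>{..<Suc n}. 1) i}"
      unfolding down_top using sets_eq_imp_space_eq[OF s] by (simp only: space_cube_borel)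
    moreover have "(\<lambda>i\<in>{..<Suc n}. 1::real)(n := 1) = (\<lambda>i\<in>{..<Suc n}. 1)" by (auto simp: fun_eq_iff)
    ultimately show "emeasure (margin_lebesgue n C) (space (margin_lebesgue n C)) = 1" using val[OF one] C1 by simp
  qed
  fix x assume x: "x \<in> cube (Suc n)"
  have "0 \<le> C (x(n := 1)) * x n"
  proof (intro mult_nonneg_nonneg)
    have "x(n := 1) \<in> cube (Suc n)" using x by (auto simp: cube_def PiE_iff extensional_def)
    then show "0 \<le> C (x(n := 1))" by (rule copula_bounds[OF C])
    show "0 \<le> x n" using cubeD[OF x, of n] by simp
  qed
  then show "C (x(n := 1)) * x n = measure (margin_lebesgue n C) {y \<in> cube (Suc n). \<forall>i<Suc n. y i \<le> x i}"
    unfolding measure_def val[OF x] by simp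
qed

text \<open>A small Erlang component bounds the transform below by \<open>q * exp (- z)\<close> on
  positive arguments and contributes its positive mass to every box.\<close>

lemma positive_approximation:
  assumes "radial n \<nu>" and e: "0 < e"
  obtains \<nu>' where "radial n \<nu>'" "\<And>z. \<bar>williamson n \<nu> z - williamson n \<nu>' z\<bar> \<le> e" "\<And>z. 0 < williamson n \<nu>' z"
    "\<And>a b. (\<And>i. i < Suc n \<Longrightarrow> 0 \<le> a i \<and> a i < b i) \<Longrightarrow> 0 < emeasure (l1_law n \<nu>') (rbox (Suc n) a b)"
proof -
  interpret radial n \<nu> by fact
  define q where "q = min e 1"
  have q: "0 < q" "q \<le> e" "q \<le> 1" using e by (auto simp: q_def)
  interpret t: two_radial n \<nu> "erlang n" q
  proof (rule two_radial.intro[OF assms(1) radial_erlang[OF n]], rule two_radial_axioms.intro)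
    show "0 \<le> q" "q \<le> 1" using q by simp_all
  qed
  interpret m: radial n "mix q \<nu> (erlang n)" by (rule t.radial_mix)
  have "\<bar>williamson n \<nu> z - williamson n (mix q \<nu> (erlang n)) z\<bar> \<le> e" for z using t.williamson_mix_close[of z] q by linarith
  moreover have "0 < williamson n (mix q \<nu> (erlang n)) z" for z
  proof (cases "z \<le> 0")
    case False
    have "0 < q * exp (- z)" using q by simp
    also have "\<dots> \<le> (1 - q) * williamson n \<nu> z + q * williamson n (erlang n) z"
    proof -
      have "0 \<le> (1 - q) * williamson n \<nu> z" using q williamson_bounds(1) by (intro mult_nonneg_nonneg) auto
      moreover have "williamson n (erlang n) z = exp (- z)" using False by (intro williamson_erlang[OF n]) simp
      ultimately show ?thesis by simp
    qed
    finally show ?thesis by (simp only: t.williamson_mix)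
  qed (simp add: m.williamson_nonpos)
  moreover have "0 < emeasure (l1_law n (mix q \<nu> (erlang n))) (rbox (Suc n) a b)"
    if ab: "\<And>i. i < Suc n \<Longrightarrow> 0 \<le> a i \<and> a i < b i" for a b
  proof -
    have "0 < emeasure (l1_law n (erlang n)) (rbox (Suc n) a b)" by (rule l1_law_erlang_box_pos[OF n ab])
    then have "0 < ennreal q * emeasure (l1_law n (erlang n)) (rbox (Suc n) a b)"
      using q by (subst ennreal_zero_less_mult_iff) simp
    also have "\<dots> \<le> emeasure (l1_law n (mix q \<nu> (erlang n))) (rbox (Suc n) a b)"
      by (rule t.emeasure_l1_law_mix[OF sets_rbox])
    finally show ?thesis .
  qed
  ultimately show ?thesis by (rule that[OF t.radial_mix])
qed

text \<open>Mixing comes before smoothing: smoothing only increases the transform, so positivity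
  survives. Positivity makes the transform injective on the half-line, so that a level corresponds
  to at most one positive radius. Each of the two changes uses half of the tolerance.\<close>

lemma atomless_approximation:
  assumes "radial n \<nu>" and e: "0 < e"
  obtains \<nu>' where "radial n \<nu>'" "\<And>z. 0 \<le> z \<Longrightarrow> \<bar>williamson n \<nu> z - williamson n \<nu>' z\<bar> \<le> e" "\<And>z. 0 < williamson n \<nu>' z"
    "\<And>r. emeasure \<nu>' {r} = 0"
proof -
  obtain \<nu>1 where 1: "radial n \<nu>1" "\<And>z. \<bar>williamson n \<nu> z - williamson n \<nu>1 z\<bar> \<le> e / 2" "\<And>z. 0 < williamson n \<nu>1 z"
    "\<And>a b. (\<And>i. i < Suc n \<Longrightarrow> 0 \<le> a i \<and> a i < b i) \<Longrightarrow> 0 < emeasure (l1_law n \<nu>1) (rbox (Suc n) a b)"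
  proof (rule positive_approximation[OF assms(1) half_gt_zero[OF e]], goal_cases)
    case (1 x)
    from 1(1)[OF 1(2-)] show ?case .
  qed
  interpret a: radial n \<nu>1 by (rule 1(1))
  obtain h where h: "0 < h" "\<And>z. 0 \<le> z \<Longrightarrow> williamson n \<nu>1 (z / (1 + h)) \<le> williamson n \<nu>1 z + e / 2"
  proof (rule a.scale_close[OF half_gt_zero[OF e]], goal_cases)
    case (1 x)
    from 1(1)[OF 1(2-)] show ?case .
  qed
  obtain \<nu>' where 2: "radial n \<nu>'" "\<And>r. emeasure \<nu>' {r} = 0"
    "\<And>z. 0 \<le> z \<Longrightarrow> williamson n \<nu>1 z \<le> williamson n \<nu>' z" "\<And>z. 0 \<le> z \<Longrightarrow> williamson n \<nu>' z \<le> williamson n \<nu>1 (z / (1 + h))"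
  proof (rule smoothing[OF 1(1) h(1)], goal_cases)
    case (1 x)
    from 1(1)[OF 1(2-)] show ?case .
  qed
  interpret b: radial n \<nu>' by (rule 2(1))
  have "\<bar>williamson n \<nu> z - williamson n \<nu>' z\<bar> \<le> e" if "0 \<le> z" for z
    using 1(2)[of z] h(2)[OF that] 2(3,4)[OF that] by linarith
  moreover have "0 < williamson n \<nu>' z" for z
  proof (cases "0 \<le> z")
    case True
    then show ?thesis using 1(3)[of z] 2(3)[OF True] by linarith
  next
    case False
    then show ?thesis using b.williamson_nonpos[of z] by simp
  qed
  ultimately show ?thesis by (rule that[OF 2(1) _ _ 2(2)])
qed

text \<open>Positivity of the transform survives rounding up, so every level that carries mass is
  positive, as \<open>section_unique\<close> demands.\<close>

lemma discrete_approximation: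
  assumes "radial n \<nu>" and e: "0 < e"
  obtains \<nu>' S where "radial n \<nu>'" "\<And>z. 0 \<le> z \<Longrightarrow> \<bar>williamson n \<nu> z - williamson n \<nu>' z\<bar> \<le> e" "\<And>z. 0 < williamson n \<nu>' z"
    "countable S" "S \<subseteq> {0<..}" "emeasure \<nu>' S = 1"
proof -
  obtain \<nu>1 where 1: "radial n \<nu>1" "\<And>z. \<bar>williamson n \<nu> z - williamson n \<nu>1 z\<bar> \<le> e / 2" "\<And>z. 0 < williamson n \<nu>1 z"
    "\<And>a b. (\<And>i. i < Suc n \<Longrightarrow> 0 \<le> a i \<and> a i < b i) \<Longrightarrow> 0 < emeasure (l1_law n \<nu>1) (rbox (Suc n) a b)"
  proof (rule positive_approximation[OF assms(1) half_gt_zero[OF e]], goal_cases)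
    case (1 x)
    from 1(1)[OF 1(2-)] show ?case .
  qed
  interpret a: radial n \<nu>1 by (rule 1(1))
  obtain h where h: "0 < h" "\<And>z. 0 \<le> z \<Longrightarrow> williamson n \<nu>1 (z / (1 + h)) \<le> williamson n \<nu>1 z + e / 2"
  proof (rule a.scale_close[OF half_gt_zero[OF e]], goal_cases)
    case (1 x)
    from 1(1)[OF 1(2-)] show ?case .
  qed
  obtain \<nu>' S where 2: "radial n \<nu>'" "countable S" "S \<subseteq> {0<..}" "emeasure \<nu>' S = 1"
    "\<And>z. 0 \<le> z \<Longrightarrow> williamson n \<nu>1 z \<le> williamson n \<nu>' z" "\<And>z. 0 \<le> z \<Longrightarrow> williamson n \<nu>' z \<le> williamson n \<nu>1 (z / (1 + h))"
  proof (rule discretizing[OF 1(1) h(1)], goal_cases)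
    case (1 x y)
    from 1(1)[OF 1(2-)] show ?case .
  qed
  interpret b: radial n \<nu>' by (rule 2(1))
  have "\<bar>williamson n \<nu> z - williamson n \<nu>' z\<bar> \<le> e" if "0 \<le> z" for z
    using 1(2)[of z] h(2)[OF that] 2(5,6)[OF that] by linarith
  moreover have "0 < williamson n \<nu>' z" for z
  proof (cases "0 \<le> z")
    case True
    then show ?thesis using 1(3)[of z] 2(5)[OF True] by linarith
  next
    case False
    then show ?thesis using b.williamson_nonpos[of z] by simp
  qed
  ultimately show ?thesis by (rule that[OF 2(1) _ _ 2(2-4)])
qed

section \<open>Distance estimates for cell masses and radial copulas\<close>

lemma archE:
  assumes "n \<ge> 1" "C \<in> archimedean_copulas (Suc n)"
  shows "\<exists>\<nu>. radial n \<nu> \<and> C = radial_copula n \<nu>"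
proof (rule archimedean_representation[OF assms], goal_cases)
  case (1 \<nu>)
  then show ?case by blast
qed

lemma arch_copula: "C \<in> archimedean_copulas d \<Longrightarrow> copula d C"
  by (simp add: archimedean_copulas_def)

abbreviation in_cells :: "nat \<Rightarrow> nat \<Rightarrow> (nat \<Rightarrow> int) set \<Rightarrow> (nat \<Rightarrow> real) set" where
  "in_cells d N K \<equiv> {y \<in> cube d. grid d N y \<in> K}"

definition cell_const :: "nat \<Rightarrow> nat \<Rightarrow> real" where
  "cell_const d N = (2 * (real N + 1)) ^ d"

lemma cell_const_pos: "0 < cell_const d N"
  by (simp add: cell_const_def zero_less_power)

lemma copula_cells_diff:
  assumes "copula d A" "copula d B" "N > 0"
  shows "\<bar>measure (copula_measure d A) (in_cells d N K) - measure (copula_measure d B) (in_cells d N K)\<bar>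
    \<le> cell_const d N * uniform_dist d A B"
  unfolding cell_const_def
  by (rule cells_measure_diff[OF copula_measureD(1)[OF assms(1)] copula_measureD(1)[OF assms(2)] _ assms(3)])
     (rule uniform_dist_upper[OF assms(1,2)])

lemma margin_lebesgue_cells_diff:
  assumes A: "copula (Suc n) A" and B: "copula (Suc n) B" and N: "N > 0"
  shows "\<bar>measure (margin_lebesgue n A) (in_cells (Suc n) N K) - measure (margin_lebesgue n B) (in_cells (Suc n) N K)\<bar>
    \<le> cell_const (Suc n) N * uniform_dist (Suc n) A B"
  unfolding cell_const_def
proof (rule cells_measure_diff[OF margin_lebesgue_distribution[OF A] margin_lebesgue_distribution[OF B] _ N])
  fix x assume x: "x \<in> cube (Suc n)"
  have x1: "x(n := 1) \<in> cube (Suc n)" using x by (auto simp: cube_def PiE_iff extensional_def)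
  have xn: "0 \<le> x n" "x n \<le> 1" using cubeD[OF x, of n] by simp_all
  have "\<bar>A (x(n := 1)) * x n - B (x(n := 1)) * x n\<bar> = \<bar>A (x(n := 1)) - B (x(n := 1))\<bar> * x n"
    using xn by (simp add: abs_mult flip: left_diff_distrib)
  also have "\<dots> \<le> \<bar>A (x(n := 1)) - B (x(n := 1))\<bar>" using xn by (intro mult_left_le) auto
  also have "\<dots> \<le> uniform_dist (Suc n) A B" by (rule uniform_dist_upper[OF A B x1])
  finally show "\<bar>A (x(n := 1)) * x n - B (x(n := 1)) * x n\<bar> \<le> uniform_dist (Suc n) A B" .
qed

text \<open>The denominator \<open>n + 3\<close> exceeds the factor \<open>n + 2\<close> of
  \<open>radial_copula_dist_le\<close>, which makes the bound strict.\<close>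

lemma close_radial:
  assumes "radial n \<nu>" "radial n \<nu>'" and e: "0 < e"
    and close: "\<And>z. 0 \<le> z \<Longrightarrow> \<bar>williamson n \<nu> z - williamson n \<nu>' z\<bar> \<le> e / real (n + 3)"
  shows "uniform_dist (Suc n) (radial_copula n \<nu>) (radial_copula n \<nu>') < e"
proof -
  have "uniform_dist (Suc n) (radial_copula n \<nu>) (radial_copula n \<nu>') \<le> real (n + 2) * (e / real (n + 3))"
    by (rule radial_copula_dist_le[OF assms(1,2) close])
  also have "\<dots> < e" using e by (simp add: field_simps)
  finally show ?thesis .
qed

section \<open>Nowhere dense sets of copulas\<close>

definition empty_cell :: "nat \<Rightarrow> nat \<Rightarrow> (nat \<Rightarrow> int) \<Rightarrow> ((nat \<Rightarrow> real) \<Rightarrow> real) set" where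
  "empty_cell n N k = {C \<in> archimedean_copulas (Suc n).
     measure (copula_measure (Suc n) C) (in_cells (Suc n) N {k}) = 0}"

definition heavy_level :: "nat \<Rightarrow> real \<Rightarrow> ((nat \<Rightarrow> real) \<Rightarrow> real) set" where
  "heavy_level n q = {C \<in> archimedean_copulas (Suc n).
     \<exists>t. q \<le> measure (copula_measure (Suc n) C) {u \<in> cube (Suc n). C u = t}}"

text \<open>Copulas without a witness of near-singularity at scale \<open>q\<close>. Witnesses are
  unions of grid cells rather than arbitrary Borel sets, because the masses of cells depend
  continuously on the copula.\<close>

definition spread :: "nat \<Rightarrow> real \<Rightarrow> ((nat \<Rightarrow> real) \<Rightarrow> real) set" where
  "spread n q = {C \<in> archimedean_copulas (Suc n). \<forall>N>0. \<forall>K.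
     measure (margin_lebesgue n C) (in_cells (Suc n) N K) < q \<longrightarrow>
     measure (copula_measure (Suc n) C) (in_cells (Suc n) N K) \<le> 1 - q}"

abbreviation arch_top :: "nat \<Rightarrow> ((nat \<Rightarrow> real) \<Rightarrow> real) topology" where
  "arch_top d \<equiv> Metric_space.mtopology (archimedean_copulas d) (uniform_dist d)"

text \<open>Indices start at 1 because a cell with an index 0 lies in a face of the cube and is null
  for every copula.\<close>

lemma nowhere_dense_empty_cell:
  assumes n: "n \<ge> 1" and N: "N > 0" and k: "k \<in> {..<Suc n} \<rightarrow>\<^sub>E {1..int N}"
  shows "nowhere_dense_in (arch_top (Suc n)) (empty_cell n N k)"
proof (rule nowhere_dense_inI[OF Metric_space_archimedean_copulas])
  show "empty_cell n N k \<subseteq> archimedean_copulas (Suc n)" by (auto simp: empty_cell_def)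
next
  fix C assume C: "C \<in> archimedean_copulas (Suc n)"
    and adh: "\<And>e. 0 < e \<Longrightarrow> \<exists>B\<in>empty_cell n N k. uniform_dist (Suc n) C B < e"
  let ?m = "measure (copula_measure (Suc n) C) (in_cells (Suc n) N {k})"
  have "?m \<le> 0 + e" if e: "0 < e" for e
  proof -
    obtain B where B: "B \<in> empty_cell n N k" "uniform_dist (Suc n) C B < e / cell_const (Suc n) N"
      using adh[of "e / cell_const (Suc n) N"] e cell_const_pos by (auto simp: divide_pos_pos)
    then have B': "B \<in> archimedean_copulas (Suc n)" "measure (copula_measure (Suc n) B) (in_cells (Suc n) N {k}) = 0"
      by (auto simp: empty_cell_def)
    have "?m \<le> cell_const (Suc n) N * uniform_dist (Suc n) C B"
      using copula_cells_diff[OF arch_copula[OF C] arch_copula[OF B'(1)] N, of "{k}"] B'(2) by simp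
    also have "\<dots> \<le> e" using B(2) cell_const_pos[of "Suc n" N] by (simp add: pos_less_divide_eq mult.commute)
    finally show ?thesis by simp
  qed
  then have "?m \<le> 0" by (rule field_le_epsilon)
  then have "?m = 0" by (simp add: measure_le_0_iff)
  then show "C \<in> empty_cell n N k" using C unfolding empty_cell_def by blast
next
  fix C e assume C: "C \<in> empty_cell n N k" and e: "(0::real) < e"
  then have "C \<in> archimedean_copulas (Suc n)" by (simp add: empty_cell_def)
  then obtain \<nu> where \<nu>: "radial n \<nu>" "C = radial_copula n \<nu>" using archE[OF n] by blast
  have e': "0 < e / real (n + 3)" using e by simp
  show "\<exists>B\<in>archimedean_copulas (Suc n) - empty_cell n N k. uniform_dist (Suc n) C B < e"
  proof (rule positive_approximation[OF \<nu>(1) e'], goal_cases)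
    case (1 \<nu>')
    interpret b: radial n \<nu>' by (rule 1(1))
    have "0 < measure (copula_law n \<nu>') {y \<in> cube (Suc n). grid (Suc n) N y = k}"
      by (rule b.copula_law_cell_pos[OF 1(4) 1(3) N k])
    then have "radial_copula n \<nu>' \<notin> empty_cell n N k" by (simp add: empty_cell_def b.copula_measure_radial_copula)
    moreover have "uniform_dist (Suc n) C (radial_copula n \<nu>') < e"
      unfolding \<nu>(2) by (rule close_radial[OF \<nu>(1) 1(1) e 1(2)])
    ultimately show ?case using b.radial_copula_archimedean by blast
  qed
qed

text \<open>Closedness is the delicate point, as the heavy level varies with the approximating
  copula and the mass of a level set is not continuous. Level sets are enlarged to unions of cells,
  which lie in thin bands of \<open>C\<close>; compactness of the unit interval provides a limit
  level, and the bands shrink to its level set.\<close>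

lemma nowhere_dense_heavy_level:
  assumes n: "n \<ge> 1" and q: "0 < q"
  shows "nowhere_dense_in (arch_top (Suc n)) (heavy_level n q)"
proof (rule nowhere_dense_inI[OF Metric_space_archimedean_copulas])
  show "heavy_level n q \<subseteq> archimedean_copulas (Suc n)" by (auto simp: heavy_level_def)
next
  fix C assume C: "C \<in> archimedean_copulas (Suc n)"
    and adh: "\<And>e. 0 < e \<Longrightarrow> \<exists>B\<in>heavy_level n q. uniform_dist (Suc n) C B < e"
  obtain \<nu> where \<nu>: "radial n \<nu>" "C = radial_copula n \<nu>" using archE[OF n C] by blast
  interpret c: radial n \<nu> by (rule \<nu>(1))
  let ?M = "copula_measure (Suc n) C"
  note hd = has_distribution_functionD[OF copula_measureD(1)[OF arch_copula[OF C]]]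
  interpret M: prob_space ?M by (rule hd(1))
  have SC: "{u \<in> cube (Suc n). C u \<in> F} \<in> sets ?M" if "F \<in> sets borel" for F
    using c.sets_radial_copula[OF that] by (simp only: hd(2) \<nu>(2)[symmetric])
  define L where "L t r = {u \<in> cube (Suc n). C u \<in> {t - r..t + r}}" for t r
  have SL: "L t r \<in> sets ?M" for t r unfolding L_def by (rule SC) simp
  have "\<exists>t\<in>{0..1}. q - 1 / real (Suc N) \<le> measure ?M (L t (real (n + 2) / real (Suc N)))" for N
  proof -
    let ?c = "cell_const (Suc n) (Suc N)"
    \<comment> \<open>Chosen so that both the uniform distance and the resulting error in cell
      masses are at most \<open>1 / (N + 1)\<close>.\<close>
    define e where "e = min 1 (1 / ?c) / real (Suc N)"
    have e: "0 < e" "e \<le> 1 / real (Suc N)" "?c * e \<le> 1 / real (Suc N)"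
    proof -
      show "0 < e" using cell_const_pos[of "Suc n" "Suc N"] by (simp add: e_def)
      show "e \<le> 1 / real (Suc N)" unfolding e_def by (rule divide_right_mono) simp_all
      have "?c * min 1 (1 / ?c) \<le> ?c * (1 / ?c)" using cell_const_pos[of "Suc n" "Suc N"] by (intro mult_left_mono) auto
      also have "\<dots> = 1" using cell_const_pos[of "Suc n" "Suc N"] by simp
      finally have "?c * min 1 (1 / ?c) / real (Suc N) \<le> 1 / real (Suc N)" by (rule divide_right_mono) simp
      then show "?c * e \<le> 1 / real (Suc N)" by (simp add: e_def)
    qed
    obtain B where B: "B \<in> heavy_level n q" "uniform_dist (Suc n) C B < e" using adh[OF e(1)] by blast
    then obtain t where B': "B \<in> archimedean_copulas (Suc n)"
      and t: "q \<le> measure (copula_measure (Suc n) B) {u \<in> cube (Suc n). B u = t}"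
      by (auto simp: heavy_level_def)
    note cB = arch_copula[OF B'] and cC = arch_copula[OF C]
    note hB = has_distribution_functionD[OF copula_measureD(1)[OF cB]]
    interpret P: prob_space "copula_measure (Suc n) B" by (rule hB(1))
    let ?T = "{u \<in> cube (Suc n). B u = t}"
    let ?G = "in_cells (Suc n) (Suc N) (grid (Suc n) (Suc N) ` ?T)"
    \<comment> \<open>A level set of positive mass is nonempty, so \<open>t\<close> is a value of a
      copula and lies in the compact unit interval.\<close>
    have "?T \<noteq> {}" using t q by (metis measure_empty not_le)
    then obtain v where v: "v \<in> cube (Suc n)" "B v = t" by blast
    have t01: "t \<in> {0..1}" using copula_bounds[OF cB v(1)] v(2) by simp
    have "q \<le> measure (copula_measure (Suc n) B) ?G"
    proof (rule order_trans[OF t P.finite_measure_mono])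
      show "?T \<subseteq> ?G" by blast
      show "?G \<in> P.events" unfolding hB(2) by (rule sets_grid)
    qed
    moreover have "\<bar>measure ?M ?G - measure (copula_measure (Suc n) B) ?G\<bar> \<le> ?c * uniform_dist (Suc n) C B"
      by (rule copula_cells_diff[OF cC cB]) simp
    moreover have "?c * uniform_dist (Suc n) C B \<le> ?c * e"
      using B(2) cell_const_pos[of "Suc n" "Suc N"] by (intro mult_left_mono) auto
    ultimately have "q - 1 / real (Suc N) \<le> measure ?M ?G" using e(3) by linarith
    also have "\<dots> \<le> measure ?M (L t (real (n + 2) / real (Suc N)))"
    proof (rule M.finite_measure_mono[OF _ SL])
      show "?G \<subseteq> L t (real (n + 2) / real (Suc N))"
      proof
        fix u assume u: "u \<in> ?G"
        then obtain w where w: "w \<in> cube (Suc n)" "B w = t" "grid (Suc n) (Suc N) u = grid (Suc n) (Suc N) w" by blast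
        have uc: "u \<in> cube (Suc n)" using u by blast
        have "\<bar>C u - C w\<bar> \<le> real (Suc n) / real (Suc N)" by (rule grid_eq_copula[OF cC uc w(1) w(3)]) simp
        moreover have "\<bar>C w - B w\<bar> \<le> 1 / real (Suc N)" using uniform_dist_upper[OF cC cB w(1)] B(2) e(2) by linarith
        \<comment> \<open>Half the width of the band: \<open>(n + 1) / (N + 1)\<close> for the
          oscillation of \<open>C\<close> on a cell, plus \<open>1 / (N + 1)\<close> for the
          distance of \<open>C\<close> to \<open>B\<close>.\<close>
        moreover have "real (Suc n) / real (Suc N) + 1 / real (Suc N) = real (n + 2) / real (Suc N)"
          by (simp add: add_divide_distrib[symmetric])
        ultimately have "\<bar>C u - t\<bar> \<le> real (n + 2) / real (Suc N)" using w(2) by linarith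
        then show "u \<in> L t (real (n + 2) / real (Suc N))" using uc by (auto simp: L_def)
      qed
    qed
    finally show ?thesis using t01 by blast
  qed
  then have "\<forall>N. \<exists>t. t \<in> {0..1} \<and> q - 1 / real (Suc N) \<le> measure ?M (L t (real (n + 2) / real (Suc N)))" by blast
  from choice[OF this] obtain t where t: "\<And>N. t N \<in> {0..1}"
    "\<And>N. q - 1 / real (Suc N) \<le> measure ?M (L (t N) (real (n + 2) / real (Suc N)))" by blast
  have "\<exists>l\<in>{0..1::real}. \<exists>r. strict_mono r \<and> (t \<circ> r) \<longlonglongrightarrow> l"
    using compact_Icc[of 0 "1::real"] t(1) unfolding compact_def by blast
  then obtain l r where r: "strict_mono r" "(t \<circ> r) \<longlonglongrightarrow> l" by blast
  have inv0: "(\<lambda>k. x / real (Suc (r k))) \<longlonglongrightarrow> 0" for x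
  proof -
    have "(\<lambda>k. x / real k) \<longlonglongrightarrow> 0" by (rule lim_const_over_n)
    then have "(\<lambda>k. x / real (Suc k)) \<longlonglongrightarrow> 0" by (rule LIMSEQ_Suc)
    from LIMSEQ_subseq_LIMSEQ[OF this r(1)] show ?thesis by (simp add: o_def)
  qed
  \<comment> \<open>Along the subsequence the moving bands eventually lie in any fixed band around
    \<open>l\<close>, and the loss \<open>1 / (r k + 1)\<close> in mass tends to 0.\<close>
  have big: "q \<le> measure ?M (L l (1 / real (Suc i)))" for i
  proof -
    have "(\<lambda>k. \<bar>(t \<circ> r) k - l\<bar> + real (n + 2) / real (Suc (r k))) \<longlonglongrightarrow> \<bar>l - l\<bar> + 0"
      by (intro tendsto_intros r(2) inv0)
    then have "(\<lambda>k. \<bar>t (r k) - l\<bar> + real (n + 2) / real (Suc (r k))) \<longlonglongrightarrow> 0" by simp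
    then have ev: "eventually (\<lambda>k. \<bar>t (r k) - l\<bar> + real (n + 2) / real (Suc (r k)) < 1 / real (Suc i)) sequentially"
      by (rule order_tendstoD(2)) simp
    have "(\<lambda>k. q - 1 / real (Suc (r k))) \<longlonglongrightarrow> q - 0" by (intro tendsto_intros inv0)
    then have lim: "(\<lambda>k. q - 1 / real (Suc (r k))) \<longlonglongrightarrow> q" by simp
    have "eventually (\<lambda>k. q - 1 / real (Suc (r k)) \<le> measure ?M (L l (1 / real (Suc i)))) sequentially"
      using ev
    proof eventually_elim
      case (elim k)
      have "L (t (r k)) (real (n + 2) / real (Suc (r k))) \<subseteq> L l (1 / real (Suc i))"
        using elim unfolding L_def by auto
      then have "measure ?M (L (t (r k)) (real (n + 2) / real (Suc (r k)))) \<le> measure ?M (L l (1 / real (Suc i)))"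
        by (rule M.finite_measure_mono[OF _ SL])
      then show ?case using t(2)[of "r k"] by linarith
    qed
    then show ?thesis by (intro tendsto_upperbound[OF lim]) auto
  qed
  have "(\<lambda>i. measure ?M (L l (1 / real (Suc i)))) \<longlonglongrightarrow> measure ?M (\<Inter>i. L l (1 / real (Suc i)))"
  proof (rule M.finite_Lim_measure_decseq)
    show "range (\<lambda>i. L l (1 / real (Suc i))) \<subseteq> M.events" using SL by blast
    show "decseq (\<lambda>i. L l (1 / real (Suc i)))"
      unfolding decseq_def
    proof (intro allI impI)
      fix i j :: nat assume "i \<le> j"
      then have "1 / real (Suc j) \<le> 1 / real (Suc i)" by (intro divide_left_mono) auto
      then show "L l (1 / real (Suc j)) \<subseteq> L l (1 / real (Suc i))" unfolding L_def by auto
    qed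
  qed
  then have "q \<le> measure ?M (\<Inter>i. L l (1 / real (Suc i)))"
    by (rule LIMSEQ_le_const) (use big in blast)
  also have "(\<Inter>i. L l (1 / real (Suc i))) = {u \<in> cube (Suc n). C u = l}"
  proof (intro set_eqI iffI)
    fix u assume u: "u \<in> (\<Inter>i. L l (1 / real (Suc i)))"
    have bound: "\<bar>C u - l\<bar> \<le> 1 / real (Suc i)" for i
    proof -
      have "u \<in> L l (1 / real (Suc i))" using u by blast
      then show ?thesis by (auto simp: L_def)
    qed
    have "(\<lambda>i. 1 / real (Suc i)) \<longlonglongrightarrow> 0" by (rule LIMSEQ_Suc[OF lim_1_over_n])
    then have "\<bar>C u - l\<bar> \<le> 0" by (rule LIMSEQ_le_const) (use bound in blast)
    moreover have "u \<in> L l (1 / real (Suc 0))" using u by blast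
    ultimately show "u \<in> {u \<in> cube (Suc n). C u = l}" by (simp add: L_def)
  next
    fix u assume "u \<in> {u \<in> cube (Suc n). C u = l}"
    then show "u \<in> (\<Inter>i. L l (1 / real (Suc i)))" by (simp add: L_def)
  qed
  finally show "C \<in> heavy_level n q" using C unfolding heavy_level_def by blast
next
  fix C e assume C: "C \<in> heavy_level n q" and e: "(0::real) < e"
  then have "C \<in> archimedean_copulas (Suc n)" by (simp add: heavy_level_def)
  then obtain \<nu> where \<nu>: "radial n \<nu>" "C = radial_copula n \<nu>" using archE[OF n] by blast
  have e': "0 < e / real (n + 3)" using e by simp
  show "\<exists>B\<in>archimedean_copulas (Suc n) - heavy_level n q. uniform_dist (Suc n) C B < e"
  proof (rule atomless_approximation[OF \<nu>(1) e'], goal_cases)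
    case (1 \<nu>')
    interpret b: radial n \<nu>' by (rule 1(1))
    have "measure (copula_law n \<nu>') {u \<in> cube (Suc n). radial_copula n \<nu>' u = t} = 0" for t
    proof -
      have "measure (copula_law n \<nu>') {u \<in> cube (Suc n). radial_copula n \<nu>' u = t} = measure \<nu>' {r. williamson n \<nu>' r = t}"
        using b.measure_level[of "{t}"] by simp
      \<comment> \<open>The transform is injective on positive radii, so up to a null set the level
        is a single radius or none, and the atomless law gives it no mass.\<close>
      also have "\<dots> = measure \<nu>' (if \<exists>r>0. williamson n \<nu>' r = t then {SOME r. 0 < r \<and> williamson n \<nu>' r = t} else {})"
      proof (rule measure_eq_AE)
        show "AE r in \<nu>'. r \<in> {r. williamson n \<nu>' r = t} \<longleftrightarrow>
            r \<in> (if \<exists>r>0. williamson n \<nu>' r = t then {SOME r. 0 < r \<and> williamson n \<nu>' r = t} else {})"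
          using b.pos
        proof eventually_elim
          case (elim r)
          show ?case
          proof (cases "\<exists>r>0. williamson n \<nu>' r = t")
            case True
            define s where "s = (SOME r. 0 < r \<and> williamson n \<nu>' r = t)"
            have s: "0 < s \<and> williamson n \<nu>' s = t" unfolding s_def using True by (rule someI_ex)
            have "williamson n \<nu>' r = t \<longleftrightarrow> r = s"
              using b.inj[of r s] s elim 1(3)[of r] by auto
            then show ?thesis using True by (simp add: s_def)
          next
            case False
            then show ?thesis using elim by auto
          qed
        qed
        show "{r. williamson n \<nu>' r = t} \<in> sets \<nu>'"
          using measurable_sets[OF b.williamson_measurable, of "{t}"] by (simp add: b.sets_nu vimage_def)
        show "(if \<exists>r>0. williamson n \<nu>' r = t then {SOME r. 0 < r \<and> williamson n \<nu>' r = t} else {}) \<in> sets \<nu>'"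
          by (simp add: b.sets_nu)
      qed
      also have "\<dots> = 0" using 1(4) by (simp add: measure_def)
      finally show ?thesis .
    qed
    then have "radial_copula n \<nu>' \<notin> heavy_level n q" using q by (simp add: heavy_level_def b.copula_measure_radial_copula)
    moreover have "uniform_dist (Suc n) C (radial_copula n \<nu>') < e"
      unfolding \<nu>(2) by (rule close_radial[OF \<nu>(1) 1(1) e 1(2)])
    ultimately show ?case using b.radial_copula_archimedean by blast
  qed
qed

lemma countable_finite_approx:
  assumes "prob_space M" "countable S" "emeasure M S = 1" "\<And>x. x \<in> S \<Longrightarrow> {x} \<in> sets M" and q: "0 < q"
  shows "\<exists>T\<subseteq>S. finite T \<and> 1 - q < measure M T"
proof -
  interpret prob_space M by fact
  have "S \<noteq> {}" using assms(3) by auto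
  then have range: "range (from_nat_into S) = S" by (rule range_from_nat_into) fact
  let ?T = "\<lambda>k. from_nat_into S ` {..k}"
  have sub: "?T k \<subseteq> S" for k using range by blast
  have sets: "?T k \<in> sets M" for k
  proof (rule sets.countable)
    show "{x} \<in> sets M" if "x \<in> ?T k" for x using assms(4) sub that by blast
    show "countable (?T k)" by (rule countable_finite) simp
  qed
  have "(\<lambda>k. measure M (?T k)) \<longlonglongrightarrow> measure M (\<Union>k. ?T k)"
  proof (rule finite_Lim_measure_incseq)
    show "range ?T \<subseteq> events" using sets by blast
    show "incseq ?T" unfolding incseq_def by (intro allI impI image_mono) simp
  qed
  moreover have "(\<Union>k. ?T k) = S" using range by blast
  moreover have "measure M S = 1" using assms(3) by (simp add: measure_def)
  ultimately have "(\<lambda>k. measure M (?T k)) \<longlonglongrightarrow> 1" by (simp only:)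
  from order_tendstoD(1)[OF this, of "1 - q"] q
  have "eventually (\<lambda>k. 1 - q < measure M (?T k)) sequentially" by simp
  then obtain k where "1 - q < measure M (?T k)" by (auto simp: eventually_sequentially)
  then show ?thesis using sub by (intro exI[of _ "?T k"] conjI finite_imageI) simp_all
qed

lemma not_spreadI:
  assumes "N > 0" "measure (margin_lebesgue n C) (in_cells (Suc n) N K) < q"
    "1 - q < measure (copula_measure (Suc n) C) (in_cells (Suc n) N K)"
  shows "C \<notin> spread n q"
proof
  assume "C \<in> spread n q"
  then have "C \<in> archimedean_copulas (Suc n) \<and> (\<forall>N>0. \<forall>K. measure (margin_lebesgue n C) (in_cells (Suc n) N K) < q \<longrightarrow>
      measure (copula_measure (Suc n) C) (in_cells (Suc n) N K) \<le> 1 - q)"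
    unfolding spread_def mem_Collect_eq .
  from conjunct2[OF this] assms(1,2) have "measure (copula_measure (Suc n) C) (in_cells (Suc n) N K) \<le> 1 - q" by blast
  with assms(3) show False by linarith
qed

lemma not_spreadD:
  assumes C: "C \<in> archimedean_copulas (Suc n)" and ns: "C \<notin> spread n q"
  shows "\<exists>p. measure (margin_lebesgue n C) (in_cells (Suc n) (fst p) (snd p)) < q \<and>
    1 - q < measure (copula_measure (Suc n) C) (in_cells (Suc n) (fst p) (snd p))" (is ?goal)
proof (rule ccontr)
  assume no: "\<not> ?goal"
  have le: "measure (copula_measure (Suc n) C) (in_cells (Suc n) N K) \<le> 1 - q"
    if l: "measure (margin_lebesgue n C) (in_cells (Suc n) N K) < q" for N K
  proof (rule ccontr)
    assume "\<not> measure (copula_measure (Suc n) C) (in_cells (Suc n) N K) \<le> 1 - q"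
    then have g: "1 - q < measure (copula_measure (Suc n) C) (in_cells (Suc n) N K)" by (simp only: not_le)
    have ?goal
      by (rule exI[of _ "(N, K)"]) (use l g in \<open>simp only: fst_conv snd_conv\<close>)
    with no show False by (rule notE)
  qed
  have "C \<in> spread n q" unfolding spread_def by (intro CollectI conjI allI impI C le)
  with ns show False by (rule notE)
qed

text \<open>For a discrete radial law, finitely many atoms carry mass above \<open>1 - q\<close>.
  The corresponding level sets are null for the reference measure, hence so thin when slightly
  thickened that the cells meeting them form a witness against \<open>spread\<close>.\<close>

lemma nowhere_dense_spread:
  assumes n: "n \<ge> 1" and q: "0 < q"
  shows "nowhere_dense_in (arch_top (Suc n)) (spread n q)"
proof (rule nowhere_dense_inI[OF Metric_space_archimedean_copulas])
  show "spread n q \<subseteq> archimedean_copulas (Suc n)" by (auto simp: spread_def)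
next
  fix C assume C: "C \<in> archimedean_copulas (Suc n)"
    and adh: "\<And>e. 0 < e \<Longrightarrow> \<exists>B\<in>spread n q. uniform_dist (Suc n) C B < e"
  have "measure (copula_measure (Suc n) C) (in_cells (Suc n) N K) \<le> 1 - q"
    if N: "N > 0" and less: "measure (margin_lebesgue n C) (in_cells (Suc n) N K) < q" for N K
  proof (rule field_le_epsilon)
    fix e :: real assume e: "0 < e"
    let ?c = "cell_const (Suc n) N"
    \<comment> \<open>The first entry bounds the change of the copula mass by \<open>e\<close>; the
      second keeps the reference mass of the approximating copula below \<open>q\<close>.\<close>
    define g where "g = min e (q - measure (margin_lebesgue n C) (in_cells (Suc n) N K))"
    have g: "0 < g" "g \<le> e" "g \<le> q - measure (margin_lebesgue n C) (in_cells (Suc n) N K)" using e less by (auto simp: g_def)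
    have "0 < g / ?c" using g(1) cell_const_pos by (rule divide_pos_pos)
    then obtain B where B: "B \<in> spread n q" "uniform_dist (Suc n) C B < g / ?c" using adh by blast
    have B': "B \<in> archimedean_copulas (Suc n)" using B(1) by (simp add: spread_def)
    note cc = arch_copula[OF C] arch_copula[OF B']
    have d: "?c * uniform_dist (Suc n) C B < g"
      using B(2) cell_const_pos[of "Suc n" N] by (simp add: pos_less_divide_eq mult.commute)
    have "measure (margin_lebesgue n B) (in_cells (Suc n) N K) < q"
      using margin_lebesgue_cells_diff[OF cc N, of K] d g(3) by linarith
    then have "measure (copula_measure (Suc n) B) (in_cells (Suc n) N K) \<le> 1 - q"
      using B(1) N unfolding spread_def by blast
    then show "measure (copula_measure (Suc n) C) (in_cells (Suc n) N K) \<le> 1 - q + e"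
      using copula_cells_diff[OF cc N, of K] d g(2) by linarith
  qed
  then show "C \<in> spread n q" using C unfolding spread_def by blast
next
  fix C e assume C: "C \<in> spread n q" and e: "(0::real) < e"
  then have "C \<in> archimedean_copulas (Suc n)" by (simp add: spread_def)
  then obtain \<nu> where \<nu>: "radial n \<nu>" "C = radial_copula n \<nu>" using archE[OF n] by blast
  have e': "0 < e / real (n + 3)" using e by simp
  show "\<exists>B\<in>archimedean_copulas (Suc n) - spread n q. uniform_dist (Suc n) C B < e"
  proof (rule discrete_approximation[OF \<nu>(1) e'], goal_cases)
    case (1 \<nu>' S)
    interpret b: radial n \<nu>' by (rule 1(1))
    let ?B = "radial_copula n \<nu>'"
    let ?\<mu> = "copula_law n \<nu>'"
    interpret U: prob_space ?\<mu> by (rule b.prob_space_copula_law)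
    note hl = has_distribution_functionD[OF margin_lebesgue_distribution[OF b.copula_radial_copula]]
    interpret L: prob_space "margin_lebesgue n ?B" by (rule hl(1))
    interpret k: kernel_over n "margin_measure n ?B" "\<lambda>_. unit_lebesgue" by (rule margin_lebesgue_kernel[OF b.copula_radial_copula])
    \<comment> \<open>Finitely many levels are needed for the thickened sets to decrease exactly to
      the union of the level sets.\<close>
    obtain T where T: "T \<subseteq> S" "finite T" "1 - q < measure \<nu>' T"
    proof -
      have "{x} \<in> sets \<nu>'" for x by (simp add: b.sets_nu)
      from countable_finite_approx[OF b.prob 1(4) 1(6) this q] show thesis using that by blast
    qed
    let ?F = "williamson n \<nu>' ` T"
    have fin: "finite ?F" using T(2) by simp
    have F: "?F \<in> sets borel" using fin by (intro borel_closed finite_imp_closed)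
    have Fpos: "0 < t" if "t \<in> ?F" for t using that 1(3) by auto
    define A where "A r = {u \<in> cube (Suc n). ?B u \<in> (\<Union>t\<in>?F. {t - r..t + r})}" for r
    have borelA: "(\<Union>t\<in>?F. {t - r..t + r}) \<in> sets borel" for r
      by (rule sets.finite_UN[OF fin]) simp
    have SA: "A r \<in> sets (margin_lebesgue n ?B)" "A r \<in> sets ?\<mu>" for r
      unfolding A_def hl(2) b.sets_copula_law by (rule b.sets_radial_copula[OF borelA])+
    have ball: "x \<in> {t - r..t + r} \<longleftrightarrow> \<bar>x - t\<bar> \<le> r" for x t r :: real
      unfolding atLeastAtMost_iff by linarith
    have A_iff: "u \<in> A r \<longleftrightarrow> u \<in> cube (Suc n) \<and> (\<exists>t\<in>?F. \<bar>?B u - t\<bar> \<le> r)" for u r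
      unfolding A_def by (simp only: mem_Collect_eq UN_iff ball)
    have A0: "A 0 = {u \<in> cube (Suc n). ?B u \<in> ?F}" unfolding A_def by auto
    have "1 - q < measure \<nu>' {r. williamson n \<nu>' r \<in> ?F}"
    proof (rule less_le_trans[OF T(3) b.nu.finite_measure_mono])
      show "{r. williamson n \<nu>' r \<in> ?F} \<in> b.nu.events"
        using measurable_sets[OF b.williamson_measurable F] by (simp add: b.sets_nu vimage_def)
    qed blast
    then have \<mu>A: "1 - q < measure ?\<mu> (A 0)" unfolding A0 b.measure_level[OF F] .
    have lamA: "emeasure (margin_lebesgue n ?B) (A 0) = 0"
    proof -
      have "emeasure (margin_lebesgue n ?B) (A 0) = (\<integral>\<^sup>+x. emeasure unit_lebesgue (slice n (A 0) x) \<partial>margin_measure n ?B)"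
        unfolding margin_lebesgue_def by (rule k.emeasure_kernel_prod) (use SA(1)[of 0] hl(2) in blast)
      also have "\<dots> = (\<integral>\<^sup>+x. 0 \<partial>margin_measure n ?B)"
      proof (rule nn_integral_cong)
        fix x assume "x \<in> space (margin_measure n ?B)"
        then have x: "x \<in> cube n" by (simp only: k.space_M)
        let ?s = "\<lambda>t. {y \<in> {0..1}. ?B (x(n := y)) = t}"
        have "finite (?s t)" if t: "t \<in> ?F" for t
        proof (cases "?s t = {}")
          case False
          then obtain y where y: "y \<in> ?s t" by blast
          have "?s t \<subseteq> {y}"
          proof
            fix y' assume y': "y' \<in> ?s t"
            have "y = y'"
            proof (rule b.section_unique[OF x])
              show "y \<in> {0..1}" "y' \<in> {0..1}" using y y' by blast+
              show "?B (x(n := y)) = ?B (x(n := y'))" using y y' by simp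
              show "0 < ?B (x(n := y))" using y Fpos[OF t] by simp
            qed
            then show "y' \<in> {y}" by blast
          qed
          then show ?thesis by (rule finite_subset) simp
        qed (simp only: finite.emptyI)
        then have "finite (\<Union>t\<in>?F. ?s t)" by (rule finite_UN_I[OF fin])
        moreover have "slice n (A 0) x \<subseteq> (\<Union>t\<in>?F. ?s t)" unfolding slice_def A0 by blast
        ultimately have fs: "finite (slice n (A 0) x)" by (rule finite_subset[rotated])
        have "emeasure unit_lebesgue (slice n (A 0) x) = emeasure lborel (slice n (A 0) x)"
          by (rule emeasure_restrict_space) (auto simp: slice_def)
        also have "\<dots> = 0" by (rule emeasure_lborel_countable[OF countable_finite[OF fs]])
        finally show "emeasure unit_lebesgue (slice n (A 0) x) = 0" .
      qed
      finally show ?thesis by simp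
    qed
    \<comment> \<open>The radius \<open>(n + 1) / (i + 1)\<close> is the oscillation bound of a
      copula on a cell of the grid with \<open>i + 1\<close> steps.\<close>
    have "(\<lambda>i. measure (margin_lebesgue n ?B) (A (real (Suc n) / real (Suc i)))) \<longlonglongrightarrow> measure (margin_lebesgue n ?B) (\<Inter>i. A (real (Suc n) / real (Suc i)))"
    proof (rule L.finite_Lim_measure_decseq)
      show "range (\<lambda>i. A (real (Suc n) / real (Suc i))) \<subseteq> L.events" using SA(1) by blast
      show "decseq (\<lambda>i. A (real (Suc n) / real (Suc i)))"
        unfolding decseq_def
      proof (intro allI impI)
        fix i j :: nat assume "i \<le> j"
        then have le: "real (Suc n) / real (Suc j) \<le> real (Suc n) / real (Suc i)" by (intro divide_left_mono) auto
        show "A (real (Suc n) / real (Suc j)) \<subseteq> A (real (Suc n) / real (Suc i))"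
        proof
          fix u assume "u \<in> A (real (Suc n) / real (Suc j))"
          then obtain t where t: "u \<in> cube (Suc n)" "t \<in> ?F" "\<bar>?B u - t\<bar> \<le> real (Suc n) / real (Suc j)"
            unfolding A_iff by blast
          from t(3) le have "\<bar>?B u - t\<bar> \<le> real (Suc n) / real (Suc i)" by (rule order_trans)
          with t(1,2) show "u \<in> A (real (Suc n) / real (Suc i))" unfolding A_iff by (intro conjI bexI)
        qed
      qed
    qed
    moreover have "(\<Inter>i. A (real (Suc n) / real (Suc i))) = A 0"
    proof (intro set_eqI iffI)
      fix u assume u: "u \<in> (\<Inter>i. A (real (Suc n) / real (Suc i)))"
      then have "u \<in> A (real (Suc n) / real (Suc 0))" by (rule INT_D) simp
      then have "u \<in> cube (Suc n) \<and> (\<exists>t\<in>?F. \<bar>?B u - t\<bar> \<le> real (Suc n) / real (Suc 0))" by (simp only: A_iff)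
      then have uc: "u \<in> cube (Suc n)" and F0: "?F \<noteq> {}" by blast+
      \<comment> \<open>The distance to the finitely many levels is a minimum; being below every
        radius, it is 0, and some level is attained.\<close>
      define m where "m = Min ((\<lambda>t. \<bar>?B u - t\<bar>) ` ?F)"
      have "m \<in> (\<lambda>t. \<bar>?B u - t\<bar>) ` ?F" unfolding m_def using fin F0 by (intro Min_in) auto
      then obtain t where t: "t \<in> ?F" "m = \<bar>?B u - t\<bar>" by blast
      have bound: "m \<le> real (Suc n) / real (Suc i)" for i
      proof -
        have "u \<in> A (real (Suc n) / real (Suc i))" using u by (rule INT_D) simp
        then obtain s where s: "s \<in> ?F" "\<bar>?B u - s\<bar> \<le> real (Suc n) / real (Suc i)"
          unfolding A_iff by blast
        have "m \<le> \<bar>?B u - s\<bar>" unfolding m_def by (rule Min_le) (use fin s(1) in auto)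
        also have "\<dots> \<le> real (Suc n) / real (Suc i)" by (rule s(2))
        finally show ?thesis .
      qed
      have "(\<lambda>i. real (Suc n) / real (Suc i)) \<longlonglongrightarrow> 0" by (rule LIMSEQ_Suc[OF lim_const_over_n])
      then have "m \<le> 0" by (rule LIMSEQ_le_const) (intro exI[of _ 0] allI impI bound)
      then have "\<bar>?B u - t\<bar> \<le> 0" by (simp only: t(2))
      with uc t(1) show "u \<in> A 0" unfolding A_iff by (intro conjI bexI)
    next
      fix u assume u: "u \<in> A 0"
      show "u \<in> (\<Inter>i. A (real (Suc n) / real (Suc i)))"
      proof (rule INT_I)
        fix i
        have le: "0 \<le> real (Suc n) / real (Suc i)" by simp
        from u obtain t where t: "u \<in> cube (Suc n)" "t \<in> ?F" "\<bar>?B u - t\<bar> \<le> 0" unfolding A_iff by blast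
        from t(3) le have "\<bar>?B u - t\<bar> \<le> real (Suc n) / real (Suc i)" by (rule order_trans)
        with t(1,2) show "u \<in> A (real (Suc n) / real (Suc i))" unfolding A_iff by (intro conjI bexI)
      qed
    qed
    moreover have "measure (margin_lebesgue n ?B) (A 0) = 0" using lamA by (simp add: measure_def)
    ultimately have "(\<lambda>i. measure (margin_lebesgue n ?B) (A (real (Suc n) / real (Suc i)))) \<longlonglongrightarrow> 0" by (simp only:)
    then have "eventually (\<lambda>i. measure (margin_lebesgue n ?B) (A (real (Suc n) / real (Suc i))) < q) sequentially"
      by (rule order_tendstoD(2)) (rule q)
    then obtain i where i: "measure (margin_lebesgue n ?B) (A (real (Suc n) / real (Suc i))) < q"
      by (auto simp: eventually_sequentially)
    let ?K = "grid (Suc n) (Suc i) ` A 0"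
    let ?G = "in_cells (Suc n) (Suc i) ?K"
    have "measure (margin_lebesgue n ?B) ?G < q"
    proof (rule le_less_trans[OF L.finite_measure_mono[OF _ SA(1)] i])
      show "?G \<subseteq> A (real (Suc n) / real (Suc i))"
      proof
        fix u assume u: "u \<in> ?G"
        then obtain w where w: "w \<in> A 0" "grid (Suc n) (Suc i) u = grid (Suc n) (Suc i) w" by blast
        have c1: "u \<in> cube (Suc n)" using u by simp
        from w(1) have c2: "w \<in> cube (Suc n)" and wF: "?B w \<in> ?F" unfolding A0 by simp_all
        note c = c1 c2
        have "\<bar>?B u - ?B w\<bar> \<le> real (Suc n) / real (Suc i)"
          by (rule grid_eq_copula[OF b.copula_radial_copula c w(2)]) simp
        with wF c1 show "u \<in> A (real (Suc n) / real (Suc i))" unfolding A_iff by (intro conjI bexI)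
      qed
    qed
    moreover have "1 - q < measure ?\<mu> ?G"
    proof (rule less_le_trans[OF \<mu>A U.finite_measure_mono])
      show "A 0 \<subseteq> ?G"
      proof
        fix u assume u: "u \<in> A 0"
        then have "u \<in> cube (Suc n)" unfolding A0 by simp
        then show "u \<in> ?G" using imageI[OF u] by (intro CollectI conjI)
      qed
      show "?G \<in> U.events" unfolding b.sets_copula_law by (rule sets_grid)
    qed
    ultimately have "?B \<notin> spread n q"
      unfolding b.copula_measure_radial_copula[symmetric] by (rule not_spreadI[OF zero_less_Suc])
    moreover have "uniform_dist (Suc n) C ?B < e"
      unfolding \<nu>(2) by (rule close_radial[OF \<nu>(1) 1(1) e 1(2)])
    ultimately show ?case using b.radial_copula_archimedean by blast
  qed
qed

section \<open>Copulas outside the exceptional sets\<close>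

lemma support_of_cells:
  assumes hd: "has_distribution_function d M C"
    and pos: "\<And>N k. N > 0 \<Longrightarrow> k \<in> {..<d} \<rightarrow>\<^sub>E {1..int N} \<Longrightarrow> measure M (in_cells d N {k}) \<noteq> 0"
  shows "measure_support (cube_topology d) M = cube d"
proof -
  note hM = has_distribution_functionD[OF hd]
  interpret prob_space M by (rule hM(1))
  have "U = {}" if U: "openin (cube_topology d) U" and z: "emeasure M U = 0" for U
  proof (rule ccontr)
    assume "U \<noteq> {}"
    have Uc: "U \<subseteq> cube d" using openin_subset[OF U] by (simp only: topspace_cube_topology)
    have nbhd: "\<exists>r>0. \<forall>v\<in>cube d. (\<forall>i<d. \<bar>u i - v i\<bar> < r) \<longrightarrow> v \<in> U" if u: "u \<in> U" for u
    proof -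
      obtain V where V: "finite {i \<in> {..<d}. V i \<noteq> topspace (top_of_set {0..1::real})}"
        "\<forall>i\<in>{..<d}. openin (top_of_set {0..1::real}) (V i)" "u \<in> Pi\<^sub>E {..<d} V" "Pi\<^sub>E {..<d} V \<subseteq> U"
        using U u unfolding openin_product_topology_alt by meson
      have "\<exists>r>0. \<forall>y\<in>{0..1}. \<bar>u i - y\<bar> < r \<longrightarrow> y \<in> V i" if i: "i \<in> {..<d}" for i
      proof -
        have "u i \<in> V i" using V(3) i by (rule PiE_mem)
        then obtain r where "r > 0" "\<forall>y\<in>{0..1}. dist y (u i) < r \<longrightarrow> y \<in> V i"
          using bspec[OF V(2) i] unfolding openin_euclidean_subtopology_iff by blast
        then show ?thesis by (intro exI[of _ r]) (auto simp: dist_real_def abs_minus_commute)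
      qed
      then obtain r where r: "\<And>i. i \<in> {..<d} \<Longrightarrow> 0 < r i"
        "\<And>i y. i \<in> {..<d} \<Longrightarrow> y \<in> {0..1} \<Longrightarrow> \<bar>u i - y\<bar> < r i \<Longrightarrow> y \<in> V i" by metis
      define s where "s = Min (insert 1 (r ` {..<d}))"
      have s: "0 < s" "\<And>i. i \<in> {..<d} \<Longrightarrow> s \<le> r i"
        unfolding s_def using r(1) by (auto simp: Min_gr_iff)
      have "v \<in> U" if v: "v \<in> cube d" "\<forall>i<d. \<bar>u i - v i\<bar> < s" for v
      proof -
        have "v \<in> Pi\<^sub>E {..<d} V"
        proof (rule PiE_I)
          fix i assume i: "i \<in> {..<d}"
          have "v i \<in> {0..1}" using cubeD[OF v(1)] i by simp
          moreover have "\<bar>u i - v i\<bar> < r i" using v(2) i s(2)[OF i] by force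
          ultimately show "v i \<in> V i" using r(2)[OF i] by blast
        next
          fix i assume "i \<notin> {..<d}"
          then show "v i = undefined" using v(1) unfolding cube_def by (rule PiE_arb[rotated])
        qed
        then show ?thesis using V(4) by blast
      qed
      then show ?thesis using s(1) by blast
    qed
    have cell: "\<exists>N>0. in_cells d N {grid d N u} \<subseteq> U" if u: "u \<in> U" for u
    proof -
      obtain r where r: "r > 0" "\<And>v. v \<in> cube d \<Longrightarrow> \<forall>i<d. \<bar>u i - v i\<bar> < r \<Longrightarrow> v \<in> U"
        using nbhd[OF u] by blast
      obtain N where N: "N > 0" "1 / real N < r"
      proof -
        obtain m where m: "inverse (real (Suc m)) < r" using reals_Archimedean[OF r(1)] by blast
        show thesis by (rule that[of "Suc m"]) (use m in \<open>simp_all add: inverse_eq_divide\<close>)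
      qed
      have "in_cells d N {grid d N u} \<subseteq> U"
      proof
        fix v assume v: "v \<in> in_cells d N {grid d N u}"
        have "\<bar>u i - v i\<bar> < r" if "i < d" for i
        proof -
          have "grid d N u = grid d N v" using v by simp
          then have "\<bar>u i - v i\<bar> \<le> 1 / real N" by (rule grid_eq_dist[OF _ N(1) that])
          then show ?thesis using N(2) by linarith
        qed
        then show "v \<in> U" using r(2) v by blast
      qed
      then show ?thesis using N(1) by blast
    qed
    \<comment> \<open>A null value of \<open>emeasure\<close> could also come from a set that is not
      measurable. Writing \<open>U\<close> as a countable union of cells excludes this.\<close>
    let ?I = "{(N, k). N > 0 \<and> k \<in> cells d N \<and> in_cells d N {k} \<subseteq> U}"
    have "countable (SIGMA N:UNIV. cells d N)"
      by (rule countable_SIGMA) (auto intro: countable_finite finite_cells)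
    then have cI: "countable ?I" by (rule countable_subset[rotated]) blast
    have "(\<Union>(N, k)\<in>?I. in_cells d N {k}) \<in> sets M"
    proof (rule sets.countable_UN'[OF cI], rule image_subsetI)
      fix p
      show "(case p of (N, k) \<Rightarrow> in_cells d N {k}) \<in> sets M"
        unfolding hM(2) by (cases p) (simp only: split_conv sets_grid)
    qed
    moreover have "(\<Union>(N, k)\<in>?I. in_cells d N {k}) = U"
    proof
      show "U \<subseteq> (\<Union>(N, k)\<in>?I. in_cells d N {k})"
      proof
        fix u assume u: "u \<in> U"
        obtain N where N: "N > 0" "in_cells d N {grid d N u} \<subseteq> U" using cell[OF u] by blast
        have "u \<in> cube d" using u Uc by blast
        then have "grid d N u \<in> cells d N" by (rule grid_in_cells)
        with N have "(N, grid d N u) \<in> ?I" by blast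
        moreover have "u \<in> in_cells d N {grid d N u}" using \<open>u \<in> cube d\<close> by blast
        ultimately show "u \<in> (\<Union>(N, k)\<in>?I. in_cells d N {k})" by blast
      qed
    qed blast
    ultimately have Um: "U \<in> sets M" by (simp only:)
    obtain u where u: "u \<in> U" using \<open>U \<noteq> {}\<close> by blast
    obtain r where r: "r > 0" "\<And>v. v \<in> cube d \<Longrightarrow> \<forall>i<d. \<bar>u i - v i\<bar> < r \<Longrightarrow> v \<in> U"
      using nbhd[OF u] by blast
    have uc: "u \<in> cube d" using u Uc by blast
    \<comment> \<open>Moves a point of \<open>U\<close> off the faces through 0 by less than
      \<open>r\<close>, so that its cell has all indices at least 1.\<close>
    define w where "w = (\<lambda>i\<in>{..<d}. max (u i) (min (r / 2) 1))"
    have wc: "w \<in> cube d" unfolding w_def cube_def using cubeD[OF uc] r(1) by (auto simp: max_def min_def)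
    have "\<bar>u i - w i\<bar> < r" if "i < d" for i
      using that r(1) cubeD[OF uc that] by (auto simp: w_def max_def min_def)
    then have "w \<in> U" by (intro r(2) wc) blast
    then obtain N where N: "N > 0" "in_cells d N {grid d N w} \<subseteq> U" using cell by blast
    have "grid d N w \<in> {..<d} \<rightarrow>\<^sub>E {1..int N}"
    proof (rule PiE_I)
      fix i assume i: "i \<in> {..<d}"
      have "0 < w i" using i r(1) by (auto simp: w_def less_max_iff_disj)
      then have "0 < real N * w i" using N(1) by simp
      then have "1 \<le> grid d N w i" using i by (simp add: grid_def)
      moreover have "grid d N w i \<le> int N"
        using grid_in_cells[OF wc, of N] i unfolding cells_def by (auto simp: PiE_iff)
      ultimately show "grid d N w i \<in> {1..int N}" by simp
    next
      fix i assume "i \<notin> {..<d}"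
      then show "grid d N w i = undefined" by (simp add: grid_def)
    qed
    from pos[OF N(1) this] have "0 < measure M (in_cells d N {grid d N w})"
      by (simp add: zero_less_measure_iff)
    also have "\<dots> \<le> measure M U" by (rule finite_measure_mono[OF N(2) Um])
    finally show False using z by (simp add: measure_def)
  qed
  then show ?thesis unfolding measure_support_def topspace_cube_topology by blast
qed

text \<open>The witnesses for \<open>(1 / 2) ^ j\<close> have summable reference masses, and their
  complements have summable copula masses. By Borel-Cantelli, the set of points lying in all but
  finitely many witnesses is null for the first measure and of full mass for the second.\<close>

lemma singular_of_spread:
  assumes C: "C \<in> archimedean_copulas (Suc n)" and ns: "\<And>j. C \<notin> spread n ((1 / 2) ^ j)"
  obtains A where "A \<in> sets (cube_borel (Suc n))" "emeasure (margin_lebesgue n C) A = 0"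
    "emeasure (copula_measure (Suc n) C) (cube (Suc n) - A) = 0"
proof -
  note c = arch_copula[OF C]
  let ?M = "copula_measure (Suc n) C"
  note hM = has_distribution_functionD[OF copula_measureD(1)[OF c]]
  note hL = has_distribution_functionD[OF margin_lebesgue_distribution[OF c]]
  interpret M: prob_space ?M by (rule hM(1))
  interpret L: prob_space "margin_lebesgue n C" by (rule hL(1))
  have "\<forall>j. \<exists>p. measure (margin_lebesgue n C) (in_cells (Suc n) (fst p) (snd p)) < (1 / 2) ^ j \<and>
      1 - (1 / 2) ^ j < measure ?M (in_cells (Suc n) (fst p) (snd p))"
    by (intro allI not_spreadD[OF C ns])
  from choice[OF this] obtain p
    where p: "\<forall>j. measure (margin_lebesgue n C) (in_cells (Suc n) (fst (p j)) (snd (p j))) < (1 / 2) ^ j \<and>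
      1 - (1 / 2) ^ j < measure ?M (in_cells (Suc n) (fst (p j)) (snd (p j)))" ..
  note NK = spec[OF p, THEN conjunct1] spec[OF p, THEN conjunct2]
  define G where "G j = in_cells (Suc n) (fst (p j)) (snd (p j))" for j
  have SG: "G j \<in> sets (cube_borel (Suc n))" for j unfolding G_def by (rule sets_grid)
  have GL: "G j \<in> sets (margin_lebesgue n C)" and GM: "G j \<in> sets ?M" for j using SG hL(2) hM(2) by simp_all
  have sum: "summable (\<lambda>j. (1 / 2 :: real) ^ j)" by (rule summable_geometric) simp
  have "AE x in margin_lebesgue n C. eventually (\<lambda>j. x \<in> space (margin_lebesgue n C) - G j) sequentially"
  proof (rule borel_cantelli_AE1)
    show "summable (\<lambda>j. measure (margin_lebesgue n C) (G j))"
    proof (rule summable_comparison_test'[OF sum])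
      fix j show "norm (measure (margin_lebesgue n C) (G j)) \<le> (1 / 2) ^ j" using NK(1)[of j] by (simp add: G_def)
    qed
  qed (use GL in \<open>simp_all add: L.emeasure_eq_measure\<close>)
  then have aeL: "AE x in margin_lebesgue n C. eventually (\<lambda>j. x \<notin> G j) sequentially"
    by eventually_elim (auto elim: eventually_mono)
  have "AE x in ?M. eventually (\<lambda>j. x \<in> space ?M - (space ?M - G j)) sequentially"
  proof (rule borel_cantelli_AE1)
    show "summable (\<lambda>j. measure ?M (space ?M - G j))"
    proof (rule summable_comparison_test'[OF sum])
      fix j
      have "measure ?M (space ?M - G j) = 1 - measure ?M (G j)" by (rule M.prob_compl[OF GM])
      then show "norm (measure ?M (space ?M - G j)) \<le> (1 / 2) ^ j" using NK(2)[of j] by (simp add: G_def)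
    qed
  qed (use GM in \<open>simp_all add: M.emeasure_eq_measure sets.compl_sets\<close>)
  then have aeM: "AE x in ?M. eventually (\<lambda>j. x \<in> G j) sequentially"
    by eventually_elim (auto elim: eventually_mono)
  define A where "A = (\<Union>i. \<Inter>j\<in>{i..}. G j)"
  have A_iff: "x \<in> A \<longleftrightarrow> eventually (\<lambda>j. x \<in> G j) sequentially" for x
    unfolding A_def by (auto simp: eventually_sequentially)
  have SA: "A \<in> sets (cube_borel (Suc n))"
    unfolding A_def by (intro sets.countable_UN sets.countable_INT' image_subsetI) (use SG in auto)
  have "AE x in margin_lebesgue n C. x \<notin> A"
    using aeL
  proof eventually_elim
    case (elim x)
    show ?case
    proof
      assume "x \<in> A"
      then have "eventually (\<lambda>j. False) sequentially"
        using elim unfolding A_iff by eventually_elim simp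
      then show False by simp
    qed
  qed
  then have "A \<in> null_sets (margin_lebesgue n C)" using SA hL(2) by (subst AE_iff_null_sets) (simp_all only:)
  moreover have "AE x in ?M. x \<notin> cube (Suc n) - A" using aeM by eventually_elim (use A_iff in blast)
  then have "cube (Suc n) - A \<in> null_sets ?M"
  proof (subst AE_iff_null_sets)
    have "space ?M - A \<in> sets ?M" by (rule sets.compl_sets) (simp only: hM(2) SA)
    then show "cube (Suc n) - A \<in> sets ?M" by (simp only: hM(3))
  qed
  ultimately show ?thesis by (intro that[OF SA] null_setsD1)
qed

text \<open>The absolutely continuous part vanishes altogether, which is more than failing to have
  mass 1.\<close>

lemma typical_parts:
  assumes n: "n \<ge> 1" and C: "C \<in> archimedean_copulas (Suc n)"
    and nh: "\<And>j. C \<notin> heavy_level n (1 / real (Suc j))" and ns: "\<And>j. C \<notin> spread n ((1 / 2) ^ j)"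
  shows "emeasure (copula_dis (Suc n) C) (cube (Suc n)) = 0"
    "emeasure (copula_abs (Suc n) C) (cube (Suc n)) = 0"
proof -
  note c = arch_copula[OF C]
  obtain \<nu> where \<nu>: "radial n \<nu>" "C = radial_copula n \<nu>" using archE[OF n C] by blast
  interpret radial n \<nu> by (rule \<nu>(1))
  have atomless: "emeasure \<nu> {r} = 0" for r
  \<comment> \<open>An atom of the radius at \<open>r\<close> puts at least its mass on the level
    set of the copula at \<open>williamson n \<nu> r\<close>; a number \<open>1 / (j + 1)\<close>
    below that mass contradicts the assumption on heavy levels.\<close>
  proof (rule ccontr)
    assume "emeasure \<nu> {r} \<noteq> 0"
    then have "0 < measure \<nu> {r}" by (simp add: nu.emeasure_eq_measure zero_less_measure_iff)
    then obtain j where j: "inverse (real (Suc j)) < measure \<nu> {r}" using reals_Archimedean by blast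
    have "measure \<nu> {r} \<le> measure \<nu> {s. williamson n \<nu> s \<in> {williamson n \<nu> r}}"
      by (rule nu.finite_measure_mono)
         (use measurable_sets[OF williamson_measurable, of "{williamson n \<nu> r}"] in \<open>auto simp: sets_nu vimage_def\<close>)
    also have "\<dots> = measure (copula_law n \<nu>) {u \<in> cube (Suc n). radial_copula n \<nu> u \<in> {williamson n \<nu> r}}"
      by (rule measure_level[symmetric]) simp
    finally have "1 / real (Suc j) \<le> measure (copula_measure (Suc n) C) {u \<in> cube (Suc n). C u = williamson n \<nu> r}"
      using j by (simp add: \<nu>(2) copula_measure_radial_copula inverse_eq_divide)
    then have "C \<in> heavy_level n (1 / real (Suc j))" using C unfolding heavy_level_def by blast
    then show False using nh by blast
  qed
  let ?K = "conditional_kernel (Suc n) C"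
  let ?M = "margin_measure n C"
  have ck: "is_conditional_kernel (Suc n) C ?K"
    unfolding conditional_kernel_def \<nu>(2)
    by (rule someI[where P="is_conditional_kernel (Suc n) (radial_copula n \<nu>)", OF conditional_kernel_gap])
  note ko = conditional_kernelD[OF c ck]
  interpret k: kernel_over n ?M ?K by (rule ko(1))
  interpret l: kernel_over n ?M "\<lambda>_. unit_lebesgue" by (rule margin_lebesgue_kernel[OF c])
  obtain A where A: "A \<in> sets (cube_borel (Suc n))" "emeasure (margin_lebesgue n C) A = 0"
    "emeasure (copula_measure (Suc n) C) (cube (Suc n) - A) = 0"
  proof (rule singular_of_spread[OF C ns], goal_cases)
    case (1 A)
    from 1(1)[OF 1(2-)] show ?case .
  qed
  have cA: "cube (Suc n) - A \<in> sets (cube_borel (Suc n))"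
    using sets.compl_sets[OF A(1)] by (simp only: space_cube_borel)
  have "AE x in ?M. emeasure unit_lebesgue (slice n A x) = 0"
    by (rule kernel_AE_null[OF margin_lebesgue_kernel[OF c] A(1)]) (use A(2) in \<open>simp only: margin_lebesgue_def\<close>)
  moreover have "AE x in ?M. emeasure (?K x) (slice n (cube (Suc n) - A) x) = 0"
    by (rule kernel_AE_null[OF ko(1) cA]) (simp only: ko(2) A(3))
  moreover have "AE x in ?M. \<forall>y. emeasure (?K x) {y} = 0"
    unfolding \<nu>(2) by (rule conditional_kernel_atomless[OF atomless])
  moreover have "AE x in ?M. x \<in> cube n" by (rule AE_I2) (simp only: k.space_M)
  ultimately have parts: "AE x in ?M. abs_part (?K x) = null_measure unit_borel \<and> dis_part (?K x) = null_measure unit_borel"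
  proof eventually_elim
    case (elim x)
    have x: "x \<in> cube n" by (rule elim(4))
    have sA: "slice n A x \<in> sets unit_borel" by (rule k.slice_measurable[OF A(1) x])
    have lA: "emeasure lborel (slice n A x) = 0"
    proof -
      have "emeasure unit_lebesgue (slice n A x) = emeasure lborel (slice n A x)"
        by (rule emeasure_restrict_space) (auto simp: slice_def)
      then show ?thesis using elim(1) by simp
    qed
    have "x(n := y) \<in> cube (Suc n)" if "y \<in> {0..1}" for y
      using x that by (auto simp: cube_def PiE_iff extensional_def less_Suc_eq)
    then have "slice n (cube (Suc n) - A) x = {0..1} - slice n A x" unfolding slice_def by blast
    with elim(2) have KA: "emeasure (?K x) ({0..1} - slice n A x) = 0" by (simp only:)
    show ?case
      using null_parts[OF k.KD(1,2)[OF x] _ sA lA KA] elim(3) by blast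
  qed
  have dis: "AE x in ?M. dis_part (?K x) = null_measure unit_borel" using parts by eventually_elim blast
  have abs: "AE x in ?M. abs_part (?K x) = null_measure unit_borel" using parts by eventually_elim blast
  show "emeasure (copula_dis (Suc n) C) (cube (Suc n)) = 0"
    unfolding copula_dis_def by (rule kernel_measure_null[OF c dis])
  show "emeasure (copula_abs (Suc n) C) (cube (Suc n)) = 0"
    unfolding copula_abs_def by (rule kernel_measure_null[OF c abs])
qed

theorem corollary6p14:
  fixes d :: nat
  assumes "d \<ge> 2"
  shows "comeager_in (Metric_space.mtopology (archimedean_copulas d) (uniform_dist d))
    {C \<in> archimedean_copulas d.
       measure_support (cube_topology d) (copula_measure d C) = cube d \<and>
       emeasure (copula_dis d C) (cube d) = 0 \<and>
       \<not> absolutely_continuous_copula d C}"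
proof -
  obtain n where d: "d = Suc n" and n: "n \<ge> 1" using assms by (cases d) auto
  interpret Metric_space "archimedean_copulas d" "uniform_dist d" by (rule Metric_space_archimedean_copulas)
  let ?G = "{C \<in> archimedean_copulas d.
       measure_support (cube_topology d) (copula_measure d C) = cube d \<and>
       emeasure (copula_dis d C) (cube d) = 0 \<and> \<not> absolutely_continuous_copula d C}"
  \<comment> \<open>\<open>Suc N\<close> ranges over the positive grid sizes; for each of them there
    are finitely many indices, so the family is countable.\<close>
  let ?E = "(\<Union>N. \<Union>k\<in>{..<Suc n} \<rightarrow>\<^sub>E {1..int (Suc N)}. {empty_cell n (Suc N) k})"
  let ?F = "?E \<union> range (\<lambda>j. heavy_level n (1 / real (Suc j))) \<union> range (\<lambda>j. spread n ((1 / 2) ^ j))"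
  have "countable ?F"
    by (intro countable_Un countable_UN countable_image) (auto intro!: countable_finite finite_PiE)
  moreover have "nowhere_dense_in mtopology A" if "A \<in> ?F" for A
  proof -
    from that consider (e) "A \<in> ?E" | (h) "A \<in> range (\<lambda>j. heavy_level n (1 / real (Suc j)))"
      | (s) "A \<in> range (\<lambda>j. spread n ((1 / 2) ^ j))" by (elim UnE)
    then show ?thesis
    proof cases
      case e
      then obtain N k where k: "k \<in> {..<Suc n} \<rightarrow>\<^sub>E {1..int (Suc N)}" "A = empty_cell n (Suc N) k"
        by (elim UN_E singletonE) (rule that)
      show ?thesis unfolding k(2) d by (rule nowhere_dense_empty_cell[OF n _ k(1)]) simp
    next
      case h
      then obtain j where j: "A = heavy_level n (1 / real (Suc j))" by (rule rangeE)
      show ?thesis unfolding j d by (rule nowhere_dense_heavy_level[OF n]) simp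
    next
      case s
      then obtain j where j: "A = spread n ((1 / 2) ^ j)" by (rule rangeE)
      show ?thesis unfolding j d by (rule nowhere_dense_spread[OF n]) simp
    qed
  qed
  moreover have "topspace mtopology - ?G \<subseteq> \<Union>?F"
  proof
    fix C assume C: "C \<in> topspace mtopology - ?G"
    then have "C \<in> topspace mtopology" by blast
    then have "C \<in> archimedean_copulas d" by (simp only: topspace_mtopology)
    then have Ca: "C \<in> archimedean_copulas (Suc n)" by (simp only: d)
    show "C \<in> \<Union>?F"
    proof (rule ccontr)
      assume nF: "C \<notin> \<Union>?F"
      have nA: "C \<notin> A" if "A \<in> ?F" for A using nF UnionI[OF that] by (rule contrapos_nn)
      have nh: "C \<notin> heavy_level n (1 / real (Suc j))" for j by (rule nA) (rule UnI1[OF UnI2[OF rangeI]])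
      have ns: "C \<notin> spread n ((1 / 2) ^ j)" for j by (rule nA) (rule UnI2[OF rangeI])
      have ne: "C \<notin> empty_cell n N k" if N: "N > 0" and k: "k \<in> {..<Suc n} \<rightarrow>\<^sub>E {1..int N}" for N k
      proof -
        obtain N' where N': "N = Suc N'" using N by (cases N) auto
        have k': "k \<in> {..<Suc n} \<rightarrow>\<^sub>E {1..int (Suc N')}" using k by (simp only: N')
        show ?thesis unfolding N'
          by (rule nA) (rule UnI1, rule UnI1, rule UN_I[OF UNIV_I], rule UN_I[OF k'], rule singletonI)
      qed
      have "measure_support (cube_topology (Suc n)) (copula_measure (Suc n) C) = cube (Suc n)"
      proof (rule support_of_cells[OF copula_measureD(1)[OF arch_copula[OF Ca]]])
        fix N k assume "0 < N" "k \<in> {..<Suc n} \<rightarrow>\<^sub>E {1..int N}"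
        from ne[OF this] show "measure (copula_measure (Suc n) C) (in_cells (Suc n) N {k}) \<noteq> 0"
          using Ca unfolding empty_cell_def by blast
      qed
      moreover have "emeasure (copula_dis (Suc n) C) (cube (Suc n)) = 0" by (rule typical_parts(1)[OF n Ca nh ns])
      moreover have "\<not> absolutely_continuous_copula (Suc n) C"
        unfolding absolutely_continuous_copula_def typical_parts(2)[OF n Ca nh ns] by simp
      ultimately have "C \<in> ?G" unfolding d using Ca by blast
      then show False using C by blast
    qed
  qed
  ultimately have "meager_in mtopology (topspace mtopology - ?G)"
    unfolding meager_in_def by (intro exI[of _ ?F]) blast
  moreover have "?G \<subseteq> topspace mtopology" by auto
  ultimately show ?thesis unfolding comeager_in_def by blast
qed

end
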